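(* Let $N\ge3$. Assume $f\in C^0([0,\infty))\cap C^2((0,\infty))$ is nondecreasing and convex, $f>0$ in $(0,\infty)$, $f(0)=0$, and the limit $q_0=\lim_{u\to0^+}q(u)$ exists in $\overline{\mathbb{R}}$; let $p_0$ be the conjugate exponent of $q_0$. Assume that $p_0$ is in the supercritical range, i.e. $$\frac{N+2}{N-2}<p_0<+\infty\ \text{ if } 3\le N\le10,\qquad \frac{N+2}{N-2}<p_0<p_c(N)\ \text{ if } N\ge11,$$ and that there exist constants $\varepsilon,c_1,c_2>0$ such that $$f(u)\ge c_1u^{p_0}\quad\text{and}\quad f'(u)\le c_2u^{p_0-1}\qquad\text{for all } u\in(0,\varepsilon).$$ Then any bounded positive solution $u\in C^2(\mathbb{R}^N)$ of $-\Delta u=f(u)$ in $\mathbb{R}^N$ which is stable outside a compact set satisfies $$u(x)=o\left(|x|^{-\frac{2}{p_0-1}}\right)\quad\text{and}\quad|\nabla u(x)|=o\left(|x|^{-\frac2{p_0-1}-1}\right)\qquad\text{as }|x|\to\infty.$$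
   Context: For $u>0$, $q(u)=\dfrac{f'(u)^2}{f(u)f''(u)}$ if $f(u)f''(u)\ne0$, and $q(u)=+\infty$ otherwise. The conjugate exponent $p_0\in\overline{\mathbb{R}}$ of $q_0$ is defined by $1/p_0+1/q_0=1$, i.e. $p_0=q_0/(q_0-1)$ if $q_0\notin\{1,+\infty\}$, $p_0=+\infty$ if $q_0=1$, $p_0=1$ if $q_0=+\infty$. For $N\ge 11$, $p_c(N)=\dfrac{(N-2)^2-4N+8\sqrt{N-1}}{(N-2)(N-10)}$. A solution $u$ of $-\Delta u=f(u)$ in $\mathbb{R}^N$ is stable outside a compact set if there is a compact set $K\subset\mathbb{R}^N$ such that $\int_{\mathbb{R}^N} f'(u)\varphi^2\,dx\le\int_{\mathbb{R}^N}|\nabla\varphi|^2\,dx$ for all $\varphi\in C^1_c(\mathbb{R}^N\setminus K)$. *)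

theory Defs
  imports "HOL-Analysis.Analysis" "HOL-Library.Landau_Symbols"
begin

definition partial_deriv :: "'a \<Rightarrow> ('a::euclidean_space \<Rightarrow> real) \<Rightarrow> 'a \<Rightarrow> real"
  where "partial_deriv b u x = frechet_derivative u (at x) b"

definition grad :: "('a::euclidean_space \<Rightarrow> real) \<Rightarrow> 'a \<Rightarrow> 'a"
  where "grad u x = (\<Sum>b\<in>Basis. partial_deriv b u x *\<^sub>R b)"

definition laplacian :: "('a::euclidean_space \<Rightarrow> real) \<Rightarrow> 'a \<Rightarrow> real"
  where "laplacian u x = (\<Sum>b\<in>Basis. partial_deriv b (partial_deriv b u) x)"

definition C1 :: "('a::euclidean_space \<Rightarrow> real) \<Rightarrow> bool"
  where "C1 u \<longleftrightarrow> (\<forall>x. u differentiable (at x)) \<and>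
           (\<forall>b\<in>Basis. continuous_on UNIV (partial_deriv b u))"

definition C2 :: "('a::euclidean_space \<Rightarrow> real) \<Rightarrow> bool"
  where "C2 u \<longleftrightarrow> C1 u \<and> (\<forall>b\<in>Basis. C1 (partial_deriv b u))"

definition C2_pos :: "(real \<Rightarrow> real) \<Rightarrow> bool"
  where "C2_pos f \<longleftrightarrow> (\<forall>t>0. f differentiable (at t)) \<and>
           (\<forall>t>0. deriv f differentiable (at t)) \<and>
           continuous_on {0<..} (deriv (deriv f))"

text \<open>Elements of \<open>C\<^sup>1\<^sub>c(A)\<close>, for \<open>A\<close> open, are represented by their extension by zero
  to the whole space.\<close>

definition C1c :: "'a::euclidean_space set \<Rightarrow> ('a \<Rightarrow> real) set"
  where "C1c A = {\<phi>. C1 \<phi> \<and> compact (closure (support_on UNIV \<phi>)) \<and>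
                     closure (support_on UNIV \<phi>) \<subseteq> A}"

definition stable_outside_compact ::
  "(real \<Rightarrow> real) \<Rightarrow> ('a::euclidean_space \<Rightarrow> real) \<Rightarrow> bool"
  where "stable_outside_compact f u \<longleftrightarrow>
    (\<exists>K. compact K \<and>
      (\<forall>\<phi>\<in>C1c (- K).
        (\<integral>x. deriv f (u x) * (\<phi> x)\<^sup>2 \<partial>lborel) \<le> (\<integral>x. (norm (grad \<phi> x))\<^sup>2 \<partial>lborel)))"

definition q_fun :: "(real \<Rightarrow> real) \<Rightarrow> real \<Rightarrow> ereal"
  where "q_fun f t =
    (if f t * deriv (deriv f) t \<noteq> 0
     then ereal ((deriv f t)\<^sup>2 / (f t * deriv (deriv f) t)) else \<infinity>)"

text \<open>The value at \<open>-\<infinity>\<close> is irrelevant: for \<open>f\<close> nonnegative and convex, \<open>q_fun f\<close> is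
  nonnegative on the positive reals, hence so is its limit at \<open>0\<close>.\<close>

definition conjugate_exponent :: "ereal \<Rightarrow> ereal"
  where "conjugate_exponent q = (if q = 1 then \<infinity> else if q = \<infinity> then 1 else q / (q - 1))"

definition p_c :: "nat \<Rightarrow> real"
  where "p_c N = ((real N - 2)\<^sup>2 - 4 * real N + 8 * sqrt (real N - 1)) /
                 ((real N - 2) * (real N - 10))"

end

(* A stable solution satisfies an energy estimate: testing stability with \<phi>(u) \<psi> and the equation with
   K(u) \<psi>^2, where \<phi> behaves like f^\<alpha> near 0 and K' dominates \<phi>'^2, gives
   \<integral> u^\<sigma> \<psi>^2 \<le> C \<integral> u^(\<sigma>-p+1) |\<nabla>\<psi>|^2 for \<sigma> = 2 \<alpha> p + p - 1, whenever (\<alpha> - 1)^2 < 1 - 1/p.  Since u is bounded, \<phi>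
   and K can be continued to all values of u, so it need not be known beforehand that u tends to 0.
   In the supercritical range the scale invariant exponent \<sigma>0 = N (p - 1) / 2 and slightly larger ones
   are admissible.  Hence u^\<sigma>0 is integrable near infinity, and by interpolation the rescaled L^\<sigma> norms of u
   on the balls B(x, |x|/2) tend to 0 for some \<sigma> > \<sigma>0.  A local supremum estimate turns this into pointwise
   decay, and an interior gradient estimate for the Poisson equation gives the decay of the gradient. *)

theory Submission
  imports Defs
begin

section \<open>Calculus for functions of class C1 and C2\<close>

text \<open>The range of \<alpha>: a conjugate exponent 1 < p < \<infinity> forces q0 = p / (p - 1),
  so f f'' / f'^2 tends to 1 - 1/p at 0, and near 0 this is all that is known about f''. For \<phi>
  = f^\<alpha> and K = f^(2 \<alpha> - 1) f' one gets K' - \<phi>'^2 = f^(2 \<alpha> - 2) f'^2 (f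
  f'' / f'^2 - (\<alpha> - 1)^2), whence the condition (\<alpha> - 1)^2 < 1 - 1/p. But then f K = f'
  \<phi>^2, and stability minus equation gains nothing; K has to be lowered a little, at the expense
  of the strict inequality. In terms of \<sigma> the condition is |\<sigma> - (3 p - 1)| < 2 sqrt (p
  (p - 1)), and p_c(N) is the value of p at which N (p - 1) / 2 reaches the upper end of this
  window. Both local estimates rest on one identity for weighted averages of u over B(x, s), so
  surface integrals and Sobolev inequalities do not enter. Hoelder's inequality is replaced
  throughout by splitting a power at a threshold and choosing the threshold well.\<close>

lemma has_derivative_grad:
  assumes "u differentiable (at x)"
  shows "(u has_derivative (\<lambda>h. grad u x \<bullet> h)) (at x)"
proof -
  let ?D = "frechet_derivative u (at x)"
  have D: "(u has_derivative ?D) (at x)"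
    using assms by (simp add: frechet_derivative_works)
  then have "linear ?D" by (simp add: has_derivative_linear)
  have "?D h = grad u x \<bullet> h" for h
  proof -
    have "?D h = ?D (\<Sum>b\<in>Basis. (h \<bullet> b) *\<^sub>R b)"
      by (simp add: euclidean_representation)
    also have "\<dots> = (\<Sum>b\<in>Basis. (h \<bullet> b) * ?D b)"
      using \<open>linear ?D\<close> by (simp add: linear_sum linear_scale)
    also have "\<dots> = grad u x \<bullet> h"
      unfolding grad_def partial_deriv_def inner_sum_left
      by (intro sum.cong) (auto simp: inner_commute)
    finally show ?thesis .
  qed
  then have "?D = (\<lambda>h. grad u x \<bullet> h)" by (rule ext)
  with D show ?thesis by simp
qed

lemma grad_eqI:
  assumes "(u has_derivative (\<lambda>h. g \<bullet> h)) (at x)"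
  shows "grad u x = g"
proof -
  have "frechet_derivative u (at x) = (\<lambda>h. g \<bullet> h)"
    using frechet_derivative_at[OF assms] by simp
  then show ?thesis
    by (simp add: grad_def partial_deriv_def euclidean_representation)
qed

lemma grad_inner_Basis: "b \<in> Basis \<Longrightarrow> grad u x \<bullet> b = partial_deriv b u x"
  by (simp add: grad_def inner_sum_left inner_Basis if_distrib cong: if_cong)

text \<open>Exhibiting one continuous vector field as the derivative spares the work with single
  partial derivatives; the closure properties of \<open>C1\<close> below all go through this
  rule.\<close>

lemma C1I:
  assumes "\<And>x. (u has_derivative (\<lambda>h. G x \<bullet> h)) (at x)" "continuous_on UNIV G"
  shows "C1 u" "grad u = G"
proof -
  show G: "grad u = G" using grad_eqI[OF assms(1)] by (rule ext)
  have "partial_deriv b u = (\<lambda>x. G x \<bullet> b)" if "b \<in> Basis" for b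
    using that G grad_inner_Basis[of b u] by auto
  then show "C1 u"
    unfolding C1_def using assms
    by (auto simp: differentiable_def intro!: continuous_intros)
qed

lemma C1_has_derivative: "C1 u \<Longrightarrow> (u has_derivative (\<lambda>h. grad u x \<bullet> h)) (at x)"
  by (simp add: C1_def has_derivative_grad)

lemma C1_continuous_grad: "C1 u \<Longrightarrow> continuous_on A (grad u)"
  unfolding C1_def grad_def
  by (rule continuous_on_subset[where s = UNIV]) (auto intro!: continuous_intros simp: grad_def[abs_def])

lemma C1_continuous: "C1 u \<Longrightarrow> continuous_on A u"
  unfolding C1_def
  by (meson continuous_at_imp_continuous_on differentiable_imp_continuous_within)

lemma C1_continuous_partial: "C1 u \<Longrightarrow> b \<in> Basis \<Longrightarrow> continuous_on A (partial_deriv b u)"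
  unfolding C1_def by (meson continuous_on_subset subset_UNIV)

lemma C1_mult:
  assumes "C1 u" "C1 v"
  shows "C1 (\<lambda>x. u x * v x)" "grad (\<lambda>x. u x * v x) = (\<lambda>x. u x *\<^sub>R grad v x + v x *\<^sub>R grad u x)"
proof -
  have 1: "((\<lambda>x. u x * v x) has_derivative (\<lambda>h. (u x *\<^sub>R grad v x + v x *\<^sub>R grad u x) \<bullet> h)) (at x)" for x
    by (rule derivative_eq_intros C1_has_derivative assms refl)+ (auto simp: inner_simps)
  have 2: "continuous_on UNIV (\<lambda>x. u x *\<^sub>R grad v x + v x *\<^sub>R grad u x)"
    by (intro continuous_intros C1_continuous C1_continuous_grad assms)
  show "C1 (\<lambda>x. u x * v x)" "grad (\<lambda>x. u x * v x) = (\<lambda>x. u x *\<^sub>R grad v x + v x *\<^sub>R grad u x)"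
    using C1I[OF 1 2] by auto
qed

lemma C1_compose:
  assumes "C1 u" "open S" "\<And>x. u x \<in> S"
    and "\<And>t. t \<in> S \<Longrightarrow> (g has_real_derivative g' t) (at t)" "continuous_on S g'"
  shows "C1 (\<lambda>x. g (u x))" "grad (\<lambda>x. g (u x)) = (\<lambda>x. g' (u x) *\<^sub>R grad u x)"
proof -
  have 1: "((\<lambda>x. g (u x)) has_derivative (\<lambda>h. (g' (u x) *\<^sub>R grad u x) \<bullet> h)) (at x)" for x
    using has_derivative_compose[OF C1_has_derivative[OF assms(1)]
        assms(4)[OF assms(3), unfolded has_field_derivative_def]]
    by simp
  have 2: "continuous_on UNIV (\<lambda>x. g' (u x) *\<^sub>R grad u x)"
    by (intro continuous_intros C1_continuous_grad assms continuous_on_compose2[OF assms(5)] C1_continuous)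
      (use assms in auto)
  show "C1 (\<lambda>x. g (u x))" "grad (\<lambda>x. g (u x)) = (\<lambda>x. g' (u x) *\<^sub>R grad u x)"
    using C1I[OF 1 2] by auto
qed

text \<open>Radial functions are built from the squared norm, which unlike the norm is
  differentiable at the origin. The squared bump and the cutoff functions have this form.\<close>

lemma C1_norm_square_compose:
  fixes g g' :: "real \<Rightarrow> real"
  assumes "\<And>t. (g has_real_derivative g' t) (at t)" "continuous_on UNIV g'"
  shows "C1 (\<lambda>x::'a::euclidean_space. g ((norm x)\<^sup>2))"
    "grad (\<lambda>x::'a. g ((norm x)\<^sup>2)) = (\<lambda>x. (2 * g' ((norm x)\<^sup>2)) *\<^sub>R x)"
proof -
  have 1: "((\<lambda>x::'a. (norm x)\<^sup>2) has_derivative (\<lambda>h. (2 *\<^sub>R x) \<bullet> h)) (at x)" for x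
    unfolding power2_norm_eq_inner
    by (rule derivative_eq_intros refl)+ (auto simp: inner_commute)
  have 2: "continuous_on UNIV (\<lambda>x::'a. 2 *\<^sub>R x)" by (intro continuous_intros)
  note 3 = C1I[OF 1 2]
  show "C1 (\<lambda>x::'a. g ((norm x)\<^sup>2))"
    "grad (\<lambda>x::'a. g ((norm x)\<^sup>2)) = (\<lambda>x. (2 * g' ((norm x)\<^sup>2)) *\<^sub>R x)"
    using C1_compose[OF 3(1), of UNIV g g'] assms 3(2) by (auto simp: mult.commute)
qed

section \<open>Differentiation under the integral sign and integration by parts\<close>

lemma integrable_continuous_bounded_support:
  fixes g :: "'a::euclidean_space \<Rightarrow> real"
  assumes "continuous_on UNIV g" "\<And>x. norm x > r \<Longrightarrow> g x = 0"
  shows "integrable lborel g"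
proof -
  have "integrable lborel (\<lambda>x. indicator (cball 0 r) x *\<^sub>R g x)"
    by (intro borel_integrable_compact) (use assms in \<open>auto intro: continuous_on_subset\<close>)
  moreover have "(\<lambda>x. indicator (cball 0 r) x *\<^sub>R g x) = g"
    using assms(2) by (auto simp: indicator_def fun_eq_iff not_le)
  ultimately show ?thesis by simp
qed

text \<open>The common support radius \<open>r\<close> places all integrands in one box, where the
  Lebesgue integral agrees with the gauge integral to which the Leibniz rule applies. Openness of
  \<open>U\<close> turns the derivative within \<open>U\<close> into a full one.\<close>

lemma has_real_derivative_integral_lborel:
  fixes F F' :: "real \<Rightarrow> 'a::euclidean_space \<Rightarrow> real"
  assumes U: "open U" "convex U" "s \<in> U"
    and F: "\<And>s x. s \<in> U \<Longrightarrow> ((\<lambda>s. F s x) has_real_derivative F' s x) (at s)"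
    and contF: "\<And>s. s \<in> U \<Longrightarrow> continuous_on UNIV (F s)"
    and contF': "continuous_on (U \<times> UNIV) (\<lambda>(s, x). F' s x)"
    and supp: "\<And>s x. s \<in> U \<Longrightarrow> norm x > r \<Longrightarrow> F s x = 0"
  shows "((\<lambda>s. \<integral>x. F s x \<partial>lborel) has_real_derivative (\<integral>x. F' s x \<partial>lborel)) (at s)"
proof -
  obtain a b :: 'a where ab: "cball 0 r \<subseteq> cbox a b"
    by (meson bounded_cball bounded_subset_cbox_symmetric)
  \<comment> \<open>The derivative inherits the support: for fixed x outside the ball,
    \<open>F t x\<close> vanishes for all t near s.\<close>
  have supp': "F' s x = 0" if "s \<in> U" "norm x > r" for s x
  proof -
    have ev: "eventually (\<lambda>t. F t x = 0) (nhds s)"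
      using eventually_nhds_in_open[OF U(1) that(1)]
      by eventually_elim (use supp that in blast)
    have "((\<lambda>s. F s x) has_real_derivative 0) (at s)"
      using DERIV_cong_ev[OF refl ev refl, of 0] by simp
    with F[OF that(1)] show ?thesis by (rule DERIV_unique)
  qed
  have contF's: "continuous_on UNIV (F' s)" if "s \<in> U" for s
  proof -
    have "continuous_on UNIV (Pair s :: 'a \<Rightarrow> _)" by (intro continuous_intros)
    then show ?thesis
      using continuous_on_compose2[OF contF', of UNIV "Pair s"] that by auto
  qed
  have eq: "(\<integral>x. g x \<partial>lborel) = integral (cbox a b) g"
    if "continuous_on UNIV g" "\<And>x. norm x > r \<Longrightarrow> g x = 0" for g :: "'a \<Rightarrow> real"
  proof -
    have "(g has_integral (\<integral>x. g x \<partial>lborel)) UNIV"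
      using integrable_continuous_bounded_support[OF that]
      by (rule has_integral_integral_lborel)
    moreover have "g = (\<lambda>x. if x \<in> cbox a b then g x else 0)"
    proof
      fix x
      have "norm x > r" if "x \<notin> cbox a b" using that ab by (meson in_mono mem_cball_0 not_le)
      then show "g x = (if x \<in> cbox a b then g x else 0)" using that(2) by auto
    qed
    ultimately have "((\<lambda>x. if x \<in> cbox a b then g x else 0) has_integral (\<integral>x. g x \<partial>lborel)) UNIV"
      by simp
    then have "(g has_integral (\<integral>x. g x \<partial>lborel)) (cbox a b)"
      by (simp only: has_integral_restrict_UNIV)
    then show ?thesis by (rule integral_unique[symmetric])
  qed
  have "((\<lambda>s. integral (cbox a b) (F s)) has_real_derivative integral (cbox a b) (F' s)) (at s within U)"
  proof (rule leibniz_rule_field_derivative)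
    show "((\<lambda>s. F s t) has_real_derivative F' s t) (at s within U)" if "s \<in> U" for s t
      using F[OF that] by (rule DERIV_subset) auto
    show "F s integrable_on cbox a b" if "s \<in> U" for s
      using contF[OF that] by (meson continuous_on_subset integrable_continuous subset_UNIV)
    show "continuous_on (U \<times> cbox a b) (\<lambda>(s, t). F' s t)"
      using contF' by (rule continuous_on_subset) auto
  qed (use U in blast)+
  moreover have "(\<integral>x. F' s x \<partial>lborel) = integral (cbox a b) (F' s)"
    using contF's supp' U(3) by (intro eq) blast+
  ultimately have "((\<lambda>s. integral (cbox a b) (F s)) has_real_derivative (\<integral>x. F' s x \<partial>lborel)) (at s)"
    by (simp only: at_within_open[OF U(3,1)])
  moreover have ev: "eventually (\<lambda>s. integral (cbox a b) (F s) = (\<integral>x. F s x \<partial>lborel)) (nhds s)"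
    using eventually_nhds_in_open[OF U(1) U(3)]
    by eventually_elim (rule eq[symmetric], (use contF supp in blast)+)
  ultimately show ?thesis
    using DERIV_cong_ev[OF refl ev refl] by blast
qed

lemma integral_translation_lborel:
  fixes g :: "'a::euclidean_space \<Rightarrow> real"
  assumes "g \<in> borel_measurable borel"
  shows "(\<integral>x. g (t + x) \<partial>lborel) = (\<integral>x. g x \<partial>lborel)"
  using assms by (subst (2) lborel_distr_plus[of t, symmetric]) (simp add: integral_distr)

lemma bounded_support_grad:
  fixes w :: "'a::euclidean_space \<Rightarrow> real"
  assumes "\<And>x. norm x > r \<Longrightarrow> w x = 0" "norm x > r"
  shows "grad w x = 0"
proof (rule grad_eqI)
  have "(w has_derivative (\<lambda>h. 0)) (at x)"
  proof (rule has_derivative_transform_within_open[of "\<lambda>_. 0" _ _ _ "{x. norm x > r}"])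
    show "open {x::'a. norm x > r}" by (intro open_Collect_less continuous_intros)
  qed (use assms in auto)
  then show "(w has_derivative (\<lambda>h. 0 \<bullet> h)) (at x)" by simp
qed

text \<open>By translation invariance the integral of \<open>g (s b + x)\<close> does not depend on
  s; its derivative at s = 0, taken under the integral, is the left-hand side. Restricting s to (-1,
  1) keeps all supports within radius r + 1.\<close>

lemma integral_partial_deriv_eq_0:
  fixes g :: "'a::euclidean_space \<Rightarrow> real"
  assumes g: "C1 g" and supp: "\<And>x. norm x > r \<Longrightarrow> g x = 0" and b: "b \<in> Basis"
  shows "(\<integral>x. partial_deriv b g x \<partial>lborel) = 0"
proof -
  have "((\<lambda>s. \<integral>x. g (s *\<^sub>R b + x) \<partial>lborel) has_real_derivative
      (\<integral>x. grad g (0 *\<^sub>R b + x) \<bullet> b \<partial>lborel)) (at 0)"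
  proof (rule has_real_derivative_integral_lborel[where U = "{-1<..<1}" and r = "r + 1"])
    fix s :: real and x :: 'a assume s: "s \<in> {-1<..<1}"
    have "((\<lambda>s. g (s *\<^sub>R b + x)) has_derivative (\<lambda>h. grad g (s *\<^sub>R b + x) \<bullet> (h *\<^sub>R b))) (at s)"
      by (rule has_derivative_compose[OF _ C1_has_derivative[OF g]])
        (auto intro!: derivative_eq_intros)
    then show "((\<lambda>s. g (s *\<^sub>R b + x)) has_real_derivative grad g (s *\<^sub>R b + x) \<bullet> b) (at s)"
      by (simp add: has_field_derivative_def mult_commute_abs)
    assume "norm x > r + 1"
    moreover have "norm x \<le> norm (s *\<^sub>R b + x) + norm (s *\<^sub>R b)"
      by (metis add_diff_cancel_left' norm_triangle_ineq4)
    moreover have "norm (s *\<^sub>R b) \<le> 1" using s b by auto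
    ultimately show "g (s *\<^sub>R b + x) = 0" using supp by auto
  next
    show "continuous_on UNIV (\<lambda>x. g (s *\<^sub>R b + x))" for s
      by (rule continuous_on_compose2[OF C1_continuous[OF g, of UNIV]]) (auto intro!: continuous_intros)
    show "continuous_on ({-1<..<1} \<times> UNIV) (\<lambda>(s, x). grad g (s *\<^sub>R b + x) \<bullet> b)"
      unfolding split_beta
      by (intro continuous_intros continuous_on_compose2[OF C1_continuous_grad[OF g, of UNIV]]) auto
  qed (auto simp: convex_real_interval)
  moreover have "g \<in> borel_measurable borel"
    by (intro borel_measurable_continuous_onI C1_continuous g)
  ultimately have d: "((\<lambda>s::real. \<integral>x. g x \<partial>lborel) has_real_derivative (\<integral>x. grad g x \<bullet> b \<partial>lborel)) (at 0)"
    by (simp add: integral_translation_lborel)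
  have "((\<lambda>s::real. \<integral>x. g x \<partial>lborel) has_real_derivative 0) (at 0)" by simp
  from DERIV_unique[OF d this] show ?thesis
    using b by (simp add: grad_inner_Basis)
qed

lemma C2_C1: "C2 u \<Longrightarrow> C1 u"
  by (simp add: C2_def)

lemma C2_partial: "C2 u \<Longrightarrow> b \<in> Basis \<Longrightarrow> C1 (partial_deriv b u)"
  by (simp add: C2_def)

lemma C2_continuous_laplacian: "C2 u \<Longrightarrow> continuous_on A (laplacian u)"
  unfolding laplacian_def[abs_def] by (intro continuous_intros C1_continuous_partial C2_partial)

lemma C1_affine:
  fixes v :: "'a::euclidean_space \<Rightarrow> real"
  assumes "C1 v"
  shows "C1 (\<lambda>y. v (x + s *\<^sub>R y))" "grad (\<lambda>y. v (x + s *\<^sub>R y)) = (\<lambda>y. s *\<^sub>R grad v (x + s *\<^sub>R y))"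
proof -
  have 1: "((\<lambda>y. v (x + s *\<^sub>R y)) has_derivative (\<lambda>h. (s *\<^sub>R grad v (x + s *\<^sub>R y)) \<bullet> h)) (at y)" for y
  proof -
    have "((\<lambda>y. v (x + s *\<^sub>R y)) has_derivative (\<lambda>h. grad v (x + s *\<^sub>R y) \<bullet> (s *\<^sub>R h))) (at y)"
      by (rule has_derivative_compose[OF _ C1_has_derivative[OF assms]])
        (auto intro!: derivative_eq_intros)
    then show ?thesis by simp
  qed
  have 2: "continuous_on UNIV (\<lambda>y. s *\<^sub>R grad v (x + s *\<^sub>R y))"
    by (intro continuous_intros continuous_on_compose2[OF C1_continuous_grad[OF assms, of UNIV]]) auto
  show "C1 (\<lambda>y. v (x + s *\<^sub>R y))" "grad (\<lambda>y. v (x + s *\<^sub>R y)) = (\<lambda>y. s *\<^sub>R grad v (x + s *\<^sub>R y))"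
    using C1I[OF 1 2] by auto
qed

text \<open>For each coordinate the product of a partial derivative of u with w has bounded support,
  so its derivative integrates to 0. The inner map x + s y is kept rather than substituted away: the
  chain rule supplies the factor s, and s = 0 is included, as averages over shrinking balls
  require.\<close>

lemma integral_grad_inner_affine:
  fixes u w :: "'a::euclidean_space \<Rightarrow> real"
  assumes u: "C2 u" and w: "C1 w" and supp: "\<And>x. norm x > r \<Longrightarrow> w x = 0"
  shows "(\<integral>y. grad u (x + s *\<^sub>R y) \<bullet> grad w y \<partial>lborel) = - s * (\<integral>y. laplacian u (x + s *\<^sub>R y) * w y \<partial>lborel)"
proof -
  define p where "p b y = partial_deriv b u (x + s *\<^sub>R y)" for b y
  define q where "q b y = partial_deriv b (partial_deriv b u) (x + s *\<^sub>R y)" for b y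
  note affine = C1_affine[OF C2_partial[OF u], of _ x s]
  have cont: "continuous_on UNIV (p b)" "continuous_on UNIV (q b)" if "b \<in> Basis" for b
  proof -
    have aff: "continuous_on UNIV (\<lambda>y. x + s *\<^sub>R y)" by (intro continuous_intros)
    show "continuous_on UNIV (p b)" "continuous_on UNIV (q b)"
      using continuous_on_compose2[OF C1_continuous_partial[OF C2_C1[OF u] that, where A = UNIV] aff]
        continuous_on_compose2[OF C1_continuous_partial[OF C2_partial[OF u that] that, where A = UNIV] aff]
      by (auto simp: p_def[abs_def] q_def[abs_def])
  qed
  have gsupp: "grad w y = 0" if "norm y > r" for y
    using bounded_support_grad[of r w y] supp that by blast
  have i1: "integrable lborel (\<lambda>y. p b y * (grad w y \<bullet> b))" if "b \<in> Basis" for b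
    using that gsupp
    by (intro integrable_continuous_bounded_support[of _ r] continuous_intros cont C1_continuous_grad w) auto
  have i2: "integrable lborel (\<lambda>y. q b y * w y)" if "b \<in> Basis" for b
    using that supp
    by (intro integrable_continuous_bounded_support[of _ r] continuous_intros cont C1_continuous w) auto
  have part: "(\<integral>y. p b y * (grad w y \<bullet> b) \<partial>lborel) = - s * (\<integral>y. q b y * w y \<partial>lborel)" if b: "b \<in> Basis" for b
  proof -
    have C: "C1 (\<lambda>y. p b y * w y)"
      unfolding p_def by (intro C1_mult affine b w)
    have "partial_deriv b (\<lambda>y. p b y * w y) y = p b y * (grad w y \<bullet> b) + s * (q b y * w y)" for y
    proof -
      have "grad (p b) y = s *\<^sub>R grad (partial_deriv b u) (x + s *\<^sub>R y)"
        unfolding p_def using affine(2)[OF b] by simp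
      then have "grad (\<lambda>y. p b y * w y) y \<bullet> b = p b y * (grad w y \<bullet> b) + s * (q b y * w y)"
        using C1_mult(2)[OF affine(1)[OF b] w] b
        by (simp add: p_def[abs_def] q_def inner_simps grad_inner_Basis affine(2)[OF b])
      then show ?thesis by (simp only: grad_inner_Basis[OF b])
    qed
    then have "(\<integral>y. p b y * (grad w y \<bullet> b) + s * (q b y * w y) \<partial>lborel) = 0"
      using integral_partial_deriv_eq_0[OF C _ b, of r] supp by simp
    then show ?thesis using i1[OF b] i2[OF b] by simp
  qed
  have "(\<integral>y. grad u (x + s *\<^sub>R y) \<bullet> grad w y \<partial>lborel) = (\<integral>y. (\<Sum>b\<in>Basis. p b y * (grad w y \<bullet> b)) \<partial>lborel)"
    by (subst euclidean_inner) (simp add: p_def grad_inner_Basis)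
  also have "\<dots> = (\<Sum>b\<in>Basis. - s * (\<integral>y. q b y * w y \<partial>lborel))"
    using i1 part by (simp add: integral_sum)
  also have "\<dots> = - s * (\<integral>y. (\<Sum>b\<in>Basis. q b y * w y) \<partial>lborel)"
    using i2 by (simp add: integral_sum sum_distrib_left sum_negf)
  also have "\<dots> = - s * (\<integral>y. laplacian u (x + s *\<^sub>R y) * w y \<partial>lborel)"
    by (simp add: laplacian_def q_def sum_distrib_right)
  finally show ?thesis .
qed

corollary integral_grad_inner_grad:
  fixes u w :: "'a::euclidean_space \<Rightarrow> real"
  assumes "C2 u" "C1 w" "\<And>x. norm x > r \<Longrightarrow> w x = 0"
  shows "(\<integral>y. grad u y \<bullet> grad w y \<partial>lborel) = - (\<integral>y. laplacian u y * w y \<partial>lborel)"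
  using integral_grad_inner_affine[OF assms, where x = 0 and s = 1] by simp

section \<open>Averages against a compactly supported weight\<close>

text \<open>Squaring removes the corner of the positive part. This is what makes the squared bump
  and the later cutoff profile continuously differentiable.\<close>

lemma has_real_derivative_max_0_square:
  "((\<lambda>t::real. (max 0 t)\<^sup>2) has_real_derivative 2 * max 0 t) (at t)"
proof -
  consider "t > 0" | "t < 0" | "t = 0" by linarith
  then show ?thesis
  proof cases
    case 1
    have "((\<lambda>t::real. t\<^sup>2) has_real_derivative 2 * max 0 t) (at t)"
      using 1 by (auto intro!: derivative_eq_intros)
    then show ?thesis
      by (rule has_field_derivative_transform_within_open[where S = "{0<..}"]) (use 1 in auto)
  next
    case 2
    have "((\<lambda>t::real. 0) has_real_derivative 2 * max 0 t) (at t)"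
      using 2 by auto
    then show ?thesis
      by (rule has_field_derivative_transform_within_open[where S = "{..<0}"]) (use 2 in auto)
  next
    case 3
    have "((\<lambda>h::real. (max 0 h)\<^sup>2 / h) \<longlongrightarrow> 0) (at 0)"
    proof (rule Lim_null_comparison)
      show "\<forall>\<^sub>F h in at 0. norm ((max 0 h)\<^sup>2 / h) \<le> \<bar>h :: real\<bar>"
        by (auto simp: max_def power2_eq_square)
      show "((\<lambda>h::real. \<bar>h\<bar>) \<longlongrightarrow> 0) (at 0)"
        by (rule tendsto_rabs_zero) simp
    qed
    then show ?thesis using 3 by (simp add: DERIV_def)
  qed
qed

definition bump :: "'a::euclidean_space \<Rightarrow> real"
  where "bump y = max 0 (1 - (norm y)\<^sup>2)"

text \<open>The gradient of \<open>\<lambda>y. (bump y)\<^sup>2 / 4\<close> is \<open>- bump y *\<^sub>R y\<close>, so the \<open>s\<close>-derivative of the average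
  of \<open>u (x + s *\<^sub>R y)\<close> against \<open>bump\<close> is an average of the Laplacian after one integration by parts.
  This replaces Green's representation formula.\<close>

lemma bump_bounds: "0 \<le> bump y" "bump y \<le> 1"
  by (auto simp: bump_def)

lemma bump_eq_0: "norm y \<ge> 1 \<Longrightarrow> bump y = 0"
  by (simp add: bump_def max_def power2_eq_square) (use mult_mono[of 1 "norm y" 1 "norm y"] in auto)

lemma continuous_bump [continuous_intros]: "continuous_on A bump"
  unfolding bump_def[abs_def] by (intro continuous_intros)

lemma integrable_bump: "integrable lborel bump"
  by (rule integrable_continuous_bounded_support[of _ 1]) (auto intro: continuous_bump bump_eq_0)

lemma C1_bump_square:
  "C1 (\<lambda>y::'a::euclidean_space. (bump y)\<^sup>2 / 4)"
  "grad (\<lambda>y::'a. (bump y)\<^sup>2 / 4) = (\<lambda>y. - bump y *\<^sub>R y)"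
proof -
  define g where "g t = (max 0 (1 - t))\<^sup>2 / 4" for t :: real
  have d: "(g has_real_derivative (- max 0 (1 - t) / 2)) (at t)" for t
    unfolding g_def
    by (rule DERIV_cong[OF DERIV_cdivide[OF DERIV_chain2[OF has_real_derivative_max_0_square, where Db="-1"]]])
      (auto intro!: derivative_eq_intros)
  have c: "continuous_on UNIV (\<lambda>t::real. - max 0 (1 - t) / 2)"
    by (intro continuous_intros) auto
  show "C1 (\<lambda>y::'a::euclidean_space. (bump y)\<^sup>2 / 4)"
    "grad (\<lambda>y::'a. (bump y)\<^sup>2 / 4) = (\<lambda>y. - bump y *\<^sub>R y)"
    using C1_norm_square_compose[OF d c, where ?'a = 'a] by (simp_all add: g_def bump_def)
qed


lemma bump_lipschitz: "\<bar>bump y - bump z\<bar> \<le> 2 * norm (y - z)"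
proof -
  have *: "bump a - bump b \<le> 2 * norm (a - b)" for a b :: 'a
  proof (cases "norm a < 1")
    case True
    show ?thesis
    proof (cases "norm b \<le> norm a")
      case True
      then have "(norm b)\<^sup>2 \<le> (norm a)\<^sup>2" by (intro power_mono) auto
      then have "bump a \<le> bump b" unfolding bump_def by linarith
      then show ?thesis by (smt (verit) norm_ge_zero)
    next
      case False
      \<comment> \<open>The outer radius is truncated at 1, beyond which the profile is constantly
        0; on [0, 1] the profile 1 - t^2 has slope at most 2 in modulus.\<close>
      define c where "c = min (norm b) 1"
      have c: "norm a \<le> c" "c \<le> norm b" "c \<le> 1" using False True by (auto simp: c_def)
      have "bump b = 1 - c\<^sup>2"
        using c abs_square_le_1[of "norm b"] by (auto simp: bump_def c_def max_def min_def)
      then have "bump a - bump b = c\<^sup>2 - (norm a)\<^sup>2"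
        using True abs_square_le_1[of "norm a"] by (auto simp: bump_def max_def)
      also have "\<dots> = (c - norm a) * (c + norm a)" by (simp add: power2_eq_square algebra_simps)
      also have "\<dots> \<le> (c - norm a) * 2" using c True by (intro mult_left_mono) auto
      also have "\<dots> \<le> 2 * norm (a - b)"
        using c norm_triangle_ineq2[of b a] by (simp add: norm_minus_commute)
      finally show ?thesis .
    qed
  next
    case False
    then show ?thesis using bump_bounds[of b] bump_eq_0[of a] by (smt (verit) norm_ge_zero)
  qed
  show ?thesis using *[of y z] *[of z y] by (auto simp: norm_minus_commute)
qed

lemma bump_square_lipschitz: "\<bar>(bump y)\<^sup>2 / 4 - (bump z)\<^sup>2 / 4\<bar> \<le> 2 * norm (y - z)"
proof -
  have "\<bar>(bump y)\<^sup>2 / 4 - (bump z)\<^sup>2 / 4\<bar> = \<bar>bump y - bump z\<bar> * ((bump y + bump z) / 4)"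
  proof -
    have "(bump y)\<^sup>2 / 4 - (bump z)\<^sup>2 / 4 = (bump y - bump z) * ((bump y + bump z) / 4)"
      by (simp add: power2_eq_square field_simps)
    then show ?thesis using bump_bounds[of y] bump_bounds[of z] by (simp only: abs_mult) simp
  qed
  also have "\<dots> \<le> 2 * norm (y - z) * 1"
    using bump_bounds[of y] bump_bounds[of z] by (intro mult_mono bump_lipschitz) auto
  finally show ?thesis by simp
qed

lemma bump_integral_pos: "0 < integral\<^sup>L lborel (bump :: 'a::euclidean_space \<Rightarrow> real)"
proof -
  have "0 < measure lborel (ball (0::'a) (1/2)) * (3/4)"
    by (auto intro!: content_ball_pos)
  also have "\<dots> = (\<integral>y. indicator (ball (0::'a) (1/2)) y * (3/4) \<partial>lborel)"
    by simp
  also have "\<dots> \<le> integral\<^sup>L lborel (bump :: 'a \<Rightarrow> real)"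
  proof (rule integral_mono)
    show "integrable lborel (\<lambda>y::'a. indicator (ball 0 (1/2)) y * (3/4::real))"
      by (intro integrable_mult_left integrable_real_indicator) (auto simp: emeasure_ball)
    show "indicator (ball 0 (1/2)) y * (3/4) \<le> bump y" for y :: 'a
      using bump_bounds[of y] power_mono[of "norm y" "1/2" 2]
      by (auto simp: indicator_def bump_def power2_eq_square)
  qed (rule integrable_bump)
  finally show ?thesis .
qed

lemma continuous_on_affine_comp:
  "continuous_on UNIV v \<Longrightarrow> continuous_on UNIV (\<lambda>y. v (x + s *\<^sub>R (y::'a::real_normed_vector)))"
  by (rule continuous_on_compose2[of UNIV v]) (auto intro!: continuous_intros)

lemma has_real_derivative_bump_average:
  fixes u :: "'a::euclidean_space \<Rightarrow> real"
  assumes u: "C2 u"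
  shows "((\<lambda>s. \<integral>y. u (x + s *\<^sub>R y) * bump y \<partial>lborel) has_real_derivative
          s * (\<integral>y. laplacian u (x + s *\<^sub>R y) * ((bump y)\<^sup>2 / 4) \<partial>lborel)) (at s)"
proof -
  note C1 = C2_C1[OF u]
  have "((\<lambda>s. \<integral>y. u (x + s *\<^sub>R y) * bump y \<partial>lborel) has_real_derivative
      (\<integral>y. (grad u (x + s *\<^sub>R y) \<bullet> y) * bump y \<partial>lborel)) (at s)"
  proof (rule has_real_derivative_integral_lborel[where U = UNIV and r = 1])
    show "((\<lambda>s. u (x + s *\<^sub>R y) * bump y) has_real_derivative (grad u (x + s *\<^sub>R y) \<bullet> y) * bump y) (at s)" for s y
    proof -
      have "((\<lambda>s. u (x + s *\<^sub>R y)) has_derivative (\<lambda>h. grad u (x + s *\<^sub>R y) \<bullet> (h *\<^sub>R y))) (at s)"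
        by (rule has_derivative_compose[OF _ C1_has_derivative[OF C1]])
          (auto intro!: derivative_eq_intros)
      then have "((\<lambda>s. u (x + s *\<^sub>R y)) has_real_derivative grad u (x + s *\<^sub>R y) \<bullet> y) (at s)"
        by (simp add: has_field_derivative_def mult_commute_abs)
      then show ?thesis by (rule DERIV_cmult_right)
    qed
    show "continuous_on UNIV (\<lambda>y. u (x + s *\<^sub>R y) * bump y)" for s
      by (intro continuous_intros continuous_on_affine_comp C1_continuous C1)
    show "continuous_on (UNIV \<times> UNIV) (\<lambda>(s, y). (grad u (x + s *\<^sub>R y) \<bullet> y) * bump y)"
      unfolding split_beta
      by (intro continuous_intros continuous_on_compose2[OF C1_continuous_grad[OF C1, of UNIV]]
          continuous_on_compose2[OF continuous_bump[of UNIV]]) auto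
  qed (auto simp: bump_eq_0)
  also have "(\<integral>y. (grad u (x + s *\<^sub>R y) \<bullet> y) * bump y \<partial>lborel)
      = - (\<integral>y. grad u (x + s *\<^sub>R y) \<bullet> grad (\<lambda>y. (bump y)\<^sup>2 / 4) y \<partial>lborel)"
    by (subst integral_minus[symmetric]) (simp add: C1_bump_square mult.commute)
  also have "\<dots> = s * (\<integral>y. laplacian u (x + s *\<^sub>R y) * ((bump y)\<^sup>2 / 4) \<partial>lborel)"
    by (subst integral_grad_inner_affine[OF u C1_bump_square(1), where r = 1]) (auto simp: bump_eq_0)
  finally show ?thesis .
qed

section \<open>Scaling, and integrals of powers over balls\<close>

lemma integrable_ball_continuous:
  fixes g :: "'a::euclidean_space \<Rightarrow> real"
  assumes "continuous_on UNIV g"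
  shows "integrable lborel (\<lambda>x. indicator (ball z r) x * g x)"
proof (rule Bochner_Integration.integrable_bound)
  show "integrable lborel (\<lambda>x. indicator (cball z r) x *\<^sub>R g x)"
    by (intro borel_integrable_compact) (use assms in \<open>auto intro: continuous_on_subset\<close>)
  have "g \<in> borel_measurable borel" using assms by (rule borel_measurable_continuous_onI)
  then show "(\<lambda>x. indicator (ball z r) x * g x) \<in> borel_measurable lborel"
    by (auto intro!: borel_measurable_times borel_measurable_indicator)
qed (auto simp: indicator_def)

lemma integral_ball_affine:
  fixes g :: "'a::euclidean_space \<Rightarrow> real"
  assumes g: "continuous_on UNIV g" and s: "s > 0"
  shows "(\<integral>y. indicator (ball 0 1) y * g (x + s *\<^sub>R y) \<partial>lborel)
       = (\<integral>y. indicator (ball x s) y * g y \<partial>lborel) / s ^ DIM('a)"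
proof -
  have m: "(\<lambda>y. indicator (ball x s) y * g y) \<in> borel_measurable borel"
    using borel_measurable_continuous_onI[OF g] by (intro borel_measurable_times borel_measurable_indicator) auto
  have "(\<integral>y. indicator (ball x s) y * g y \<partial>lborel)
      = (\<integral>y. s ^ DIM('a) * (indicator (ball x s) (x + s *\<^sub>R y) * g (x + s *\<^sub>R y)) \<partial>lborel)"
    using m s
    by (subst lborel_affine[of s x])
      (auto simp: integral_density integral_distr)
  also have "(\<lambda>y. indicator (ball x s) (x + s *\<^sub>R y) * g (x + s *\<^sub>R y))
      = (\<lambda>y. indicator (ball 0 1) y * g (x + s *\<^sub>R y))"
    using s by (auto simp: indicator_def fun_eq_iff dist_norm)
  finally show ?thesis using s by simp
qed

text \<open>Below the threshold T the power is at most its value at T; above T the missing exponent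
  r - a costs the factor T^(a - r). The threshold stays free.\<close>

lemma powr_split:
  fixes t T :: real
  assumes "t \<ge> 0" "T > 0" "0 < a" "a \<le> r"
  shows "t powr a \<le> T powr a + T powr (a - r) * t powr r"
proof (cases "t \<le> T")
  case True
  then have "t powr a \<le> T powr a" using assms by (intro powr_mono2) auto
  then show ?thesis by (simp add: add_increasing2)
next
  case False
  then have "t powr a = t powr (a - r) * t powr r"
    using assms by (simp add: powr_add[symmetric])
  also have "t powr (a - r) \<le> T powr (a - r)"
    using False assms by (intro powr_mono2') auto
  finally show ?thesis by (simp add: mult_right_mono add_increasing)
qed

text \<open>A Jensen type bound without Jensen: with E = J / s^N and the threshold T = E^(1/r), both
  terms of \<open>powr_split\<close> have size E^(a/r). The first carries the volume of the unit
  ball, the second the summand 1.\<close>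

lemma integral_powr_unit_ball_bound:
  fixes u :: "'a::euclidean_space \<Rightarrow> real"
  assumes u: "continuous_on UNIV u" "\<And>x. u x > 0" and s: "s > 0" "a > 0" "a \<le> r"
    and w: "continuous_on UNIV w" "\<And>y. 0 \<le> w y" "\<And>y. w y \<le> 1" "\<And>y. norm y \<ge> 1 \<Longrightarrow> w y = 0"
    and J: "J > 0" "(\<integral>y. indicator (ball x s) y * u y powr r \<partial>lborel) \<le> J"
  shows "(\<integral>y. u (x + s *\<^sub>R y) powr a * w y \<partial>lborel)
       \<le> (measure lborel (ball (0::'a) 1) + 1) * (J / s ^ DIM('a)) powr (a / r)"
proof -
  let ?E = "J / s ^ DIM('a)"
  define T where "T = ?E powr (1 / r)"
  have E: "?E > 0" and T: "T > 0" using J s by (auto simp: T_def)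
  have nz: "u x \<noteq> 0" for x using u(2)[of x] by simp
  have c: "continuous_on UNIV (\<lambda>y. u y powr a)" for a
    by (intro continuous_intros u) (use nz in auto)
  note c' = continuous_on_affine_comp[OF c]
  have i: "integrable lborel (\<lambda>y. indicator (ball (0::'a) 1) y * u (x + s *\<^sub>R y) powr r)"
    by (intro integrable_ball_continuous c')
  have i': "integrable lborel (\<lambda>y. indicator (ball (0::'a) 1) y * (1::real))"
    by (intro integrable_ball_continuous continuous_intros)
  have "(\<integral>y. u (x + s *\<^sub>R y) powr a * w y \<partial>lborel)
     \<le> (\<integral>y. T powr a * (indicator (ball (0::'a) 1) y * 1)
          + T powr (a - r) * (indicator (ball (0::'a) 1) y * u (x + s *\<^sub>R y) powr r) \<partial>lborel)"
  proof (rule integral_mono)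
    show "integrable lborel (\<lambda>y. u (x + s *\<^sub>R y) powr a * w y)"
      by (rule integrable_continuous_bounded_support[of _ 1]) (auto intro!: continuous_intros c' w)
    show "integrable lborel (\<lambda>y. T powr a * (indicator (ball (0::'a) 1) y * 1)
          + T powr (a - r) * (indicator (ball (0::'a) 1) y * u (x + s *\<^sub>R y) powr r))"
      using i i' by (intro Bochner_Integration.integrable_add integrable_mult_right)
    show "u (x + s *\<^sub>R y) powr a * w y \<le> T powr a * (indicator (ball (0::'a) 1) y * 1)
          + T powr (a - r) * (indicator (ball (0::'a) 1) y * u (x + s *\<^sub>R y) powr r)" for y
    proof (cases "norm y < 1")
      case True
      have "u (x + s *\<^sub>R y) powr a * w y \<le> u (x + s *\<^sub>R y) powr a * 1"
        using w by (intro mult_left_mono) auto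
      also have "\<dots> \<le> T powr a + T powr (a - r) * u (x + s *\<^sub>R y) powr r"
        using powr_split[of "u (x + s *\<^sub>R y)" T a r] u(2) T s by (simp add: less_imp_le)
      finally show ?thesis using True by simp
    next
      case False
      then show ?thesis using w(4)[of y] by simp
    qed
  qed
  also have "\<dots> = T powr a * (\<integral>y. indicator (ball (0::'a) 1) y * 1 \<partial>lborel)
      + T powr (a - r) * (\<integral>y. indicator (ball (0::'a) 1) y * u (x + s *\<^sub>R y) powr r \<partial>lborel)"
    using i i' by (subst Bochner_Integration.integral_add) auto
  also have "\<dots> = T powr a * measure lborel (ball (0::'a) 1)
      + T powr (a - r) * ((\<integral>y. indicator (ball x s) y * u y powr r \<partial>lborel) / s ^ DIM('a))"
    by (simp add: integral_ball_affine[OF c s(1)])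
  also have "\<dots> \<le> T powr a * measure lborel (ball (0::'a) 1) + T powr (a - r) * ?E"
    using J s by (intro add_left_mono mult_left_mono divide_right_mono) auto
  also have "T powr (a - r) * ?E = T powr a"
  proof -
    have "?E = T powr r" using E s J by (simp add: T_def powr_powr)
    then show ?thesis using T by (metis powr_add diff_add_cancel)
  qed
  also have "T powr a = ?E powr (a / r)" by (simp add: T_def powr_powr)
  finally show ?thesis by (simp add: algebra_simps)
qed

text \<open>The averages \<open>\<integral>y. u (x + s *\<^sub>R y) * bump y\<close> decrease in \<open>s\<close> at rate at most a constant times
  \<open>s powr (1 - DIM('a) * a / r)\<close>, which is integrable at \<open>0\<close> exactly when \<open>DIM('a) * a / r < 2\<close>.\<close>

lemma superharmonic_pointwise_bound:
  fixes a r :: real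
  assumes a: "0 < a" "a \<le> r" "1 \<le> r" "DIM('a::euclidean_space) * a / r < 2"
  shows "\<exists>C>0. \<forall>(u :: 'a \<Rightarrow> real) x \<rho> A J. C2 u \<longrightarrow> (\<forall>y. u y > 0) \<longrightarrow> \<rho> > 0 \<longrightarrow> A \<ge> 0 \<longrightarrow> J > 0 \<longrightarrow>
      (\<forall>y\<in>ball x \<rho>. - laplacian u y \<le> A * u y powr a) \<longrightarrow>
      (\<integral>y. indicator (ball x \<rho>) y * u y powr r \<partial>lborel) \<le> J \<longrightarrow>
      u x \<le> C * ((J / \<rho> ^ DIM('a)) powr (1 / r) + A * \<rho>\<^sup>2 * (J / \<rho> ^ DIM('a)) powr (a / r))"
proof -
  define \<omega> where "\<omega> = integral\<^sup>L lborel (bump :: 'a \<Rightarrow> real)"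
  define V where "V = measure lborel (ball (0::'a) 1) + 1"
  \<comment> \<open>The margin in the integrability condition: the averages lose at most a multiple
    of s^(m-1) per unit of s, and s^m / m is an antiderivative continuous at 0 because m >
    0.\<close>
  define m where "m = 2 - DIM('a) * a / r"
  define C where "C = (V / m + V) / \<omega>"
  have \<omega>: "\<omega> > 0" unfolding \<omega>_def by (rule bump_integral_pos)
  have V: "V > 0" unfolding V_def by (simp add: add_nonneg_pos)
  have m: "m > 0" using a unfolding m_def by simp
  have "C > 0" using \<omega> V m unfolding C_def by (intro divide_pos_pos add_pos_pos)
  show ?thesis
  proof (intro exI[of _ C] conjI allI impI)
    fix u :: "'a \<Rightarrow> real" and x \<rho> A J
    assume u1: "C2 u" and u2: "\<forall>y. u y > 0" and "\<rho> > 0" "A \<ge> 0" "J > 0"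
      and lap: "\<forall>y\<in>ball x \<rho>. - laplacian u y \<le> A * u y powr a"
      and J: "(\<integral>y. indicator (ball x \<rho>) y * u y powr r \<partial>lborel) \<le> J"
    note u = u1 u2[rule_format]
    note cu = C1_continuous[OF C2_C1[OF u(1)], of UNIV]
    have nz: "u x \<noteq> 0" for x using u(2)[of x] by simp
    have cp: "continuous_on UNIV (\<lambda>y. u y powr a)" for a by (intro continuous_intros cu) (use nz in auto)
    define U where "U s = (\<integral>y. u (x + s *\<^sub>R y) * bump y \<partial>lborel)" for s
    define U' where "U' s = s * (\<integral>y. laplacian u (x + s *\<^sub>R y) * ((bump y)\<^sup>2 / 4) \<partial>lborel)" for s
    have dU: "(U has_real_derivative U' s) (at s)" for s
      unfolding U_def U'_def by (rule has_real_derivative_bump_average[OF u(1)])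
    define B where "B = A * V * J powr (a / r)"
    have Js: "(\<integral>y. indicator (ball x s) y * u y powr r \<partial>lborel) \<le> J" if "s \<le> \<rho>" for s
    proof -
      have "(\<integral>y. indicator (ball x s) y * u y powr r \<partial>lborel) \<le> (\<integral>y. indicator (ball x \<rho>) y * u y powr r \<partial>lborel)"
        by (intro integral_mono integrable_ball_continuous cp mult_right_mono)
          (use that in \<open>auto simp: indicator_def\<close>)
      then show ?thesis using J by linarith
    qed
    have U'_ge: "U' s \<ge> - (B * s powr (m - 1))" if s: "0 < s" "s \<le> \<rho>" for s
    proof -
      have w: "(bump y)\<^sup>2 / 4 \<le> 1" for y :: 'a
        using bump_bounds[of y] power_le_one[of "bump y" 2] by simp
      have "- (\<integral>y. laplacian u (x + s *\<^sub>R y) * ((bump y)\<^sup>2 / 4) \<partial>lborel)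
          = (\<integral>y. - laplacian u (x + s *\<^sub>R y) * ((bump y)\<^sup>2 / 4) \<partial>lborel)"
        by simp
      also have "\<dots> \<le> (\<integral>y. A * (u (x + s *\<^sub>R y) powr a * ((bump y)\<^sup>2 / 4)) \<partial>lborel)"
      proof (rule integral_mono)
        show "integrable lborel (\<lambda>y. - laplacian u (x + s *\<^sub>R y) * ((bump y)\<^sup>2 / 4))"
          by (rule integrable_continuous_bounded_support[of _ 1])
            (auto intro!: continuous_intros continuous_on_affine_comp C2_continuous_laplacian u bump_eq_0)
        show "integrable lborel (\<lambda>y. A * (u (x + s *\<^sub>R y) powr a * ((bump y)\<^sup>2 / 4)))"
          by (rule integrable_continuous_bounded_support[of _ 1])
            (auto intro!: continuous_intros continuous_on_affine_comp[OF cp] bump_eq_0)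
        show "- laplacian u (x + s *\<^sub>R y) * ((bump y)\<^sup>2 / 4)
            \<le> A * (u (x + s *\<^sub>R y) powr a * ((bump y)\<^sup>2 / 4))" for y
        proof (cases "norm y < 1")
          case True
          then have "s * norm y < \<rho> * 1" using s by (intro mult_le_less_imp_less) auto
          then have "x + s *\<^sub>R y \<in> ball x \<rho>" using s by (simp add: dist_norm)
          from mult_right_mono[OF lap[rule_format, OF this], of "(bump y)\<^sup>2 / 4"] show ?thesis
            by (simp add: mult.assoc)
        qed (simp add: bump_eq_0)
      qed
      also have "\<dots> = A * (\<integral>y. u (x + s *\<^sub>R y) powr a * ((bump y)\<^sup>2 / 4) \<partial>lborel)" by simp
      also have "\<dots> \<le> A * (V * (J / s ^ DIM('a)) powr (a / r))"
        unfolding V_def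
        by (intro mult_left_mono integral_powr_unit_ball_bound u cu s a w Js \<open>A \<ge> 0\<close> \<open>J > 0\<close>)
          (auto intro!: continuous_intros simp: bump_eq_0)
      also have "(J / s ^ DIM('a)) powr (a / r) = J powr (a / r) * s powr (m - 2)"
        using s \<open>J > 0\<close>
        by (simp add: powr_divide powr_powr powr_realpow[symmetric] m_def powr_minus_divide)
      finally have "- (\<integral>y. laplacian u (x + s *\<^sub>R y) * ((bump y)\<^sup>2 / 4) \<partial>lborel) \<le> B * s powr (m - 2)"
        by (simp add: B_def mult.assoc)
      from mult_left_mono[OF this, of s] s have "- U' s \<le> B * (s * s powr (m - 2))"
        by (simp add: U'_def mult.left_commute)
      also have "s * s powr (m - 2) = s powr (m - 1)"
        using s powr_add[of s 1 "m - 2"] by simp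
      finally show ?thesis by simp
    qed
    \<comment> \<open>Adding the antiderivative of the loss makes the average nondecreasing. The
      derivative is needed only for s > 0, where s^(m-1) is harmless, and the correction at s = 0
      vanishes because \<open>0 powr m = 0\<close>.\<close>
    have "U 0 + B * 0 powr m / m \<le> U \<rho> + B * \<rho> powr m / m"
    proof (rule DERIV_nonneg_imp_increasing_open[where f = "\<lambda>s. U s + B * s powr m / m"])
      fix s assume s: "0 < s" "s < \<rho>"
      have "((\<lambda>s. U s + B * s powr m / m) has_real_derivative (U' s + B * s powr (m - 1))) (at s)"
        using s m by (auto intro!: derivative_eq_intros dU)
      then show "\<exists>y. ((\<lambda>s. U s + B * s powr m / m) has_real_derivative y) (at s) \<and> 0 \<le> y"
        using U'_ge[of s] s by force
    next
      show "continuous_on {0..\<rho>} (\<lambda>s. U s + B * s powr m / m)"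
        using m dU
        by (intro continuous_intros continuous_on_powr' DERIV_continuous_on[of _ U U'])
           (auto intro: has_field_derivative_at_within)
    qed (use \<open>\<rho> > 0\<close> in auto)
    moreover have "U 0 = u x * \<omega>" by (simp add: U_def \<omega>_def)
    moreover have "U \<rho> \<le> V * (J / \<rho> ^ DIM('a)) powr (1 / r)"
    proof -
      have "U \<rho> = (\<integral>y. u (x + \<rho> *\<^sub>R y) powr 1 * bump y \<partial>lborel)"
        unfolding U_def using u(2) by (simp add: less_imp_le)
      also have "\<dots> \<le> V * (J / \<rho> ^ DIM('a)) powr (1 / r)"
        unfolding V_def
        by (intro integral_powr_unit_ball_bound u cu \<open>\<rho> > 0\<close> \<open>J > 0\<close> a Js bump_bounds)
          (auto intro!: continuous_intros simp: bump_eq_0)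
      finally show ?thesis .
    qed
    moreover have "B * \<rho> powr m / m = V / m * (A * \<rho>\<^sup>2 * (J / \<rho> ^ DIM('a)) powr (a / r))"
    proof -
      have "(J / \<rho> ^ DIM('a)) powr (a / r) = J powr (a / r) * \<rho> powr (m - 2)"
        using \<open>\<rho> > 0\<close> \<open>J > 0\<close>
        by (simp add: powr_divide powr_powr powr_realpow[symmetric] m_def powr_minus_divide)
      moreover have "\<rho> powr m = \<rho>\<^sup>2 * \<rho> powr (m - 2)"
        using \<open>\<rho> > 0\<close> powr_add[of \<rho> 2 "m - 2"] by (simp add: powr_realpow)
      ultimately show ?thesis by (simp add: B_def)
    qed
    ultimately have "u x * \<omega> \<le> V * (J / \<rho> ^ DIM('a)) powr (1 / r)
        + V / m * (A * \<rho>\<^sup>2 * (J / \<rho> ^ DIM('a)) powr (a / r))"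
      using m by simp
    also have "\<dots> \<le> (V / m + V) * ((J / \<rho> ^ DIM('a)) powr (1 / r) + A * \<rho>\<^sup>2 * (J / \<rho> ^ DIM('a)) powr (a / r))"
      using V m \<open>A \<ge> 0\<close> by (simp add: algebra_simps)
    finally show "u x \<le> C * ((J / \<rho> ^ DIM('a)) powr (1 / r) + A * \<rho>\<^sup>2 * (J / \<rho> ^ DIM('a)) powr (a / r))"
      using \<omega> by (simp add: C_def field_simps)
  qed (rule \<open>C > 0\<close>)
qed

section \<open>Local estimates\<close>

text \<open>The point maximising \<open>(\<rho> - dist x y) powr \<kappa> * u y\<close> is chosen as the new centre. Around it \<open>u\<close> is
  bounded by \<open>2 powr \<kappa>\<close> times its central value, and \<open>u powr p\<close> can be split as
  \<open>u powr a * u powr b\<close> with \<open>b < 1\<close>, so that the supremum is absorbed.\<close>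

lemma small_energy_imp_small:
  fixes p r Cf \<epsilon> :: real
  assumes dim: "2 \<le> DIM('a::euclidean_space)" and p: "p > 1" and r: "r \<ge> 1" "r > DIM('a) * (p - 1) / 2"
    and Cf: "Cf > 0" and \<epsilon>: "\<epsilon> > 0"
  shows "\<exists>\<delta>>0. \<forall>(u :: 'a \<Rightarrow> real) x \<rho>. C2 u \<longrightarrow> (\<forall>y. u y > 0) \<longrightarrow> \<rho> > 0 \<longrightarrow>
      (\<forall>y\<in>ball x \<rho>. - laplacian u y \<le> Cf * u y powr p) \<longrightarrow>
      \<rho> powr (2 / (p - 1) * r - DIM('a)) * (\<integral>y. indicator (ball x \<rho>) y * u y powr r \<partial>lborel) \<le> \<delta> \<longrightarrow>
      \<rho> powr (2 / (p - 1)) * u x \<le> \<epsilon>"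
proof -
  let ?N = "real DIM('a)"
  define \<kappa> where "\<kappa> = 2 / (p - 1)"
  have \<kappa>: "\<kappa> > 0" "\<kappa> * p = \<kappa> + 2" using p by (auto simp: \<kappa>_def field_simps)
  have "?N > 0" using dim by simp
  have \<kappa>r: "\<kappa> * r - ?N > 0" using p r by (simp add: \<kappa>_def field_simps)
  have "p - 1 < min p (2 * r / ?N)"
    using r p \<open>?N > 0\<close> by (simp add: field_simps)
  \<comment> \<open>a > p - 1 makes the exponent b = p - a of the absorbed factor smaller than 1, a
    < p keeps it positive, and a < 2 r / N is the integrability condition of the pointwise bound.
    The hypothesis on r says precisely that p - 1 < 2 r / N.\<close>
  then obtain a where a: "p - 1 < a" "a < min p (2 * r / ?N)" using dense by blast
  have "2 * r / ?N \<le> r" using dim r by (simp add: field_simps mult_right_mono)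
  then have "a \<le> r" using a by simp
  then have ar: "a \<le> r" "0 < a" "?N * a / r < 2"
    using a p r \<open>?N > 0\<close> by (auto simp: field_simps)
  define b where "b = p - a"
  have b: "0 < b" "b < 1" "p = a + b" using a by (auto simp: b_def)
  obtain C where C: "C > 0" and bound: "\<forall>(u :: 'a \<Rightarrow> real) x \<rho> A J. C2 u \<longrightarrow> (\<forall>y. u y > 0) \<longrightarrow> \<rho> > 0 \<longrightarrow> A \<ge> 0 \<longrightarrow> J > 0 \<longrightarrow>
      (\<forall>y\<in>ball x \<rho>. - laplacian u y \<le> A * u y powr a) \<longrightarrow>
      (\<integral>y. indicator (ball x \<rho>) y * u y powr r \<partial>lborel) \<le> J \<longrightarrow>
      u x \<le> C * ((J / \<rho> ^ DIM('a)) powr (1 / r) + A * \<rho>\<^sup>2 * (J / \<rho> ^ DIM('a)) powr (a / r))"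
    using superharmonic_pointwise_bound[OF ar(2,1) r(1) ar(3)] by blast
  define C' where "C' = C * Cf * 2 powr (\<kappa> * b)"
  define \<epsilon>' where "\<epsilon>' = \<epsilon> / 2 powr \<kappa>"
  \<comment> \<open>The two entries bound the two terms of the pointwise estimate by \<epsilon>'/2
    and X^b \<epsilon>'^(1-b) / 2. The factor 2^\<kappa> in \<epsilon>' pays for taking half the
    distance to the boundary as the new radius.\<close>
  define \<delta> where "\<delta> = min ((\<epsilon>' / (2 * C)) powr r) ((\<epsilon>' powr (1 - b) / (2 * C')) powr (r / a))"
  have C': "C' > 0" and \<epsilon>': "\<epsilon>' > 0" using C Cf \<epsilon> by (auto simp: C'_def \<epsilon>'_def)
  then have \<delta>: "\<delta> > 0" using C by (auto simp: \<delta>_def)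
  have \<delta>1: "C * \<delta> powr (1 / r) \<le> \<epsilon>' / 2"
  proof -
    have "\<delta> powr (1 / r) \<le> ((\<epsilon>' / (2 * C)) powr r) powr (1 / r)"
      using \<delta> r by (intro powr_mono2) (auto simp: \<delta>_def)
    also have "\<dots> = \<epsilon>' / (2 * C)" using \<epsilon>' C r by (simp add: powr_powr)
    finally show ?thesis using C by (simp add: field_simps)
  qed
  have \<delta>2: "C' * \<delta> powr (a / r) \<le> \<epsilon>' powr (1 - b) / 2"
  proof -
    have "\<delta> powr (a / r) \<le> ((\<epsilon>' powr (1 - b) / (2 * C')) powr (r / a)) powr (a / r)"
      using \<delta> r ar by (intro powr_mono2) (auto simp: \<delta>_def)
    also have "\<dots> = \<epsilon>' powr (1 - b) / (2 * C')" using \<epsilon>' C' r ar by (simp add: powr_powr)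
    finally show ?thesis using C' by (simp add: field_simps)
  qed
  show ?thesis
    unfolding \<kappa>_def[symmetric]
  proof (intro exI[of _ \<delta>] conjI allI impI)
    fix u :: "'a \<Rightarrow> real" and x \<rho>
    assume u1: "C2 u" and u2: "\<forall>y. u y > 0" and \<rho>: "\<rho> > 0"
      and lap: "\<forall>y\<in>ball x \<rho>. - laplacian u y \<le> Cf * u y powr p"
      and J: "\<rho> powr (\<kappa> * r - ?N) * (\<integral>y. indicator (ball x \<rho>) y * u y powr r \<partial>lborel) \<le> \<delta>"
    note u = u1 u2[rule_format]
    note cu = C1_continuous[OF C2_C1[OF u(1)]]
    have nz: "u x \<noteq> 0" for x using u(2)[of x] by simp
    define d where "d y = \<rho> - dist x y" for y
    have "continuous_on (cball x \<rho>) (\<lambda>y. d y powr \<kappa> * u y)"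
      unfolding d_def using \<kappa> by (intro continuous_intros continuous_on_powr' cu) auto
    then obtain x0 where x0: "x0 \<in> cball x \<rho>" "\<And>y. y \<in> cball x \<rho> \<Longrightarrow> d y powr \<kappa> * u y \<le> d x0 powr \<kappa> * u x0"
      using continuous_attains_sup[of "cball x \<rho>" "\<lambda>y. d y powr \<kappa> * u y"] \<rho> by auto
    have center: "\<rho> powr \<kappa> * u x \<le> d x0 powr \<kappa> * u x0"
      using x0(2)[of x] \<rho> by (simp add: d_def)
    have "d x0 \<noteq> 0"
    proof
      assume "d x0 = 0"
      then have "\<rho> powr \<kappa> * u x \<le> 0" using center \<kappa> by simp
      then show False using \<rho> u(2)[of x] by (simp add: mult_le_0_iff)
    qed
    then have "d x0 > 0" using x0(1) by (simp add: d_def)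
    define \<rho>0 where "\<rho>0 = d x0 / 2"
    have \<rho>0: "\<rho>0 > 0" "\<rho>0 \<le> \<rho>" using \<open>d x0 > 0\<close> by (auto simp: \<rho>0_def d_def field_simps)
       (smt (verit) zero_le_dist)
    have ball: "y \<in> ball x \<rho>" "d y > \<rho>0" if "y \<in> ball x0 \<rho>0" for y
      using that dist_triangle[of x y x0] \<rho>0(1) by (auto simp: \<rho>0_def d_def)
    define X where "X = \<rho>0 powr \<kappa> * u x0"
    have X: "X > 0" using \<rho>0 u by (simp add: X_def)
    have dX: "d x0 powr \<kappa> * u x0 = 2 powr \<kappa> * X"
      using \<rho>0 by (simp add: X_def \<rho>0_def powr_divide)
    have u_le: "u y \<le> 2 powr \<kappa> * u x0" if "y \<in> ball x0 \<rho>0" for y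
    proof -
      have "\<rho>0 powr \<kappa> * u y \<le> d y powr \<kappa> * u y"
        using ball[OF that] \<rho>0 \<kappa> u(2)[of y] by (intro mult_right_mono powr_mono2) auto
      also have "\<dots> \<le> 2 powr \<kappa> * X" using x0(2)[of y] ball[OF that] dX by simp
      finally have "\<rho>0 powr \<kappa> * u y \<le> \<rho>0 powr \<kappa> * (2 powr \<kappa> * u x0)" by (simp add: X_def algebra_simps)
      then show ?thesis using \<rho>0 by simp
    qed
    define A where "A = Cf * (2 powr \<kappa> * u x0) powr b"
    \<comment> \<open>The largest energy that the smallness hypothesis permits on the original ball.
      Since \<kappa> r > N, the rescaled energy can only decrease when the radius shrinks to
      \<open>\<rho>0\<close>.\<close>
    define J' where "J' = \<delta> * \<rho> powr (?N - \<kappa> * r)"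
    have "J' > 0" using \<delta> \<rho> by (simp add: J'_def)
    have "\<rho>0 powr (\<kappa> * r - ?N) * J' \<le> \<rho> powr (\<kappa> * r - ?N) * J'"
      using \<rho>0 \<kappa>r \<open>J' > 0\<close> by (intro mult_right_mono powr_mono2) auto
    also have "\<dots> = \<delta>" using \<rho> by (simp add: J'_def powr_add[symmetric])
    finally have J'\<delta>: "\<rho>0 powr (\<kappa> * r - ?N) * J' \<le> \<delta>" .
    have "u x0 \<le> C * ((J' / \<rho>0 ^ DIM('a)) powr (1 / r) + A * \<rho>0\<^sup>2 * (J' / \<rho>0 ^ DIM('a)) powr (a / r))"
    proof (intro bound[rule_format] u \<rho>0(1) \<open>J' > 0\<close>)
      show "A \<ge> 0" using Cf by (simp add: A_def)
      show "- laplacian u y \<le> A * u y powr a" if "y \<in> ball x0 \<rho>0" for y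
      proof -
        have "- laplacian u y \<le> Cf * u y powr p" by (intro lap[rule_format] ball that)
        also have "\<dots> = Cf * (u y powr b * u y powr a)" using b(3) by (simp add: powr_add mult.commute)
        also have "\<dots> \<le> Cf * ((2 powr \<kappa> * u x0) powr b * u y powr a)"
          using u_le[OF that] u(2)[of y] b Cf by (intro mult_left_mono mult_right_mono powr_mono2) auto
        finally show ?thesis by (simp add: A_def)
      qed
      have "(\<integral>y. indicator (ball x0 \<rho>0) y * u y powr r \<partial>lborel) \<le> (\<integral>y. indicator (ball x \<rho>) y * u y powr r \<partial>lborel)"
      proof (intro integral_mono integrable_ball_continuous)
        show "indicator (ball x0 \<rho>0) y * u y powr r \<le> indicator (ball x \<rho>) y * u y powr r" for y
          using ball(1)[of y] by (auto simp: indicator_def)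
      qed (auto intro!: continuous_intros cu simp: nz)
      also have "\<dots> \<le> J'"
      proof -
        have "(\<integral>y. indicator (ball x \<rho>) y * u y powr r \<partial>lborel)
            = \<rho> powr (?N - \<kappa> * r) * (\<rho> powr (\<kappa> * r - ?N) * (\<integral>y. indicator (ball x \<rho>) y * u y powr r \<partial>lborel))"
          using \<rho> by (simp add: mult.assoc[symmetric] powr_add[symmetric])
        also have "\<dots> \<le> \<rho> powr (?N - \<kappa> * r) * \<delta>" by (intro mult_left_mono J) auto
        finally show ?thesis by (simp add: J'_def mult.commute)
      qed
      finally show "(\<integral>y. indicator (ball x0 \<rho>0) y * u y powr r \<partial>lborel) \<le> J'" .
    qed
    then have "X \<le> \<rho>0 powr \<kappa> * (C * ((J' / \<rho>0 ^ DIM('a)) powr (1 / r) + A * \<rho>0\<^sup>2 * (J' / \<rho>0 ^ DIM('a)) powr (a / r)))"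
      unfolding X_def by (intro mult_left_mono) auto
    also have "\<dots> = C * (\<rho>0 powr \<kappa> * (J' / \<rho>0 ^ DIM('a)) powr (1 / r))
        + C * A * (\<rho>0 powr \<kappa> * \<rho>0\<^sup>2 * (J' / \<rho>0 ^ DIM('a)) powr (a / r))"
      by (simp add: algebra_simps)
    also have "\<rho>0 powr \<kappa> * (J' / \<rho>0 ^ DIM('a)) powr (1 / r) = (\<rho>0 powr (\<kappa> * r - ?N) * J') powr (1 / r)"
    proof -
      have "(J' / \<rho>0 ^ DIM('a)) = \<rho>0 powr (- ?N) * J'"
        using \<rho>0 by (simp add: powr_minus_divide powr_realpow)
      moreover have "\<rho>0 powr \<kappa> = (\<rho>0 powr (\<kappa> * r)) powr (1 / r)" using r by (simp add: powr_powr)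
      ultimately have "\<rho>0 powr \<kappa> * (J' / \<rho>0 ^ DIM('a)) powr (1 / r) = (\<rho>0 powr (\<kappa> * r) * (\<rho>0 powr (- ?N) * J')) powr (1 / r)"
        using \<open>J' > 0\<close> \<rho>0 by (simp add: powr_mult)
      then show ?thesis by (simp add: mult.assoc[symmetric] powr_add[symmetric])
    qed
    also have "C * A * (\<rho>0 powr \<kappa> * \<rho>0\<^sup>2 * (J' / \<rho>0 ^ DIM('a)) powr (a / r))
       = C' * X powr b * (\<rho>0 powr (\<kappa> * r - ?N) * J') powr (a / r)"
    proof -
      have 1: "\<rho>0 powr (\<kappa> * r - ?N) * J' = \<rho>0 powr (\<kappa> * r) * (J' / \<rho>0 ^ DIM('a))"
        using \<rho>0 by (simp add: powr_diff powr_realpow)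
      have 2: "(\<rho>0 powr (\<kappa> * r) * (J' / \<rho>0 ^ DIM('a))) powr (a / r) = \<rho>0 powr (\<kappa> * a) * (J' / \<rho>0 ^ DIM('a)) powr (a / r)"
        using powr_mult[of "\<rho>0 powr (\<kappa> * r)" "J' / \<rho>0 ^ DIM('a)" "a / r"] \<rho>0 \<open>J' > 0\<close> r
        by (simp add: powr_powr)
      have 3: "\<rho>0 powr \<kappa> * \<rho>0\<^sup>2 = \<rho>0 powr (\<kappa> * b) * \<rho>0 powr (\<kappa> * a)"
      proof -
        have "\<rho>0 powr \<kappa> * \<rho>0\<^sup>2 = \<rho>0 powr (\<kappa> + 2)"
          using \<rho>0 by (simp add: powr_add powr_realpow)
        also have "\<kappa> + 2 = \<kappa> * b + \<kappa> * a" using \<kappa>(2) b(3) by (simp add: algebra_simps)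
        finally show ?thesis by (simp add: powr_add)
      qed
      have 4: "C * A * \<rho>0 powr (\<kappa> * b) = C' * X powr b"
        using \<rho>0 u(2)[of x0] by (simp add: A_def C'_def X_def powr_mult powr_powr)
      show ?thesis unfolding 1 2 3 4[symmetric] by simp
    qed
    finally have "X \<le> C * (\<rho>0 powr (\<kappa> * r - ?N) * J') powr (1 / r)
        + C' * X powr b * (\<rho>0 powr (\<kappa> * r - ?N) * J') powr (a / r)" .
    also have "\<dots> \<le> C * \<delta> powr (1 / r) + C' * X powr b * \<delta> powr (a / r)"
      using J'\<delta> \<open>J' > 0\<close> C C' r ar by (intro add_mono mult_left_mono powr_mono2) auto
    also have "\<dots> \<le> \<epsilon>' / 2 + X powr b * (\<epsilon>' powr (1 - b) / 2)"
      using \<delta>1 mult_left_mono[OF \<delta>2, of "X powr b"] by (simp add: algebra_simps)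
    finally have X_le: "X \<le> \<epsilon>' / 2 + X powr b * (\<epsilon>' powr (1 - b) / 2)" .
    \<comment> \<open>If X exceeded \<epsilon>', then, as b < 1, the right-hand side of
      \<open>X_le\<close> would be at most \<epsilon>'/2 + X/2, which is less than X.\<close>
    have "X \<le> \<epsilon>'"
    proof (rule ccontr)
      assume "\<not> X \<le> \<epsilon>'"
      then have "\<epsilon>' powr (1 - b) \<le> X powr (1 - b)"
        using \<epsilon>' b by (intro powr_mono2) auto
      then have "X powr b * (\<epsilon>' powr (1 - b) / 2) \<le> X powr b * (X powr (1 - b) / 2)"
        by (intro mult_left_mono) auto
      also have "\<dots> = X / 2" using X by (simp add: powr_add[symmetric])
      finally show False using X_le \<open>\<not> X \<le> \<epsilon>'\<close> by simp
    qed
    then have "2 powr \<kappa> * X \<le> \<epsilon>" by (simp add: \<epsilon>'_def field_simps)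
    then show "\<rho> powr \<kappa> * u x \<le> \<epsilon>" using center dX by simp
  qed (rule \<delta>)
qed

section \<open>Interior gradient estimate\<close>

lemma integral_shift_bound:
  fixes v w :: "'a::euclidean_space \<Rightarrow> real"
  assumes v: "continuous_on UNIV v" and s: "s > 0" and h: "h \<ge> 0" "norm e \<le> 1"
    and w: "continuous_on UNIV w" "\<And>y. norm y \<ge> 1 \<Longrightarrow> w y = 0" "\<And>y z. \<bar>w y - w z\<bar> \<le> 2 * norm (y - z)"
    and B: "\<And>z. z \<in> ball x s \<union> ball (x + h *\<^sub>R e) s \<Longrightarrow> \<bar>v z\<bar> \<le> B"
  shows "\<bar>(\<integral>y. v (x + h *\<^sub>R e + s *\<^sub>R y) * w y \<partial>lborel) - (\<integral>y. v (x + s *\<^sub>R y) * w y \<partial>lborel)\<bar>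
     \<le> 4 * measure lborel (ball (0::'a) 1) * B * (h / s)"
proof -
  \<comment> \<open>The shift by h e, measured in units of s. Substituting z = y + k moves it from v
    to the weight, so that the Lipschitz bound of w is used and no modulus of continuity of v
    enters.\<close>
  define k where "k = (h / s) *\<^sub>R e"
  have k: "s *\<^sub>R k = h *\<^sub>R e" using s by (simp add: k_def)
  have k': "norm k \<le> h / s" using h s by (simp add: k_def divide_right_mono mult_left_le)
  define g where "g z = v (x + s *\<^sub>R z) * w (z - k)" for z
  have cw: "continuous_on UNIV (\<lambda>z. w (z - k))"
    by (rule continuous_on_compose2[OF w(1)]) (auto intro!: continuous_intros)
  have cg: "continuous_on UNIV g"
    unfolding g_def by (intro continuous_intros continuous_on_affine_comp v cw)
  have eq: "(\<integral>y. v (x + h *\<^sub>R e + s *\<^sub>R y) * w y \<partial>lborel) = (\<integral>z. g z \<partial>lborel)"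
    using integral_translation_lborel[OF borel_measurable_continuous_onI[OF cg], of k]
    by (simp add: g_def scaleR_add_right k add.assoc)
  have i1: "integrable lborel g"
  proof (rule integrable_continuous_bounded_support[OF cg, of "1 + norm k"])
    fix z :: 'a assume "norm z > 1 + norm k"
    then have "norm (z - k) \<ge> 1" using norm_triangle_ineq2[of z k] by linarith
    then show "g z = 0" by (simp add: g_def w(2))
  qed
  have i2: "integrable lborel (\<lambda>y. v (x + s *\<^sub>R y) * w y)"
    by (rule integrable_continuous_bounded_support[of _ 1])
      (auto intro!: continuous_intros continuous_on_affine_comp v w)
  \<comment> \<open>The difference of the weights is at most 2 h / s and is supported in two unit
    balls, centred at 0 and at k; this explains the 4 in the claim.\<close>
  define M where "M (z::'a) = 2 * B * (h / s) * (indicator (ball (0::'a) 1) z + indicator (ball k 1) z)" for z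
  have iM: "integrable lborel M"
    unfolding M_def
    by (intro integrable_mult_right Bochner_Integration.integrable_add integrable_real_indicator)
      (auto simp: emeasure_ball)
  have "\<bar>(\<integral>z. g z - v (x + s *\<^sub>R z) * w z \<partial>lborel)\<bar> \<le> (\<integral>z. M z \<partial>lborel)"
  proof (rule order.trans[OF integral_abs_bound], rule integral_mono)
    show "integrable lborel (\<lambda>z. \<bar>g z - v (x + s *\<^sub>R z) * w z\<bar>)" using i1 i2 by simp
    show "\<bar>g z - v (x + s *\<^sub>R z) * w z\<bar> \<le> M z" for z
    proof (cases "norm z < 1 \<or> norm (z - k) < 1")
      case True
      have "x + s *\<^sub>R z \<in> ball x s \<union> ball (x + h *\<^sub>R e) s"
      proof (cases "norm z < 1")
        case True
        then show ?thesis using s by (simp add: dist_norm)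
      next
        case False
        with \<open>norm z < 1 \<or> norm (z - k) < 1\<close> have "norm (s *\<^sub>R (z - k)) < s" using s by simp
        then have "norm (s *\<^sub>R z - h *\<^sub>R e) < s" by (simp add: scaleR_diff_right k)
        then show ?thesis by (simp add: dist_norm norm_minus_commute)
      qed
      then have v_le: "\<bar>v (x + s *\<^sub>R z)\<bar> \<le> B" by (rule B)
      then have "B \<ge> 0" by linarith
      have "\<bar>g z - v (x + s *\<^sub>R z) * w z\<bar> = \<bar>v (x + s *\<^sub>R z)\<bar> * \<bar>w (z - k) - w z\<bar>"
        by (simp add: g_def abs_mult[symmetric] right_diff_distrib)
      also have "\<dots> \<le> B * (2 * (h / s))"
        using w(3)[of "z - k" z] k' \<open>B \<ge> 0\<close> by (intro mult_mono v_le) auto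
      also have "\<dots> \<le> M z"
      proof -
        have "1 \<le> (indicator (ball (0::'a) 1) z + indicator (ball k 1) z :: real)"
          using True by (auto simp: indicator_def dist_norm norm_minus_commute)
        from mult_left_mono[OF this, of "B * (2 * (h / s))"] show ?thesis
          using \<open>B \<ge> 0\<close> h s by (simp add: M_def mult_ac)
      qed
      finally show ?thesis .
    next
      case False
      then show ?thesis
        by (simp add: g_def w(2) M_def indicator_def dist_norm norm_minus_commute)
    qed
  qed (rule iM)
  also have "(\<integral>z. M z \<partial>lborel) = 4 * measure lborel (ball (0::'a) 1) * B * (h / s)"
    unfolding M_def
    by (subst integral_mult_right_zero, subst Bochner_Integration.integral_add)
      (auto simp: emeasure_ball content_ball intro!: integrable_real_indicator)
  finally show ?thesis using i1 i2 by (simp add: eq)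
qed

text \<open>The increment of u along its gradient is, up to the factor \<omega>, the value at s = 0
  of the increment \<open>D s\<close> of the bump averages. The mean value theorem bounds it by
  \<open>D \<rho>\<close> and by \<open>D'\<close> on (0, \<rho>). In both, the shift falls on the
  weight, which gives O(B h / \<rho>) and O(G h), so division by h needs only bounds for u and its
  Laplacian.\<close>

lemma gradient_estimate:
  shows "\<exists>C>0. \<forall>(u :: 'a::euclidean_space \<Rightarrow> real) x \<rho> B G. C2 u \<longrightarrow> \<rho> > 0 \<longrightarrow>
      (\<forall>y\<in>ball x (2 * \<rho>). \<bar>u y\<bar> \<le> B \<and> \<bar>laplacian u y\<bar> \<le> G) \<longrightarrow>
      norm (grad u x) \<le> C * (B / \<rho> + \<rho> * G)"
proof -
  define \<omega> where "\<omega> = integral\<^sup>L lborel (bump :: 'a \<Rightarrow> real)"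
  define V where "V = 4 * measure lborel (ball (0::'a) 1)"
  define C where "C = (V + 1) / \<omega>"
  have \<omega>: "\<omega> > 0" unfolding \<omega>_def by (rule bump_integral_pos)
  have V: "V \<ge> 0" unfolding V_def by simp
  have C: "C > 0" using \<omega> V by (simp add: C_def)
  show ?thesis
  proof (intro exI[of _ C] conjI allI impI)
    fix u :: "'a \<Rightarrow> real" and x \<rho> B G
    assume u: "C2 u" and \<rho>: "\<rho> > 0"
      and "\<forall>y\<in>ball x (2 * \<rho>). \<bar>u y\<bar> \<le> B \<and> \<bar>laplacian u y\<bar> \<le> G"
    then have B: "\<And>y. y \<in> ball x (2 * \<rho>) \<Longrightarrow> \<bar>u y\<bar> \<le> B"
      and G: "\<And>y. y \<in> ball x (2 * \<rho>) \<Longrightarrow> \<bar>laplacian u y\<bar> \<le> G" by auto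
    note cu = C1_continuous[OF C2_C1[OF u], of UNIV]
    have BG: "B \<ge> 0" "G \<ge> 0" using B[of x] G[of x] \<rho> by auto
    \<comment> \<open>The direction of the gradient; it is 0 when the gradient vanishes, so the norm
      bound and the final identity cover that case too.\<close>
    define e where "e = sgn (grad u x)"
    have e: "norm e \<le> 1" by (simp add: e_def norm_sgn)
    have quot: "\<bar>u (x + h *\<^sub>R e) - u x\<bar> \<le> h * (C * (B / \<rho> + \<rho> * G))" if h: "0 < h" "h < \<rho>" for h
    proof -
      define D where "D s = (\<integral>y. u (x + h *\<^sub>R e + s *\<^sub>R y) * bump y \<partial>lborel) - (\<integral>y. u (x + s *\<^sub>R y) * bump y \<partial>lborel)" for s
      define D' where "D' s = s * (\<integral>y. laplacian u (x + h *\<^sub>R e + s *\<^sub>R y) * ((bump y)\<^sup>2 / 4) \<partial>lborel)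
         - s * (\<integral>y. laplacian u (x + s *\<^sub>R y) * ((bump y)\<^sup>2 / 4) \<partial>lborel)" for s
      have dD: "(D has_real_derivative D' s) (at s)" for s
        unfolding D_def[abs_def] D'_def by (intro derivative_intros has_real_derivative_bump_average u)
      have sub: "z \<in> ball x (2 * \<rho>)" if "z \<in> ball x s \<union> ball (x + h *\<^sub>R e) s" "s \<le> \<rho>" for z s
      proof (cases "z \<in> ball x s")
        case False
        then have "dist (x + h *\<^sub>R e) z < s" using that by auto
        moreover have "dist x (x + h *\<^sub>R e) \<le> h" using h e by (simp add: dist_norm mult_left_le)
        ultimately show ?thesis using dist_triangle[of x z "x + h *\<^sub>R e"] that(2) h by simp
      qed (use that \<rho> in auto)
      have D\<rho>: "\<bar>D \<rho>\<bar> \<le> V * B * (h / \<rho>)"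
        unfolding D_def V_def
        by (rule integral_shift_bound[OF cu \<rho> _ e continuous_bump _ bump_lipschitz])
          (use h sub B in \<open>auto simp: bump_eq_0\<close>)
      have D's: "\<bar>D' s\<bar> \<le> V * G * h" if s: "0 < s" "s < \<rho>" for s
      proof -
        let ?I = "\<lambda>z. \<integral>y. laplacian u (z + s *\<^sub>R y) * ((bump y)\<^sup>2 / 4) \<partial>lborel"
        have I: "\<bar>?I (x + h *\<^sub>R e) - ?I x\<bar> \<le> V * G * (h / s)"
          unfolding V_def
        proof (rule integral_shift_bound[OF C2_continuous_laplacian[OF u] s(1) _ e _ _ bump_square_lipschitz])
          show "continuous_on UNIV (\<lambda>y. (bump y)\<^sup>2 / 4)" by (intro continuous_intros) auto
        qed (use h s sub G in \<open>auto simp: bump_eq_0\<close>)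
        \<comment> \<open>The factor s of the derivative formula cancels the 1/s of the shift bound,
          which makes the estimate uniform down to s = 0.\<close>
        have "D' s = s * (?I (x + h *\<^sub>R e) - ?I x)" by (simp only: D'_def right_diff_distrib)
        then have "\<bar>D' s\<bar> = s * \<bar>?I (x + h *\<^sub>R e) - ?I x\<bar>" using s by (simp only: abs_mult)
        also have "\<dots> \<le> s * (V * G * (h / s))" using s I by (intro mult_left_mono) auto
        finally show ?thesis using s by simp
      qed
      obtain s where s: "0 < s" "s < \<rho>" "D \<rho> - D 0 = (\<rho> - 0) * D' s"
        using MVT2[OF \<rho> dD] by metis
      have "\<bar>D 0\<bar> \<le> \<bar>D \<rho>\<bar> + \<rho> * \<bar>D' s\<bar>"
      proof -
        have "D 0 = D \<rho> - \<rho> * D' s" using s by simp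
        then show ?thesis
          using \<rho> abs_triangle_ineq4[of "D \<rho>" "\<rho> * D' s"] by (simp add: abs_mult)
      qed
      also have "\<dots> \<le> V * B * (h / \<rho>) + \<rho> * (V * G * h)"
        using D\<rho> D's[OF s(1,2)] \<rho> by (intro add_mono mult_left_mono) auto
      also have "\<dots> = h * (V * (B / \<rho> + \<rho> * G))" using \<rho> by (simp add: field_simps)
      also have "\<dots> \<le> h * ((V + 1) * (B / \<rho> + \<rho> * G))"
        using h BG \<rho> by (intro mult_left_mono mult_right_mono) auto
      also have "D 0 = (u (x + h *\<^sub>R e) - u x) * \<omega>"
        by (simp add: D_def \<omega>_def left_diff_distrib)
      finally have "\<bar>u (x + h *\<^sub>R e) - u x\<bar> * \<omega> \<le> h * ((V + 1) * (B / \<rho> + \<rho> * G))"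
        using \<omega> by (simp only: abs_mult abs_of_pos)
      then have "\<bar>u (x + h *\<^sub>R e) - u x\<bar> \<le> h * ((V + 1) * (B / \<rho> + \<rho> * G)) / \<omega>"
        using \<omega> by (simp only: pos_le_divide_eq)
      then show ?thesis by (simp add: C_def)
    qed
    have "((\<lambda>h. u (x + h *\<^sub>R e)) has_derivative (\<lambda>t. grad u (x + 0 *\<^sub>R e) \<bullet> (t *\<^sub>R e))) (at 0)"
      by (rule has_derivative_compose[OF _ C1_has_derivative[OF C2_C1[OF u]]])
        (auto intro!: derivative_eq_intros)
    then have "((\<lambda>h. u (x + h *\<^sub>R e)) has_real_derivative grad u x \<bullet> e) (at 0)"
      by (simp add: has_field_derivative_def mult_commute_abs)
    then have "((\<lambda>h. (u (x + h *\<^sub>R e) - u x) / h) \<longlongrightarrow> grad u x \<bullet> e) (at_right 0)"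
      by (simp add: DERIV_def filterlim_at_split)
    moreover have "\<forall>\<^sub>F h in at_right 0. (u (x + h *\<^sub>R e) - u x) / h \<le> C * (B / \<rho> + \<rho> * G)"
      using eventually_at_right_real[OF \<rho>]
    proof eventually_elim
      case (elim h)
      then have "u (x + h *\<^sub>R e) - u x \<le> h * (C * (B / \<rho> + \<rho> * G))" using quot[of h] by auto
      then show ?case using elim by (simp add: field_simps)
    qed
    ultimately have "grad u x \<bullet> e \<le> C * (B / \<rho> + \<rho> * G)"
      by (rule tendsto_upperbound) simp
    moreover have "grad u x \<bullet> e = norm (grad u x)"
      by (cases "grad u x = 0")
        (simp_all add: e_def sgn_div_norm power2_norm_eq_inner[symmetric] power2_eq_square)
    ultimately show "norm (grad u x) \<le> C * (B / \<rho> + \<rho> * G)" by simp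
  qed (rule C)
qed

section \<open>The stability inequality\<close>

lemma C1c_vanishes_outside:
  assumes "\<psi> \<in> C1c A"
  obtains r where "\<And>x. norm x > r \<Longrightarrow> \<psi> x = 0"
proof -
  have "bounded (closure (support_on UNIV \<psi>))"
    using assms by (auto simp: C1c_def compact_imp_bounded)
  then obtain r where r: "\<And>x. x \<in> closure (support_on UNIV \<psi>) \<Longrightarrow> norm x \<le> r"
    by (auto simp: bounded_iff)
  have "\<psi> x = 0" if "norm x > r" for x
    using r[of x] that closure_subset[of "support_on UNIV \<psi>"]
    by (auto simp: support_on_def)
  then show ?thesis using that by blast
qed

lemma C1c_mult:
  assumes "\<psi> \<in> C1c A" "C1 v"
  shows "(\<lambda>x. v x * \<psi> x) \<in> C1c A"
proof -
  have sub: "closure (support_on UNIV (\<lambda>x. v x * \<psi> x)) \<subseteq> closure (support_on UNIV \<psi>)"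
    by (intro closure_mono) (auto simp: support_on_def)
  then have "compact (closure (support_on UNIV (\<lambda>x. v x * \<psi> x)))"
    using assms(1) compact_Int_closed[of "closure (support_on UNIV \<psi>)" "closure (support_on UNIV (\<lambda>x. v x * \<psi> x))"]
    by (auto simp: C1c_def Int_absorb1)
  then show ?thesis using assms sub C1_mult(1)[of v \<psi>] by (auto simp: C1c_def)
qed

text \<open>Expand \<phi>^2 / \<delta> times |y a - b|^2 with y = \<delta> m z / \<phi>^2. The last
  hypothesis is a discriminant condition: it bounds the resulting coefficient of |a|^2 by n z^2. It
  will be used with m = \<phi> \<phi>' - K, n = K' - \<phi>'^2 and the gradients of u and \<psi> for
  a and b.\<close>

lemma young_inner:
  fixes a b :: "'a::real_inner"
  assumes "\<delta> > 0" "\<phi> > (0::real)" "\<delta> * m\<^sup>2 \<le> \<phi>\<^sup>2 * n"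
  shows "2 * m * z * (a \<bullet> b) \<le> n * z\<^sup>2 * (norm a)\<^sup>2 + \<phi>\<^sup>2 * (norm b)\<^sup>2 / \<delta>"
proof -
  define y where "y = \<delta> * m * z / \<phi>\<^sup>2"
  have "0 \<le> \<phi>\<^sup>2 / \<delta> * (norm (y *\<^sub>R a - b))\<^sup>2" using assms by simp
  also have "(norm (y *\<^sub>R a - b))\<^sup>2 = y\<^sup>2 * (norm a)\<^sup>2 - 2 * y * (a \<bullet> b) + (norm b)\<^sup>2"
    by (simp add: power2_norm_eq_inner inner_diff_left inner_diff_right inner_commute[of b a])
      (simp add: power2_eq_square algebra_simps)
  also have "\<phi>\<^sup>2 / \<delta> * (y\<^sup>2 * (norm a)\<^sup>2 - 2 * y * (a \<bullet> b) + (norm b)\<^sup>2)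
    = \<phi>\<^sup>2 / \<delta> * y\<^sup>2 * (norm a)\<^sup>2 - \<phi>\<^sup>2 / \<delta> * y * 2 * (a \<bullet> b) + \<phi>\<^sup>2 * (norm b)\<^sup>2 / \<delta>"
    by (simp add: algebra_simps)
  also have "\<phi>\<^sup>2 / \<delta> * y = m * z" using assms by (simp add: y_def)
  also have "\<phi>\<^sup>2 / \<delta> * y\<^sup>2 = (\<delta> * m\<^sup>2 / \<phi>\<^sup>2) * z\<^sup>2"
    using assms by (simp add: y_def power2_eq_square)
  also have "(\<delta> * m\<^sup>2 / \<phi>\<^sup>2) * z\<^sup>2 * (norm a)\<^sup>2 \<le> n * z\<^sup>2 * (norm a)\<^sup>2"
    using assms by (intro mult_right_mono) (auto simp: field_simps)
  finally show ?thesis by simp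
qed

text \<open>Stability is tested with \<open>\<phi> (u x) * \<psi> x\<close> and the equation with \<open>K (u x) * (\<psi> x)\<^sup>2\<close>; the gradient
  terms cancel because \<open>K'\<close> dominates \<open>\<phi>'\<^sup>2\<close>.\<close>

lemma stability_weighted_estimate:
  fixes u :: "'a::euclidean_space \<Rightarrow> real" and f f' \<phi> \<phi>' K K' :: "real \<Rightarrow> real"
  assumes u: "C2 u" "\<And>x. u x > 0" "\<And>x. u x \<le> M" and sol: "\<And>x. - laplacian u x = f (u x)"
    and cont: "continuous_on {0<..} f" "continuous_on {0<..} f'"
    and stable: "\<And>\<psi>. \<psi> \<in> C1c A \<Longrightarrow>
        (\<integral>x. f' (u x) * (\<psi> x)\<^sup>2 \<partial>lborel) \<le> (\<integral>x. (norm (grad \<psi> x))\<^sup>2 \<partial>lborel)"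
    and \<phi>: "\<And>t. t > 0 \<Longrightarrow> (\<phi> has_real_derivative \<phi>' t) (at t)" "continuous_on {0<..} \<phi>'" "\<And>t. t > 0 \<Longrightarrow> \<phi> t > 0"
    and K: "\<And>t. t > 0 \<Longrightarrow> (K has_real_derivative K' t) (at t)" "continuous_on {0<..} K'"
    and ineq1: "\<And>t. 0 < t \<Longrightarrow> t \<le> M \<Longrightarrow> f t * K t \<le> (1 - \<eta>) * f' t * (\<phi> t)\<^sup>2"
    and ineq2: "\<And>t. 0 < t \<Longrightarrow> t \<le> M \<Longrightarrow> \<delta> * (\<phi> t * \<phi>' t - K t)\<^sup>2 \<le> (\<phi> t)\<^sup>2 * (K' t - (\<phi>' t)\<^sup>2)"
    and \<delta>: "\<delta> > 0" and \<psi>: "\<psi> \<in> C1c A"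
  shows "\<eta> * (\<integral>x. f' (u x) * (\<phi> (u x))\<^sup>2 * (\<psi> x)\<^sup>2 \<partial>lborel)
    \<le> (1 + 1 / \<delta>) * (\<integral>x. (\<phi> (u x))\<^sup>2 * (norm (grad \<psi> x))\<^sup>2 \<partial>lborel)"
proof -
  obtain r where r: "\<And>x. norm x > r \<Longrightarrow> \<psi> x = 0" using C1c_vanishes_outside[OF \<psi>] by blast
  have gr: "norm x > r \<Longrightarrow> grad \<psi> x = 0" for x using bounded_support_grad[of r \<psi> x] r by blast
  note u1 = C2_C1[OF u(1)]
  have \<psi>1: "C1 \<psi>" using \<psi> by (simp add: C1c_def)
  have upos: "\<And>x. u x \<in> {0<..}" using u(2) by simp
  have d: "\<And>t. t \<in> {0<..} \<Longrightarrow> (\<phi> has_real_derivative \<phi>' t) (at t)" "\<And>t. t \<in> {0<..} \<Longrightarrow> (K has_real_derivative K' t) (at t)"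
    using \<phi>(1) K(1) by auto
  note v = C1_compose[OF u1 open_greaterThan upos d(1) \<phi>(2)]
  note k = C1_compose[OF u1 open_greaterThan upos d(2) K(2)]
  note w = C1_mult[OF k(1) C1_mult(1)[OF \<psi>1 \<psi>1]]
  have comp: "continuous_on UNIV (\<lambda>x. g (u x))" if "continuous_on {0<..} g" for g :: "real \<Rightarrow> real"
    by (rule continuous_on_compose2[OF that C1_continuous[OF u1]]) (use upos in auto)
  have gv: "grad (\<lambda>x. \<phi> (u x) * \<psi> x) x = \<phi> (u x) *\<^sub>R grad \<psi> x + (\<psi> x * \<phi>' (u x)) *\<^sub>R grad u x" for x
    using fun_cong[OF C1_mult(2)[OF v(1) \<psi>1], of x] fun_cong[OF v(2), of x] by simp
  have gw: "grad (\<lambda>x. K (u x) * (\<psi> x * \<psi> x)) x = (2 * K (u x) * \<psi> x) *\<^sub>R grad \<psi> x + ((\<psi> x)\<^sup>2 * K' (u x)) *\<^sub>R grad u x" for x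
    using fun_cong[OF w(2), of x] fun_cong[OF k(2), of x] fun_cong[OF C1_mult(2)[OF \<psi>1 \<psi>1], of x]
      scaleR_left_distrib[of "\<psi> x" "\<psi> x" "grad \<psi> x"]
    by (simp only: scaleR_scaleR power2_eq_square mult.assoc mult_2[symmetric] mult_2_right[symmetric] flip: scaleR_add_left) (simp add: mult.left_commute)
  \<comment> \<open>\<open>S\<close> is the integrand of the stability inequality, with nonnegative
    integral; \<open>T\<close> is that of the tested equation, with integral zero. A pointwise upper
    bound for S - T therefore yields the claim.\<close>
  define S where "S x = (norm (grad (\<lambda>x. \<phi> (u x) * \<psi> x) x))\<^sup>2 - f' (u x) * (\<phi> (u x) * \<psi> x)\<^sup>2" for x
  define T where "T x = grad u x \<bullet> grad (\<lambda>x. K (u x) * (\<psi> x * \<psi> x)) x - f (u x) * (K (u x) * (\<psi> x * \<psi> x))" for x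
  note ci = continuous_intros comp cont C1_continuous C1_continuous_grad v(1) k(1) \<psi>1 u1 C1_mult(1)
  have i1: "integrable lborel (\<lambda>x. (norm (grad (\<lambda>x. \<phi> (u x) * \<psi> x) x))\<^sup>2)"
    by (rule integrable_continuous_bounded_support[of _ r], intro ci) (auto simp: gv r gr)
  have i2: "integrable lborel (\<lambda>x. f' (u x) * (\<phi> (u x) * \<psi> x)\<^sup>2)"
    by (rule integrable_continuous_bounded_support[of _ r], intro ci) (auto simp: r)
  have i3: "integrable lborel (\<lambda>x. grad u x \<bullet> grad (\<lambda>x. K (u x) * (\<psi> x * \<psi> x)) x)"
    by (rule integrable_continuous_bounded_support[of _ r], intro ci) (auto simp: gw r gr)
  have i4: "integrable lborel (\<lambda>x. f (u x) * (K (u x) * (\<psi> x * \<psi> x)))"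
    by (rule integrable_continuous_bounded_support[of _ r], intro ci) (auto simp: r)
  have i5: "integrable lborel (\<lambda>x. (\<phi> (u x))\<^sup>2 * (norm (grad \<psi> x))\<^sup>2)"
    by (rule integrable_continuous_bounded_support[of _ r], intro ci) (auto simp: gr)
  have i6: "integrable lborel (\<lambda>x. f' (u x) * (\<phi> (u x))\<^sup>2 * (\<psi> x)\<^sup>2)"
    by (rule integrable_continuous_bounded_support[of _ r], intro ci) (auto simp: r)
  have iS: "integrable lborel S" and iT: "integrable lborel T"
    unfolding S_def[abs_def] T_def[abs_def] by (intro Bochner_Integration.integrable_diff i1 i2 i3 i4)+
  have "0 \<le> (\<integral>x. S x \<partial>lborel)"
    using stable[OF C1c_mult[OF \<psi> v(1)]] i1 i2 by (simp add: S_def)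
  moreover have "(\<integral>x. T x \<partial>lborel) = 0"
  proof -
    have "(\<integral>x. grad u x \<bullet> grad (\<lambda>x. K (u x) * (\<psi> x * \<psi> x)) x \<partial>lborel)
        = (\<integral>x. - laplacian u x * (K (u x) * (\<psi> x * \<psi> x)) \<partial>lborel)"
      using integral_grad_inner_grad[OF u(1) w(1), of r] r by simp
    then show ?thesis using i3 i4 by (simp only: sol T_def) simp
  qed
  moreover have "(\<integral>x. S x - T x \<partial>lborel)
      \<le> (\<integral>x. (1 + 1 / \<delta>) * ((\<phi> (u x))\<^sup>2 * (norm (grad \<psi> x))\<^sup>2) - \<eta> * (f' (u x) * (\<phi> (u x))\<^sup>2 * (\<psi> x)\<^sup>2) \<partial>lborel)"
  proof (rule integral_mono)
    show "integrable lborel (\<lambda>x. S x - T x)" by (rule Bochner_Integration.integrable_diff[OF iS iT])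
    show "integrable lborel (\<lambda>x. (1 + 1 / \<delta>) * ((\<phi> (u x))\<^sup>2 * (norm (grad \<psi> x))\<^sup>2) - \<eta> * (f' (u x) * (\<phi> (u x))\<^sup>2 * (\<psi> x)\<^sup>2))"
      by (intro Bochner_Integration.integrable_diff integrable_mult_right i5 i6)
    show "S x - T x \<le> (1 + 1 / \<delta>) * ((\<phi> (u x))\<^sup>2 * (norm (grad \<psi> x))\<^sup>2) - \<eta> * (f' (u x) * (\<phi> (u x))\<^sup>2 * (\<psi> x)\<^sup>2)" for x
    proof -
      define t z a b c where "t = u x" and "z = \<psi> x" and "a = (norm (grad u x))\<^sup>2"
        and "b = (norm (grad \<psi> x))\<^sup>2" and "c = grad u x \<bullet> grad \<psi> x"
      have t: "0 < t" "t \<le> M" using u by (auto simp: t_def)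
      have 1: "f t * K t * z\<^sup>2 \<le> (1 - \<eta>) * f' t * (\<phi> t)\<^sup>2 * z\<^sup>2"
        by (intro mult_right_mono ineq1 t) auto
      \<comment> \<open>In S - T the product of the two gradients has coefficient 2 (\<phi> \<phi>'
        - K) z, and |grad u|^2 has coefficient -(K' - \<phi>'^2) z^2; the latter absorbs the former
        and leaves only |grad \<psi>|^2.\<close>
      have 2: "2 * (\<phi> t * \<phi>' t - K t) * z * c \<le> (K' t - (\<phi>' t)\<^sup>2) * z\<^sup>2 * a + (\<phi> t)\<^sup>2 * b / \<delta>"
        unfolding a_def b_def c_def by (rule young_inner[OF \<delta> \<phi>(3)[OF t(1)] ineq2[OF t]])
      have 3: "S x = (\<phi> t)\<^sup>2 * b + 2 * \<phi> t * \<phi>' t * z * c + (\<phi>' t)\<^sup>2 * z\<^sup>2 * a - f' t * (\<phi> t)\<^sup>2 * z\<^sup>2"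
        unfolding S_def gv t_def z_def a_def b_def c_def power2_norm_eq_inner inner_add_left inner_add_right
        by (simp add: inner_commute[of "grad \<psi> x" "grad u x"] power2_eq_square algebra_simps)
      have 4: "T x = 2 * K t * z * c + K' t * z\<^sup>2 * a - f t * K t * z\<^sup>2"
        unfolding T_def gw t_def z_def a_def b_def c_def power2_norm_eq_inner inner_add_left inner_add_right
        by (simp add: power2_eq_square algebra_simps)
      show ?thesis
        using 1 2 unfolding 3 4 t_def[symmetric] z_def[symmetric] b_def[symmetric]
        by (simp add: algebra_simps)
    qed
  qed
  moreover have "(\<integral>x. S x - T x \<partial>lborel) = (\<integral>x. S x \<partial>lborel) - (\<integral>x. T x \<partial>lborel)"
    by (rule Bochner_Integration.integral_diff[OF iS iT])
  moreover have "(\<integral>x. (1 + 1 / \<delta>) * ((\<phi> (u x))\<^sup>2 * (norm (grad \<psi> x))\<^sup>2) - \<eta> * (f' (u x) * (\<phi> (u x))\<^sup>2 * (\<psi> x)\<^sup>2) \<partial>lborel)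
    = (1 + 1 / \<delta>) * (\<integral>x. (\<phi> (u x))\<^sup>2 * (norm (grad \<psi> x))\<^sup>2 \<partial>lborel)
      - \<eta> * (\<integral>x. f' (u x) * (\<phi> (u x))\<^sup>2 * (\<psi> x)\<^sup>2 \<partial>lborel)"
    by (simp only: Bochner_Integration.integral_diff[OF integrable_mult_right[OF i5] integrable_mult_right[OF i6]]
        integral_mult_right_zero)
  ultimately show ?thesis by linarith
qed

section \<open>Construction of the test functions\<close>

lemma powr_between:
  fixes y Y x :: real
  assumes "1 \<le> y" "y \<le> Y"
  shows "Y powr (- \<bar>x\<bar>) \<le> y powr x" "y powr x \<le> Y powr \<bar>x\<bar>"
proof -
  have *: "y powr x \<le> Y powr \<bar>x\<bar>" for x
  proof -
    have "y powr x \<le> y powr \<bar>x\<bar>" using assms by (intro powr_mono) auto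
    also have "\<dots> \<le> Y powr \<bar>x\<bar>" using assms by (intro powr_mono2) auto
    finally show ?thesis .
  qed
  show "y powr x \<le> Y powr \<bar>x\<bar>" by (rule *)
  show "Y powr (- \<bar>x\<bar>) \<le> y powr x"
    using le_imp_inverse_le[OF *[of "- x"]] assms by (simp add: powr_minus)
qed

text \<open>In terms of \<open>\<beta> = f * \<phi>' / (\<phi> * f')\<close>, \<open>c = f * K / (\<phi>\<^sup>2 * f')\<close> and \<open>r = f * f'' / f'\<^sup>2\<close>, the condition
  on \<open>K'\<close> reads \<open>f * c'(f) + c * (2 * \<beta> - 1 + r) \<ge> \<beta>\<^sup>2 + \<delta> * (\<beta> - c)\<^sup>2\<close>. Near \<open>0\<close> it holds because
  \<open>(\<alpha> - 1)\<^sup>2 < s0\<close>; elsewhere only \<open>r \<ge> 0\<close> is known, and there \<open>\<beta>\<close> is close to \<open>1\<close> and the growth of \<open>c\<close> helps.\<close>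

lemma test_functions_exist:
  fixes f f' f'' :: "real \<Rightarrow> real" and s0 \<alpha> M :: real
  assumes f: "\<And>t. t > 0 \<Longrightarrow> (f has_real_derivative f' t) (at t)"
    and f': "\<And>t. t > 0 \<Longrightarrow> (f' has_real_derivative f'' t) (at t)"
    and f'': "continuous_on {0<..} f''"
    and pos: "\<And>t. t > 0 \<Longrightarrow> f t > 0" "\<And>t. t > 0 \<Longrightarrow> f' t > 0" "\<And>t. t > 0 \<Longrightarrow> f'' t \<ge> 0"
    and mono: "\<And>s t. 0 < s \<Longrightarrow> s \<le> t \<Longrightarrow> f s \<le> f t"
    and lim: "((\<lambda>t. f t * f'' t / (f' t)\<^sup>2) \<longlongrightarrow> s0) (at_right 0)"
    and s0: "s0 \<le> 1" "(\<alpha> - 1)\<^sup>2 < s0" and M: "M > 0"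
  obtains \<phi> \<phi>' K K' :: "real \<Rightarrow> real" and \<eta> \<delta> C1 C2 :: real
  where "\<And>t. t > 0 \<Longrightarrow> (\<phi> has_real_derivative \<phi>' t) (at t)" "continuous_on {0<..} \<phi>'" "\<And>t. t > 0 \<Longrightarrow> \<phi> t > 0"
    "\<And>t. t > 0 \<Longrightarrow> (K has_real_derivative K' t) (at t)" "continuous_on {0<..} K'"
    "\<eta> > 0" "\<And>t. 0 < t \<Longrightarrow> t \<le> M \<Longrightarrow> f t * K t \<le> (1 - \<eta>) * f' t * (\<phi> t)\<^sup>2"
    "\<delta> > 0" "\<And>t. 0 < t \<Longrightarrow> t \<le> M \<Longrightarrow> \<delta> * (\<phi> t * \<phi>' t - K t)\<^sup>2 \<le> (\<phi> t)\<^sup>2 * (K' t - (\<phi>' t)\<^sup>2)"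
    "C1 > 0" "C2 > 0" "\<And>t. 0 < t \<Longrightarrow> t \<le> M \<Longrightarrow> C1 * f t powr \<alpha> \<le> \<phi> t \<and> \<phi> t \<le> C2 * f t powr \<alpha>"
proof -
  \<comment> \<open>A quarter of the gap: one \<mu> is spent on the error in the limit, one on the
    factor 1 - e, and two remain for \<delta>.\<close>
  define \<mu> where "\<mu> = (s0 - (\<alpha> - 1)\<^sup>2) / 4"
  have \<mu>4: "(\<alpha> - 1)\<^sup>2 = s0 - 4 * \<mu>" by (simp add: \<mu>_def field_simps)
  have \<mu>: "\<mu> > 0" using s0 by (simp add: \<mu>_def)
  have "\<forall>\<^sub>F t in at_right 0. f t * f'' t / (f' t)\<^sup>2 > s0 - \<mu>"
    using order_tendstoD(1)[OF lim, of "s0 - \<mu>"] \<mu> by simp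
  then obtain t1 where t1: "t1 > 0" "\<And>t. 0 < t \<Longrightarrow> t < t1 \<Longrightarrow> f t * f'' t / (f' t)\<^sup>2 > s0 - \<mu>"
    by (auto simp: eventually_at_right_field)
  define F where "F = f t1"
  define A where "A = \<bar>\<alpha> - 1\<bar>"
  define S where "S = f M"
  \<comment> \<open>E keeps the loss from 1 - e below \<mu> near 0, and \<eta> is the lower bound of
    e on (0, M], the gain in the first inequality. L is chosen after \<eta>, which does not depend
    on L, so that |\<beta> - 1| \<le> \<eta>/2 wherever f \<ge> F.\<close>
  define E where "E = min (1 / 2) (\<mu> / (2 + 2 * A))"
  define \<eta> where "\<eta> = E * exp (- 3 * S / F)"
  define L where "L = 2 * (A + 1) / (F * \<eta>)"
  define \<delta> where "\<delta> = min (2 * \<mu>) (\<eta> / 2) / (1 + A)\<^sup>2"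
  have F: "F > 0" and A: "A \<ge> 0" and S: "S > 0" using pos t1 M by (auto simp: F_def A_def S_def)
  have E: "E > 0" "E \<le> 1 / 2" "E * (2 + 2 * A) \<le> \<mu>"
  proof -
    have "E * (2 + 2 * A) \<le> \<mu> / (2 + 2 * A) * (2 + 2 * A)"
      using A by (intro mult_right_mono) (auto simp: E_def)
    then show "E * (2 + 2 * A) \<le> \<mu>" using A by simp
    show "E \<le> 1 / 2" unfolding E_def by (rule min.cobounded1)
  qed (use \<mu> A in \<open>auto simp: E_def\<close>)
  have \<eta>: "\<eta> > 0" "\<eta> \<le> E" using E F S by (auto simp: \<eta>_def)
  have L: "L > 0" using A F \<eta> by (simp add: L_def)
  have \<delta>: "\<delta> > 0" "\<delta> * (1 + A)\<^sup>2 \<le> 2 * \<mu>" "\<delta> * (1 + A)\<^sup>2 \<le> \<eta> / 2"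
    using \<mu> \<eta> A by (auto simp: \<delta>_def)
  \<comment> \<open>f / (1 + L f) behaves like f where L f is small and is nearly constant where L f
    is large. So \<phi> passes from f^\<alpha> to a multiple of f, and \<beta> from \<alpha> to
    1.\<close>
  define \<phi> where "\<phi> t = f t * (f t / (1 + L * f t)) powr (\<alpha> - 1)" for t
  define \<beta> where "\<beta> t = 1 + (\<alpha> - 1) / (1 + L * f t)" for t
  define \<phi>' where "\<phi>' t = \<beta> t * \<phi> t * f' t / f t" for t
  \<comment> \<open>With c = 1 - e the term f c'(f) equals 3 (f / F) e: never negative, and at least
    3 e once f \<ge> F.\<close>
  define e where "e t = E * exp (- 3 * f t / F)" for t
  define K where "K t = (1 - e t) * (\<phi> t)\<^sup>2 * f' t / f t" for t
  define Q where "Q t = 3 * f t / F * e t + (1 - e t) * (2 * \<beta> t - 1 + f t * f'' t / (f' t)\<^sup>2)" for t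
  define K' where "K' t = (\<phi> t)\<^sup>2 * (f' t)\<^sup>2 / (f t)\<^sup>2 * Q t" for t
  have L1: "1 + L * f t > 0" if "t > 0" for t using pos(1)[OF that] L by (simp add: add_pos_pos)
  have \<phi>_pos: "\<phi> t > 0" if "t > 0" for t using pos(1)[OF that] L1[OF that] by (simp add: \<phi>_def)
  have d\<phi>: "(\<phi> has_real_derivative \<phi>' t) (at t)" if t: "t > 0" for t
  proof -
    define q where "q = f t / (1 + L * f t)"
    have q: "q > 0" using pos(1)[OF t] L1[OF t] by (simp add: q_def)
    have dq: "((\<lambda>t. f t / (1 + L * f t)) has_real_derivative f' t / (1 + L * f t)\<^sup>2) (at t)"
      using L1[OF t] by (auto intro!: derivative_eq_intros f[OF t] simp: field_simps power2_eq_square)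
    have "((\<lambda>t. (f t / (1 + L * f t)) powr (\<alpha> - 1)) has_real_derivative
        (\<alpha> - 1) * q powr (\<alpha> - 1 - 1) * (f' t / (1 + L * f t)\<^sup>2)) (at t)"
      using DERIV_fun_powr[OF dq, of "\<alpha> - 1"] q by (simp add: q_def)
    from DERIV_mult[OF f[OF t] this]
    have "(\<phi> has_real_derivative f' t * q powr (\<alpha> - 1)
       + (\<alpha> - 1) * q powr (\<alpha> - 1 - 1) * (f' t / (1 + L * f t)\<^sup>2) * f t) (at t)"
      unfolding \<phi>_def[abs_def] q_def .
    moreover have "q powr (\<alpha> - 1 - 1) = q powr (\<alpha> - 1) / q" using q powr_diff[of q "\<alpha> - 1" 1] by simp
    moreover have "f' t * q powr (\<alpha> - 1) + (\<alpha> - 1) * (q powr (\<alpha> - 1) / q) * (f' t / (1 + L * f t)\<^sup>2) * f t = \<phi>' t"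
    proof -
      have "(1 / q) * f t / (1 + L * f t)\<^sup>2 = 1 / (1 + L * f t)"
        using pos(1)[OF t] L1[OF t] by (simp add: q_def power2_eq_square)
      moreover have "(\<alpha> - 1) * (q powr (\<alpha> - 1) / q) * (f' t / (1 + L * f t)\<^sup>2) * f t
         = (\<alpha> - 1) * q powr (\<alpha> - 1) * f' t * ((1 / q) * f t / (1 + L * f t)\<^sup>2)"
        by simp
      ultimately have eq: "(\<alpha> - 1) * (q powr (\<alpha> - 1) / q) * (f' t / (1 + L * f t)\<^sup>2) * f t
         = (\<alpha> - 1) * q powr (\<alpha> - 1) * f' t * (1 / (1 + L * f t))"
        by (simp only:)
      have "\<phi>' t = f' t * q powr (\<alpha> - 1) * (1 + (\<alpha> - 1) * (1 / (1 + L * f t)))"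
        using pos(1)[OF t] by (simp add: \<phi>'_def \<phi>_def \<beta>_def q_def[symmetric])
      then show ?thesis unfolding eq by (simp add: algebra_simps add_divide_distrib diff_divide_distrib)
    qed
    ultimately show ?thesis by simp
  qed
  have de: "(e has_real_derivative - (3 * f' t / F * e t)) (at t)" if "t > 0" for t
    unfolding e_def[abs_def] using F by (auto intro!: derivative_eq_intros f[OF that])
  have dK: "(K has_real_derivative K' t) (at t)" if t: "t > 0" for t
  proof -
    have "(K has_real_derivative
       ((3 * f' t / F * e t) * (\<phi> t)\<^sup>2 * f' t + (1 - e t) * (2 * \<phi> t * \<phi>' t) * f' t
        + (1 - e t) * (\<phi> t)\<^sup>2 * f'' t) / f t - (1 - e t) * (\<phi> t)\<^sup>2 * f' t * f' t / (f t)\<^sup>2) (at t)"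
      unfolding K_def[abs_def] using pos(1)[OF t]
      by (auto intro!: derivative_eq_intros de[OF t] d\<phi>[OF t] f[OF t] f'[OF t]
        simp: field_simps power2_eq_square)
    also have "((3 * f' t / F * e t) * (\<phi> t)\<^sup>2 * f' t + (1 - e t) * (2 * \<phi> t * \<phi>' t) * f' t
        + (1 - e t) * (\<phi> t)\<^sup>2 * f'' t) / f t - (1 - e t) * (\<phi> t)\<^sup>2 * f' t * f' t / (f t)\<^sup>2 = K' t"
      unfolding K'_def Q_def \<phi>'_def using pos(1)[OF t] pos(2)[OF t] F
      by (simp add: divide_simps) (simp add: power2_eq_square algebra_simps)
    finally show ?thesis .
  qed
  have cf: "continuous_on {0<..} f" "continuous_on {0<..} f'"
    using f f' by (auto intro!: DERIV_continuous_on intro: has_field_derivative_at_within)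
  have c\<phi>: "continuous_on {0<..} \<phi>"
    using d\<phi> by (auto intro!: DERIV_continuous_on intro: has_field_derivative_at_within)
  have nz: "\<And>t. t > 0 \<Longrightarrow> f t \<noteq> 0" "\<And>t. t > 0 \<Longrightarrow> f' t \<noteq> 0" "\<And>t. t > 0 \<Longrightarrow> 1 + L * f t \<noteq> 0"
    using pos(1,2) L1 by (metis less_irrefl)+
  have c\<phi>': "continuous_on {0<..} \<phi>'" "continuous_on {0<..} K'"
    unfolding \<phi>'_def[abs_def] K'_def[abs_def] \<beta>_def Q_def e_def
    by (intro continuous_intros cf c\<phi> f''; use nz F in force)+
  have b: "\<bar>\<beta> t - 1\<bar> \<le> A" if "t > 0" for t
  proof -
    have "A / (1 + L * f t) \<le> A / 1"
      using A pos(1)[OF that] L L1[OF that] by (intro divide_left_mono) auto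
    then show ?thesis using L1[OF that] by (simp add: \<beta>_def A_def)
  qed
  have e: "\<eta> \<le> e t" "e t \<le> E" if "0 < t" "t \<le> M" for t
    using mono[OF that] pos(1)[OF that(1)] E F by (auto simp: \<eta>_def e_def S_def divide_right_mono)
  have Q: "\<delta> * (\<beta> t - (1 - e t))\<^sup>2 \<le> Q t - (\<beta> t)\<^sup>2" if t: "0 < t" "t \<le> M" for t
  proof -
    define y r where "y = \<beta> t - 1" and "r = f t * f'' t / (f' t)\<^sup>2"
    have r: "r \<ge> 0" using pos t by (simp add: r_def less_imp_le)
    have et: "0 < e t" "e t \<le> 1 / 2" using e[OF t] \<eta> E by auto
    have "\<bar>\<beta> t - (1 - e t)\<bar> \<le> 1 + A" using b[OF t(1)] et by (simp add: abs_if split: if_splits)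
    then have "(\<beta> t - (1 - e t))\<^sup>2 \<le> (1 + A)\<^sup>2"
      using A by (simp add: abs_le_square_iff[symmetric])
    then have D: "\<delta> * (\<beta> t - (1 - e t))\<^sup>2 \<le> \<delta> * (1 + A)\<^sup>2" using \<delta> by simp
    have Qt: "Q t = 3 * f t / F * e t + (1 - e t) * (1 + 2 * y + r)"
      by (simp add: Q_def y_def r_def)
    have \<beta>: "\<beta> t = 1 + y" by (simp add: y_def)
    show ?thesis
    proof (cases "t < t1")
      case True
      \<comment> \<open>Near 0 the expression 2 \<beta> - 1 + r - \<beta>^2 equals r - (\<beta> -
        1)^2 and is at least 3 \<mu>; the factor 1 - e takes away at most one more \<mu>.\<close>
      have "r \<ge> s0 - \<mu>" using t1(2)[OF t(1) True] by (simp add: r_def)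
      have y2: "y\<^sup>2 \<le> (\<alpha> - 1)\<^sup>2" using b[OF t(1)] by (simp add: y_def A_def abs_le_square_iff[symmetric])
      define Y where "Y = 1 + 2 * y + (s0 - \<mu>)"
      have Y1: "Y \<ge> (1 + y)\<^sup>2 + 3 * \<mu>"
        using y2 \<mu>4 by (simp add: Y_def power2_sum)
      have Y2: "Y \<le> 2 + 2 * A" using b[OF t(1)] s0 \<mu> by (simp add: Y_def y_def)
      have "Y \<ge> 0" using Y1 \<mu> by (smt (verit) zero_le_power2)
      have "(1 - e t) * (1 + 2 * y + r) \<ge> (1 - e t) * Y"
        using et \<open>r \<ge> s0 - \<mu>\<close> by (intro mult_left_mono) (auto simp: Y_def)
      moreover have "e t * Y \<le> E * (2 + 2 * A)"
        using e[OF t] et Y2 \<open>Y \<ge> 0\<close> by (intro mult_mono) auto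
      moreover have "3 * f t / F * e t \<ge> 0" using pos(1)[OF t(1)] F et by simp
      ultimately have "Q t - (1 + y)\<^sup>2 \<ge> 2 * \<mu>"
        using Y1 E(3) unfolding Qt by (simp add: left_diff_distrib)
      then show ?thesis using D \<delta>(2) unfolding \<beta> by linarith
    next
      case False
      then have fF: "f t \<ge> F" using mono[of t1 t] t1 by (simp add: F_def)
      have yb: "\<bar>y\<bar> \<le> \<eta> / 2"
      proof -
        have "\<bar>y\<bar> = A / (1 + L * f t)" using L1[OF t(1)] by (simp add: y_def \<beta>_def A_def)
        also have "\<dots> \<le> (A + 1) / (L * F)"
          using A L F fF by (intro frac_le) (auto intro: add_increasing)
        also have "L * F = (A + 1) * (2 / \<eta>)" using F by (simp add: L_def)
        also have "(A + 1) / ((A + 1) * (2 / \<eta>)) = \<eta> / 2"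
          using A mult_divide_mult_cancel_left[of "A + 1" 1 "2 / \<eta>"] by (simp del: distrib_right_numeral)
        finally show ?thesis .
      qed
      then have "y\<^sup>2 \<le> (\<eta> / 2)\<^sup>2" using \<eta> by (simp add: abs_le_square_iff[symmetric])
      also have "\<dots> \<le> \<eta> / 2 * 1" unfolding power2_eq_square using \<eta> E by (intro mult_left_mono) auto
      finally have y2: "y\<^sup>2 \<le> \<eta> / 2" by simp
      have y4: "\<bar>y\<bar> \<le> 1 / 4" using yb \<eta> E by simp
      \<comment> \<open>Here nothing beyond r \<ge> 0 is available: the growth of c contributes 3 e,
        the factor 1 - e costs e, and the remainder 2 e y + y^2 is small by the choice of L.\<close>
      have "3 * f t / F * e t \<ge> 3 * e t"
        using fF F et by (simp add: field_simps)
      moreover have "(1 - e t) * (1 + 2 * y + r) \<ge> (1 - e t) * (1 + 2 * y)"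
        using r et by (intro mult_left_mono) auto
      ultimately have "Q t - (1 + y)\<^sup>2 \<ge> 2 * e t - 2 * (e t * y) - y\<^sup>2"
        unfolding Qt by (simp add: power2_eq_square algebra_simps)
      moreover have "e t * y \<le> e t * (1 / 4)" using y4 et by (intro mult_left_mono) auto
      ultimately have "Q t - (1 + y)\<^sup>2 \<ge> \<eta> / 2" using y2 e(1)[OF t] et by linarith
      then show ?thesis using D \<delta>(3) unfolding \<beta> by linarith
    qed
  qed
  have "1 + L * S > 0" using L S by (simp add: add_pos_pos)
  then have LS: "(1 + L * S) powr x > 0" for x by simp
  show ?thesis
  proof (rule that[of \<phi> \<phi>' K K' \<eta> \<delta> "(1 + L * S) powr (- \<bar>1 - \<alpha>\<bar>)" "(1 + L * S) powr \<bar>1 - \<alpha>\<bar>"])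
    show "f t * K t \<le> (1 - \<eta>) * f' t * (\<phi> t)\<^sup>2" if t: "0 < t" "t \<le> M" for t
    proof -
      have "f t * K t = (1 - e t) * (f' t * (\<phi> t)\<^sup>2)" using pos(1)[OF t(1)] by (simp add: K_def)
      also have "\<dots> \<le> (1 - \<eta>) * (f' t * (\<phi> t)\<^sup>2)"
        using e(1)[OF t] pos(2)[OF t(1)] by (intro mult_right_mono) auto
      finally show ?thesis by (simp add: mult.assoc)
    qed
    show "\<delta> * (\<phi> t * \<phi>' t - K t)\<^sup>2 \<le> (\<phi> t)\<^sup>2 * (K' t - (\<phi>' t)\<^sup>2)" if t: "0 < t" "t \<le> M" for t
    proof -
      define P where "P = ((\<phi> t)\<^sup>2 * f' t / f t)\<^sup>2"
      have "\<phi> t * \<phi>' t - K t = ((\<phi> t)\<^sup>2 * f' t / f t) * (\<beta> t - (1 - e t))"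
        unfolding \<phi>'_def K_def using pos(1)[OF t(1)] by (simp add: power2_eq_square field_simps)
      then have 1: "\<delta> * (\<phi> t * \<phi>' t - K t)\<^sup>2 = P * (\<delta> * (\<beta> t - (1 - e t))\<^sup>2)"
        unfolding P_def by (simp only: power_mult_distrib mult.left_commute)
      have 2: "(\<phi> t)\<^sup>2 * (K' t - (\<phi>' t)\<^sup>2) = P * (Q t - (\<beta> t)\<^sup>2)"
        unfolding \<phi>'_def K'_def P_def using pos(1)[OF t(1)] by (simp add: power2_eq_square field_simps)
      show ?thesis unfolding 1 2 using Q[OF t] by (intro mult_left_mono) (auto simp: P_def)
    qed
    show "(1 + L * S) powr (- \<bar>1 - \<alpha>\<bar>) * f t powr \<alpha> \<le> \<phi> t \<and> \<phi> t \<le> (1 + L * S) powr \<bar>1 - \<alpha>\<bar> * f t powr \<alpha>"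
      if t: "0 < t" "t \<le> M" for t
    proof -
      have "\<phi> t = (f t powr 1 * f t powr (\<alpha> - 1)) * ((1 + L * f t) powr (1 - \<alpha>))"
        using pos(1)[OF t(1)] L1[OF t(1)]
        by (simp add: \<phi>_def powr_divide powr_minus_divide[of _ "\<alpha> - 1", simplified])
      also have "f t powr 1 * f t powr (\<alpha> - 1) = f t powr \<alpha>"
        using powr_add[of "f t" 1 "\<alpha> - 1"] by simp
      finally have \<phi>t: "\<phi> t = (1 + L * f t) powr (1 - \<alpha>) * f t powr \<alpha>" by (simp add: mult.commute)
      \<comment> \<open>On (0, M] the correction factor ranges over a compact interval, so despite
        the modification \<phi> stays comparable to f^\<alpha>.\<close>
      have "1 \<le> 1 + L * f t" "1 + L * f t \<le> 1 + L * S"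
        using pos(1)[OF t(1)] L mono[OF t] by (auto simp: S_def)
      from powr_between[OF this, of "1 - \<alpha>"] show ?thesis
        unfolding \<phi>t by (auto intro!: mult_right_mono)
    qed
  qed (fact d\<phi> c\<phi>' \<phi>_pos dK \<eta>(1) \<delta>(1) LS)+
qed

section \<open>Energy on annuli\<close>

lemma square_powr: "x > 0 \<Longrightarrow> (x\<^sup>2) powr q = x powr (2 * q)" for x q :: real
  using powr_powr[of x 2 q] by simp

text \<open>The estimate is applied to \<zeta>^k, and u^\<tau> is absorbed by a pointwise Young
  inequality with the dual exponents \<sigma> / \<tau> and q = \<sigma> / (p - 1). The choice k
  \<ge> q keeps the leftover power of \<zeta> nonnegative. Bounded support makes the energy finite,
  so half of it may be moved to the left.\<close>

lemma energy_absorption: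
  fixes u :: "'a::euclidean_space \<Rightarrow> real" and p \<sigma> \<tau> C :: real
  assumes u: "continuous_on UNIV u" "\<And>x. u x > 0" and p: "p > 1" "\<tau> > 0" "\<sigma> = \<tau> + p - 1" and C: "C > 0"
    and est: "\<And>\<psi>. \<psi> \<in> C1c A \<Longrightarrow>
      (\<integral>x. u x powr \<sigma> * (\<psi> x)\<^sup>2 \<partial>lborel) \<le> C * (\<integral>x. u x powr \<tau> * (norm (grad \<psi> x))\<^sup>2 \<partial>lborel)"
  shows "\<exists>C' k. C' > 0 \<and> k > (0::nat) \<and> (\<forall>\<zeta>\<in>C1c A. (\<forall>x. 0 \<le> \<zeta> x \<and> \<zeta> x \<le> 1) \<longrightarrow>
      (\<integral>x. u x powr \<sigma> * \<zeta> x ^ k \<partial>lborel) \<le> C' * (\<integral>x. ((norm (grad \<zeta> x))\<^sup>2) powr (\<sigma> / (p - 1)) \<partial>lborel))"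
proof -
  define q where "q = \<sigma> / (p - 1)"
  have q: "q > 1" "q = 1 + \<tau> / (p - 1)" using p by (auto simp: q_def field_simps)
  obtain k :: nat where k: "real k \<ge> q" using real_arch_simple by blast
  then have k1: "k \<ge> 2" using q by linarith
  define B where "B = 2 * C * (real k)\<^sup>2"
  define C' where "C' = B powr q / 2"
  have B: "B > 0" and C': "C' > 0" using C k1 by (auto simp: B_def C'_def)
  have nz: "u x \<noteq> 0" for x using u(2)[of x] by simp
  have cu: "continuous_on UNIV (\<lambda>x. u x powr a)" for a by (intro continuous_intros u) (use nz in auto)
  have young: "C * (X powr \<tau> * ((real k)\<^sup>2 * z ^ (2 * k - 2) * G)) \<le> X powr \<sigma> * z ^ (2 * k) / 2 + C' * G powr q"
    if "X > 0" "0 \<le> z" "z \<le> 1" "0 \<le> G" for X z G :: real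
  proof (cases "z = 0 \<or> G = 0")
    case True
    then have "(real k)\<^sup>2 * z ^ (2 * k - 2) * G = 0" using k1 by auto
    moreover have "0 \<le> X powr \<sigma> * z ^ (2 * k) / 2 + C' * G powr q" using that C' by simp
    ultimately show ?thesis by (simp only: mult_zero_right)
  next
    case False
    then have z: "z > 0" "G > 0" using that by auto
    have zk: "z ^ (2 * k) = z ^ (2 * k - 2) * z\<^sup>2"
    proof -
      have "2 * k = (2 * k - 2) + 2" using k1 by simp
      then show ?thesis by (metis power_add)
    qed
    \<comment> \<open>The threshold for X^(p-1): above Y the left side is at most half of the energy
      term, below Y the factor X^\<tau> is bounded by a power of Y and the gradient term
      suffices.\<close>
    define Y where "Y = B * G / z\<^sup>2"
    have Y: "Y > 0" using B z by (simp add: Y_def)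
    have lhs: "C * (X powr \<tau> * ((real k)\<^sup>2 * z ^ (2 * k - 2) * G)) = Y * X powr \<tau> * z ^ (2 * k) / 2"
      unfolding zk Y_def B_def using z by simp
    show ?thesis
    proof (cases "X powr (p - 1) \<ge> Y")
      case True
      then have "Y * X powr \<tau> \<le> X powr (p - 1) * X powr \<tau>" by (intro mult_right_mono) auto
      also have "\<dots> = X powr \<sigma>" by (simp only: powr_add[symmetric]) (simp add: p(3) algebra_simps)
      finally have "Y * X powr \<tau> * z ^ (2 * k) \<le> X powr \<sigma> * z ^ (2 * k)"
        using z by (intro mult_right_mono) auto
      moreover have "0 \<le> C' * G powr q" using C' by simp
      ultimately show ?thesis unfolding lhs by linarith
    next
      case False
      have "X powr \<tau> = (X powr (p - 1)) powr (\<tau> / (p - 1))"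
        using p by (simp add: powr_powr)
      also have "\<dots> \<le> Y powr (\<tau> / (p - 1))" using False p by (intro powr_mono2) auto
      finally have "Y * X powr \<tau> \<le> Y powr 1 * Y powr (\<tau> / (p - 1))"
        using Y by (intro mult_mono) auto
      also have "\<dots> = Y powr q" unfolding q(2) by (simp add: powr_add)
      also have "Y powr q = B powr q * G powr q / z powr (2 * q)"
        unfolding Y_def using B z square_powr[of z q] by (simp add: powr_divide powr_mult)
      finally have "Y * X powr \<tau> * z ^ (2 * k) \<le> B powr q * G powr q / z powr (2 * q) * z powr (2 * real k)"
        using z powr_realpow[of z "2 * k"] by (intro mult_mono) auto
      also have "\<dots> = B powr q * G powr q * z powr (2 * (real k - q))"
        using z by (simp add: powr_diff right_diff_distrib)
      also have "\<dots> \<le> B powr q * G powr q * 1"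
        using z that k by (intro mult_left_mono powr_le1) auto
      finally have "Y * X powr \<tau> * z ^ (2 * k) / 2 \<le> C' * G powr q" by (simp add: C'_def)
      moreover have "0 \<le> X powr \<sigma> * z ^ (2 * k) / 2" using z by simp
      ultimately show ?thesis unfolding lhs by linarith
    qed
  qed
  show ?thesis
  proof (rule exI[of _ "2 * C'"], rule exI[of _ "2 * k"], intro conjI ballI impI)
    show "0 < 2 * C'" "0 < 2 * k" using C' k1 by auto
    fix \<zeta> assume \<zeta>: "\<zeta> \<in> C1c A" "\<forall>x. 0 \<le> \<zeta> x \<and> \<zeta> x \<le> 1"
    obtain r where r: "\<And>x. norm x > r \<Longrightarrow> \<zeta> x = 0" using C1c_vanishes_outside[OF \<zeta>(1)] by blast
    have gr: "norm x > r \<Longrightarrow> grad \<zeta> x = 0" for x using bounded_support_grad[of r \<zeta> x] r by blast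
    have \<zeta>1: "C1 \<zeta>" using \<zeta> by (simp add: C1c_def)
    note pw = C1_compose[OF \<zeta>1 open_UNIV, of "\<lambda>z. z ^ k" "\<lambda>z. real k * z ^ (k - 1)"]
    have d: "((\<lambda>z. z ^ k) has_real_derivative real k * z ^ (k - 1)) (at z)" for z :: real
      by (auto intro!: derivative_eq_intros)
    have pk: "C1 (\<lambda>x. \<zeta> x ^ k)" "grad (\<lambda>x. \<zeta> x ^ k) = (\<lambda>x. (real k * \<zeta> x ^ (k - 1)) *\<^sub>R grad \<zeta> x)"
      by (intro pw d continuous_intros; simp)+
    have pc: "(\<lambda>x. \<zeta> x ^ k) \<in> C1c A"
    proof -
      have "C1 (\<lambda>x. \<zeta> x ^ (k - 1))"
        by (rule C1_compose[OF \<zeta>1 open_UNIV, of "\<lambda>z. z ^ (k - 1)" "\<lambda>z. real (k - 1) * z ^ (k - 1 - 1)"])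
          (auto intro!: derivative_eq_intros continuous_intros)
      from C1c_mult[OF \<zeta>(1) this] show ?thesis
        using k1 power_add[of "\<zeta> _" "k - 1" 1] by (simp add: power_Suc2[symmetric] del: power_Suc)
    qed
    have c: "continuous_on UNIV (\<lambda>x. ((norm (grad \<zeta> x))\<^sup>2) powr q)"
      using q by (intro continuous_on_powr' continuous_intros C1_continuous_grad \<zeta>1) auto
    have i1: "integrable lborel (\<lambda>x. u x powr \<sigma> * \<zeta> x ^ (2 * k))"
      by (rule integrable_continuous_bounded_support[of _ r], intro continuous_on_mult continuous_on_power cu C1_continuous[OF \<zeta>1])
        (use r k1 in auto)
    have i2: "integrable lborel (\<lambda>x. ((norm (grad \<zeta> x))\<^sup>2) powr q)"
      by (rule integrable_continuous_bounded_support[OF c, of r]) (simp add: gr)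
    have i3: "integrable lborel (\<lambda>x. u x powr \<tau> * ((real k)\<^sup>2 * \<zeta> x ^ (2 * k - 2) * (norm (grad \<zeta> x))\<^sup>2))"
      by (rule integrable_continuous_bounded_support[of _ r], intro continuous_on_mult continuous_on_power continuous_on_const continuous_on_norm cu C1_continuous[OF \<zeta>1] C1_continuous_grad[OF \<zeta>1])
        (use gr in auto)
    have "(\<integral>x. u x powr \<sigma> * \<zeta> x ^ (2 * k) \<partial>lborel) = (\<integral>x. u x powr \<sigma> * (\<zeta> x ^ k)\<^sup>2 \<partial>lborel)"
      by (simp add: power_mult[symmetric] mult.commute)
    also have "\<dots> \<le> C * (\<integral>x. u x powr \<tau> * (norm (grad (\<lambda>x. \<zeta> x ^ k) x))\<^sup>2 \<partial>lborel)" by (rule est[OF pc])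
    also have "(\<lambda>x. u x powr \<tau> * (norm (grad (\<lambda>x. \<zeta> x ^ k) x))\<^sup>2)
        = (\<lambda>x. u x powr \<tau> * ((real k)\<^sup>2 * \<zeta> x ^ (2 * k - 2) * (norm (grad \<zeta> x))\<^sup>2))"
      unfolding pk(2)
      by (simp add: power_mult_distrib power_mult[symmetric] diff_mult_distrib mult.commute[of 2])
    also have "C * (\<integral>x. u x powr \<tau> * ((real k)\<^sup>2 * \<zeta> x ^ (2 * k - 2) * (norm (grad \<zeta> x))\<^sup>2) \<partial>lborel)
        = (\<integral>x. C * (u x powr \<tau> * ((real k)\<^sup>2 * \<zeta> x ^ (2 * k - 2) * (norm (grad \<zeta> x))\<^sup>2)) \<partial>lborel)"
      by (rule integral_mult_right_zero[symmetric])
    also have "\<dots> \<le> (\<integral>x. u x powr \<sigma> * \<zeta> x ^ (2 * k) / 2 + C' * ((norm (grad \<zeta> x))\<^sup>2) powr q \<partial>lborel)"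
      by (intro integral_mono young u integrable_mult_right Bochner_Integration.integrable_add
          Bochner_Integration.integrable_divide i1 i2 i3) (use \<zeta>(2) in auto)
    also have "\<dots> = (\<integral>x. u x powr \<sigma> * \<zeta> x ^ (2 * k) \<partial>lborel) / 2 + C' * (\<integral>x. ((norm (grad \<zeta> x))\<^sup>2) powr q \<partial>lborel)"
      using i1 i2 by simp
    finally show "(\<integral>x. u x powr \<sigma> * \<zeta> x ^ (2 * k) \<partial>lborel)
        \<le> 2 * C' * (\<integral>x. ((norm (grad \<zeta> x))\<^sup>2) powr (\<sigma> / (p - 1)) \<partial>lborel)"
      by (simp add: q_def)
  qed
qed

section \<open>Cutoff functions and the energy on annuli\<close>

definition smooth_step :: "real \<Rightarrow> real"
  where "smooth_step t = 1 - (max 0 (1 - (max 0 t)\<^sup>2))\<^sup>2"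

definition smooth_step' :: "real \<Rightarrow> real"
  where "smooth_step' t = 4 * max 0 (1 - (max 0 t)\<^sup>2) * max 0 t"

lemma smooth_step_derivative: "(smooth_step has_real_derivative smooth_step' t) (at t)"
proof -
  have "((\<lambda>t::real. 1 - (max 0 t)\<^sup>2) has_real_derivative - (2 * max 0 t)) (at t)"
    using DERIV_diff[OF DERIV_const[of 1] has_real_derivative_max_0_square] by simp
  from DERIV_diff[OF DERIV_const DERIV_chain2[OF has_real_derivative_max_0_square this], of 1]
  show ?thesis by (simp add: smooth_step_def[abs_def] smooth_step'_def mult.assoc)
qed

lemma smooth_step_bounds: "0 \<le> smooth_step t" "smooth_step t \<le> 1"
  and smooth_step_eq_0: "t \<le> 0 \<Longrightarrow> smooth_step t = 0"
  and smooth_step_eq_1: "t \<ge> 1 \<Longrightarrow> smooth_step t = 1"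
  and smooth_step'_eq_0: "t \<ge> 1 \<Longrightarrow> smooth_step' t = 0" "t \<le> 0 \<Longrightarrow> smooth_step' t = 0"
  and smooth_step'_bound: "\<bar>smooth_step' t\<bar> \<le> 4"
proof -
  define a where "a = max 0 (1 - (max 0 t)\<^sup>2)"
  have a: "0 \<le> a" "a \<le> 1" by (auto simp: a_def)
  show "0 \<le> smooth_step t" "smooth_step t \<le> 1"
    using a power_le_one[of a 2] by (simp_all add: smooth_step_def a_def[symmetric])
  show "smooth_step t = 0" if "t \<le> 0" using that by (simp add: smooth_step_def max_def)
  have "(max 0 t)\<^sup>2 \<ge> 1" if "t \<ge> 1" using that power_mono[of 1 t 2] by simp
  then show "t \<ge> 1 \<Longrightarrow> smooth_step t = 1" "t \<ge> 1 \<Longrightarrow> smooth_step' t = 0"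
    by (simp_all add: smooth_step_def smooth_step'_def)
  show "smooth_step' t = 0" if "t \<le> 0" using that by (simp add: smooth_step'_def)
  show "\<bar>smooth_step' t\<bar> \<le> 4"
  proof (cases "t \<ge> 1")
    case True
    then show ?thesis using \<open>t \<ge> 1 \<Longrightarrow> smooth_step' t = 0\<close> by simp
  next
    case False
    then have "a * max 0 t \<le> 1 * 1" using a by (intro mult_mono) auto
    then show ?thesis using a by (simp add: smooth_step'_def a_def[symmetric] abs_mult)
  qed
qed


lemma C1_radial_step:
  fixes s c :: real
  shows "C1 (\<lambda>x::'a::euclidean_space. smooth_step (s * (norm x)\<^sup>2 + c))"
    "grad (\<lambda>x::'a. smooth_step (s * (norm x)\<^sup>2 + c)) = (\<lambda>x. (2 * (smooth_step' (s * (norm x)\<^sup>2 + c) * s)) *\<^sub>R x)"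
proof -
  have d: "((\<lambda>t. smooth_step (s * t + c)) has_real_derivative smooth_step' (s * t + c) * s) (at t)" for t
    by (rule DERIV_chain2[OF smooth_step_derivative]) (auto intro!: derivative_eq_intros)
  have c: "continuous_on UNIV (\<lambda>t. smooth_step' (s * t + c) * s)"
    unfolding smooth_step'_def by (intro continuous_intros)
  show "C1 (\<lambda>x::'a. smooth_step (s * (norm x)\<^sup>2 + c))"
    "grad (\<lambda>x::'a. smooth_step (s * (norm x)\<^sup>2 + c)) = (\<lambda>x. (2 * (smooth_step' (s * (norm x)\<^sup>2 + c) * s)) *\<^sub>R x)"
    using C1_norm_square_compose[OF d c, where ?'a = 'a] by auto
qed

text \<open>A step rising between R1 and 2 R1 times one falling between R2 and 2 R2, each a profile
  of an affine function of |x|^2. A single step has gradient at most 16 / (3 R), with square below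
  32 / R^2; the product rule doubles this. Full balls instead of annuli on the right are enough,
  because only volumes of order R^N will matter.\<close>

lemma annular_cutoff:
  fixes R1 R2 :: real
  assumes R: "R1 > 0" "R2 \<ge> 2 * R1"
  obtains \<zeta> :: "'a::euclidean_space \<Rightarrow> real"
  where "C1 \<zeta>" "\<And>x. 0 \<le> \<zeta> x" "\<And>x. \<zeta> x \<le> 1"
    "\<And>x. 2 * R1 \<le> norm x \<Longrightarrow> norm x \<le> R2 \<Longrightarrow> \<zeta> x = 1"
    "\<And>x. norm x \<le> R1 \<Longrightarrow> \<zeta> x = 0" "\<And>x. norm x \<ge> 2 * R2 \<Longrightarrow> \<zeta> x = 0"
    "\<And>x. (norm (grad \<zeta> x))\<^sup>2 \<le> 64 / R1\<^sup>2 * indicator (cball 0 (2 * R1)) x + 64 / R2\<^sup>2 * indicator (cball 0 (2 * R2)) x"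
proof -
  have R2: "R2 > 0" using R by simp
  define s1 s2 where "s1 = 1 / (3 * R1\<^sup>2)" and "s2 = - 1 / (3 * R2\<^sup>2)"
  define a1 a2 where "a1 x = s1 * (norm x)\<^sup>2 + - 1 / 3" and "a2 x = s2 * (norm x)\<^sup>2 + 4 / 3" for x :: 'a
  define \<zeta>1 \<zeta>2 where "\<zeta>1 x = smooth_step (a1 x)" and "\<zeta>2 x = smooth_step (a2 x)" for x
  have a1: "a1 x \<ge> 1" if "norm x \<ge> 2 * R1" for x
    using that R power_mono[of "2 * R1" "norm x" 2] by (simp add: a1_def s1_def field_simps)
  have a1': "a1 x \<le> 0" if "norm x \<le> R1" for x
    using that R power_mono[of "norm x" R1 2] by (simp add: a1_def s1_def field_simps)
  have a2: "a2 x \<ge> 1" if "norm x \<le> R2" for x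
    using that R2 power_mono[of "norm x" R2 2] by (simp add: a2_def s2_def field_simps)
  have a2': "a2 x \<le> 0" if "norm x \<ge> 2 * R2" for x
    using that R2 power_mono[of "2 * R2" "norm x" 2] by (simp add: a2_def s2_def field_simps)
  note C1 = C1_radial_step[of s1 "- 1 / 3", where ?'a = 'a, folded a1_def, folded \<zeta>1_def]
    C1_radial_step[of s2 "4 / 3", where ?'a = 'a, folded a2_def, folded \<zeta>2_def]
  have g: "(norm ((2 * (b * s)) *\<^sub>R x))\<^sup>2 \<le> 32 / \<rho>\<^sup>2"
    if "\<bar>b\<bar> \<le> 4" "\<bar>s\<bar> = 1 / (3 * \<rho>\<^sup>2)" "norm x \<le> 2 * \<rho>" "\<rho> > 0" for b s \<rho> and x :: 'a
  proof -
    have "norm ((2 * (b * s)) *\<^sub>R x) = 2 * (\<bar>b\<bar> * \<bar>s\<bar>) * norm x" by (simp add: abs_mult)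
    also have "\<dots> \<le> 2 * (4 * (1 / (3 * \<rho>\<^sup>2))) * (2 * \<rho>)" using that by (intro mult_mono) auto
    also have "\<dots> = 16 / 3 / \<rho>" using that by (simp add: power2_eq_square)
    finally have "(norm ((2 * (b * s)) *\<^sub>R x))\<^sup>2 \<le> (16 / 3 / \<rho>)\<^sup>2" by (intro power_mono) auto
    also have "\<dots> \<le> 32 / \<rho>\<^sup>2" using that by (simp add: field_simps)
    finally show ?thesis .
  qed
  have g1: "(norm (grad \<zeta>1 x))\<^sup>2 \<le> 32 / R1\<^sup>2 * indicator (cball 0 (2 * R1)) x" for x
  proof (cases "norm x \<le> 2 * R1")
    case True
    then show ?thesis unfolding C1(2) using g[of "smooth_step' (a1 x)" s1 R1 x] R smooth_step'_bound
      by (simp add: s1_def)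
  next
    case False
    then show ?thesis unfolding C1(2) using smooth_step'_eq_0(1)[OF a1[of x]] by simp
  qed
  have g2: "(norm (grad \<zeta>2 x))\<^sup>2 \<le> 32 / R2\<^sup>2 * indicator (cball 0 (2 * R2)) x" for x
  proof (cases "norm x \<le> 2 * R2")
    case True
    then show ?thesis unfolding C1(4) using g[of "smooth_step' (a2 x)" s2 R2 x] R2 smooth_step'_bound
      by (simp add: s2_def)
  next
    case False
    then show ?thesis unfolding C1(4) using smooth_step'_eq_0(2)[OF a2'[of x]] by simp
  qed
  show ?thesis
  proof (rule that[of "\<lambda>x. \<zeta>1 x * \<zeta>2 x"])
    show "C1 (\<lambda>x. \<zeta>1 x * \<zeta>2 x)" by (rule C1_mult(1)[OF C1(1) C1(3)])
    show "(norm (grad (\<lambda>x. \<zeta>1 x * \<zeta>2 x) x))\<^sup>2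
      \<le> 64 / R1\<^sup>2 * indicator (cball 0 (2 * R1)) x + 64 / R2\<^sup>2 * indicator (cball 0 (2 * R2)) x" for x
    proof -
      have "norm (grad (\<lambda>x. \<zeta>1 x * \<zeta>2 x) x) \<le> norm (\<zeta>1 x *\<^sub>R grad \<zeta>2 x) + norm (\<zeta>2 x *\<^sub>R grad \<zeta>1 x)"
        unfolding C1_mult(2)[OF C1(1) C1(3)] by (rule norm_triangle_ineq)
      also have "\<dots> \<le> norm (grad \<zeta>2 x) + norm (grad \<zeta>1 x)"
        using smooth_step_bounds by (intro add_mono) (auto simp: \<zeta>1_def \<zeta>2_def mult_left_le_one_le)
      finally have "(norm (grad (\<lambda>x. \<zeta>1 x * \<zeta>2 x) x))\<^sup>2 \<le> (norm (grad \<zeta>2 x) + norm (grad \<zeta>1 x))\<^sup>2"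
        by (intro power_mono) auto
      also have "\<dots> \<le> 2 * (norm (grad \<zeta>2 x))\<^sup>2 + 2 * (norm (grad \<zeta>1 x))\<^sup>2"
        using sum_squares_bound[of "norm (grad \<zeta>2 x)" "norm (grad \<zeta>1 x)"] by (simp add: power2_sum)
      finally show ?thesis using g1[of x] g2[of x] by simp
    qed
  qed (use a1 a1' a2 a2' smooth_step_bounds smooth_step_eq_0 smooth_step_eq_1 in
      \<open>auto simp: \<zeta>1_def \<zeta>2_def mult_le_one\<close>)
qed

text \<open>For the annular cutoff the gradient integral at radius R is of order R^(N - 2 \<sigma> /
  (p - 1)). At \<sigma> = N (p - 1) / 2 this exponent is 0 and the bound is uniform in both radii;
  for larger \<sigma> it is negative and the energy decays at the scale invariant rate.\<close>

lemma annulus_energy_bound: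
  fixes u :: "'a::euclidean_space \<Rightarrow> real" and p \<sigma> \<tau> C :: real
  assumes u: "continuous_on UNIV u" "\<And>x. u x > 0" and p: "p > 1" "\<tau> > 0" "\<sigma> = \<tau> + p - 1" and C: "C > 0"
    and est: "\<And>\<psi>. \<psi> \<in> C1c (- S) \<Longrightarrow>
      (\<integral>x. u x powr \<sigma> * (\<psi> x)\<^sup>2 \<partial>lborel) \<le> C * (\<integral>x. u x powr \<tau> * (norm (grad \<psi> x))\<^sup>2 \<partial>lborel)"
    and S: "\<And>x. x \<in> S \<Longrightarrow> norm x < R0" and "R0 > 0"
  shows "\<exists>C'>0. \<forall>R1 R2. R0 \<le> R1 \<longrightarrow> 2 * R1 \<le> R2 \<longrightarrow>
      (\<integral>x. indicator {x. 2 * R1 \<le> norm x \<and> norm x \<le> R2} x * u x powr \<sigma> \<partial>lborel)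
      \<le> C' * (R1 powr (DIM('a) - 2 * (\<sigma> / (p - 1))) + R2 powr (DIM('a) - 2 * (\<sigma> / (p - 1))))"
proof -
  define q where "q = \<sigma> / (p - 1)"
  have q: "q > 0" using p by (simp add: q_def)
  obtain C0 k where C0: "C0 > 0" "k > 0" and absorb: "\<forall>\<zeta>\<in>C1c (- S). (\<forall>x. 0 \<le> \<zeta> x \<and> \<zeta> x \<le> 1) \<longrightarrow>
      (\<integral>x. u x powr \<sigma> * \<zeta> x ^ k \<partial>lborel) \<le> C0 * (\<integral>x. ((norm (grad \<zeta> x))\<^sup>2) powr q \<partial>lborel)"
    using energy_absorption[OF u p C est] unfolding q_def by blast
  have nz: "u x \<noteq> 0" for x using u(2)[of x] by simp
  have cu: "continuous_on UNIV (\<lambda>x. u x powr a)" for a by (intro continuous_intros u) (use nz in auto)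
  define V where "V = measure lborel (cball (0::'a) 1)"
  define C' where "C' = C0 * (2 powr q * 64 powr q * (V * 2 ^ DIM('a))) + 1"
  have V: "V \<ge> 0" by (simp add: V_def)
  have C': "C' > 0" using C0 V by (simp add: C'_def add_nonneg_pos)
  show ?thesis
    unfolding q_def[symmetric]
  proof (intro exI[of _ C'] conjI allI impI)
    fix R1 R2 assume R: "R0 \<le> R1" "2 * R1 \<le> R2"
    then have R': "R1 > 0" "R2 > 0" using \<open>R0 > 0\<close> by auto
    obtain \<zeta> :: "'a \<Rightarrow> real" where \<zeta>: "C1 \<zeta>" "\<And>x. 0 \<le> \<zeta> x" "\<And>x. \<zeta> x \<le> 1"
      "\<And>x. 2 * R1 \<le> norm x \<Longrightarrow> norm x \<le> R2 \<Longrightarrow> \<zeta> x = 1"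
      "\<And>x. norm x \<le> R1 \<Longrightarrow> \<zeta> x = 0" "\<And>x. norm x \<ge> 2 * R2 \<Longrightarrow> \<zeta> x = 0"
      "\<And>x. (norm (grad \<zeta> x))\<^sup>2 \<le> 64 / R1\<^sup>2 * indicator (cball 0 (2 * R1)) x + 64 / R2\<^sup>2 * indicator (cball 0 (2 * R2)) x"
      using annular_cutoff[OF R'(1) R(2), where ?'a = 'a] by blast
    have sup: "support_on UNIV \<zeta> \<subseteq> {x. R1 \<le> norm x \<and> norm x \<le> 2 * R2}"
      using \<zeta>(5,6) by (auto simp: support_on_def not_le[symmetric] linear) (metis linear)+
    have cl: "closed {x::'a. R1 \<le> norm x \<and> norm x \<le> 2 * R2}"
      by (intro closed_Collect_conj closed_Collect_le continuous_intros)
    have sup': "closure (support_on UNIV \<zeta>) \<subseteq> {x. R1 \<le> norm x \<and> norm x \<le> 2 * R2}"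
      by (rule closure_minimal[OF sup cl])
    then have "bounded (closure (support_on UNIV \<zeta>))"
      by (intro boundedI[of _ "2 * R2"]) auto
    then have \<zeta>c: "\<zeta> \<in> C1c (- S)"
      using sup' S R \<zeta>(1) by (fastforce simp: C1c_def compact_eq_bounded_closed)
    have G: "((norm (grad \<zeta> x))\<^sup>2) powr q \<le> 2 powr q * ((64 / R1\<^sup>2) powr q * indicator (cball 0 (2 * R1)) x
        + (64 / R2\<^sup>2) powr q * indicator (cball 0 (2 * R2)) x)" for x
    proof -
      define a b where "a = 64 / R1\<^sup>2 * indicator (cball 0 (2 * R1)) x" and "b = 64 / R2\<^sup>2 * indicator (cball 0 (2 * R2)) x"
      have ab: "a \<ge> 0" "b \<ge> 0" by (auto simp: a_def b_def)
      have "((norm (grad \<zeta> x))\<^sup>2) powr q \<le> (a + b) powr q"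
        using \<zeta>(7)[of x] q by (intro powr_mono2) (auto simp: a_def b_def)
      also have "\<dots> \<le> (2 * max a b) powr q" using ab q by (intro powr_mono2) auto
      also have "\<dots> = 2 powr q * (max a b) powr q" using ab by (simp add: powr_mult)
      also have "(max a b) powr q \<le> a powr q + b powr q" by (auto simp: max_def)
      finally have "((norm (grad \<zeta> x))\<^sup>2) powr q \<le> 2 powr q * (a powr q + b powr q)" by simp
      moreover have "a powr q = (64 / R1\<^sup>2) powr q * indicator (cball 0 (2 * R1)) x"
        "b powr q = (64 / R2\<^sup>2) powr q * indicator (cball 0 (2 * R2)) x"
        by (auto simp: a_def b_def indicator_def)
      ultimately show ?thesis by simp
    qed
    have gr: "norm x > 2 * R2 \<Longrightarrow> grad \<zeta> x = 0" for x
      using bounded_support_grad[of "2 * R2" \<zeta> x] \<zeta>(6) by auto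
    have cG: "continuous_on UNIV (\<lambda>x. ((norm (grad \<zeta> x))\<^sup>2) powr q)"
      using q by (intro continuous_on_powr' continuous_intros C1_continuous_grad \<zeta>(1)) auto
    have iG: "integrable lborel (\<lambda>x. ((norm (grad \<zeta> x))\<^sup>2) powr q)"
      by (rule integrable_continuous_bounded_support[OF cG, of "2 * R2"]) (simp add: gr)
    have ib: "integrable lborel (indicator (cball (0::'a) \<rho>) :: _ \<Rightarrow> real)" for \<rho>
      by (intro integrable_real_indicator emeasure_bounded_finite) auto
    have vol: "(64 / \<rho>\<^sup>2) powr q * measure lborel (cball (0::'a) (2 * \<rho>)) = 64 powr q * (V * 2 ^ DIM('a)) * \<rho> powr (DIM('a) - 2 * q)"
      if "\<rho> > 0" for \<rho>
    proof -
      have "measure lborel (cball (0::'a) (2 * \<rho>)) = V * 2 ^ DIM('a) * \<rho> powr DIM('a)"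
      proof -
        have "measure lborel (cball (0::'a) (2 * \<rho>)) = unit_ball_vol (real DIM('a)) * (2 * \<rho>) ^ DIM('a)"
          using that by (intro content_cball) simp
        moreover have "V = unit_ball_vol (real DIM('a)) * 1 ^ DIM('a)"
          unfolding V_def by (intro content_cball) simp
        moreover have "(2 * \<rho>) ^ DIM('a) = 2 ^ DIM('a) * \<rho> powr DIM('a)"
          by (simp only: power_mult_distrib powr_realpow[OF that])
        ultimately show ?thesis by (simp only: power_one mult_1_right mult.assoc)
      qed
      moreover have "(64 / \<rho>\<^sup>2) powr q = 64 powr q * \<rho> powr (- 2 * q)"
        using that square_powr[of \<rho> q] by (simp add: powr_divide powr_minus_divide)
      moreover have "\<rho> powr (- 2 * q) * \<rho> powr DIM('a) = \<rho> powr (DIM('a) - 2 * q)"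
        by (simp add: powr_add[symmetric])
      ultimately show ?thesis by (simp add: mult_ac)
    qed
    have "(\<integral>x. indicator {x. 2 * R1 \<le> norm x \<and> norm x \<le> R2} x * u x powr \<sigma> \<partial>lborel)
        \<le> (\<integral>x. u x powr \<sigma> * \<zeta> x ^ k \<partial>lborel)"
    proof (rule integral_mono)
      show i: "integrable lborel (\<lambda>x. u x powr \<sigma> * \<zeta> x ^ k)"
        by (rule integrable_continuous_bounded_support[of _ "2 * R2"], intro continuous_on_mult continuous_on_power cu C1_continuous[OF \<zeta>(1)])
          (use \<zeta>(6) C0 in auto)
      have cl': "closed {x::'a. 2 * R1 \<le> norm x \<and> norm x \<le> R2}"
        by (intro closed_Collect_conj closed_Collect_le continuous_intros)
      have le: "indicator {x. 2 * R1 \<le> norm x \<and> norm x \<le> R2} x * u x powr \<sigma> \<le> u x powr \<sigma> * \<zeta> x ^ k" for x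
        using \<zeta>(2)[of x] \<zeta>(4)[of x] by (auto simp: indicator_def)
      show "indicator {x. 2 * R1 \<le> norm x \<and> norm x \<le> R2} x * u x powr \<sigma> \<le> u x powr \<sigma> * \<zeta> x ^ k" for x
        by (rule le)
      show "integrable lborel (\<lambda>x. indicator {x. 2 * R1 \<le> norm x \<and> norm x \<le> R2} x * u x powr \<sigma>)"
      proof (rule Bochner_Integration.integrable_bound[OF i])
        show "(\<lambda>x. indicator {x. 2 * R1 \<le> norm x \<and> norm x \<le> R2} x * u x powr \<sigma>) \<in> borel_measurable lborel"
          using borel_measurable_continuous_onI[OF cu] cl'
          by (intro borel_measurable_times borel_measurable_indicator) auto
        show "AE x in lborel. norm (indicator {x. 2 * R1 \<le> norm x \<and> norm x \<le> R2} x * u x powr \<sigma>) \<le> norm (u x powr \<sigma> * \<zeta> x ^ k)"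
          using le \<zeta>(2) by (auto intro!: AE_I2 simp: abs_mult)
      qed
    qed
    also have "\<dots> \<le> C0 * (\<integral>x. ((norm (grad \<zeta> x))\<^sup>2) powr q \<partial>lborel)"
      using absorb \<zeta>c \<zeta>(2,3) by blast
    also have "\<dots> \<le> C0 * (\<integral>x. 2 powr q * ((64 / R1\<^sup>2) powr q * indicator (cball (0::'a) (2 * R1)) x
        + (64 / R2\<^sup>2) powr q * indicator (cball (0::'a) (2 * R2)) x) \<partial>lborel)"
    proof (intro mult_left_mono)
      show "(\<integral>x. ((norm (grad \<zeta> x))\<^sup>2) powr q \<partial>lborel) \<le> (\<integral>x. 2 powr q * ((64 / R1\<^sup>2) powr q * indicator (cball (0::'a) (2 * R1)) x
        + (64 / R2\<^sup>2) powr q * indicator (cball (0::'a) (2 * R2)) x) \<partial>lborel)"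
        by (rule integral_mono[OF iG _ G]) (intro integrable_mult_right Bochner_Integration.integrable_add ib)
    qed (use C0 in simp)
    also have "\<dots> = C0 * (2 powr q * ((64 / R1\<^sup>2) powr q * measure lborel (cball (0::'a) (2 * R1))
        + (64 / R2\<^sup>2) powr q * measure lborel (cball (0::'a) (2 * R2))))"
      using ib by simp
    also have "\<dots> = (C' - 1) * (R1 powr (DIM('a) - 2 * q) + R2 powr (DIM('a) - 2 * q))"
      unfolding vol[OF R'(1)] vol[OF R'(2)] by (simp add: C'_def algebra_simps)
    also have "\<dots> \<le> C' * (R1 powr (DIM('a) - 2 * q) + R2 powr (DIM('a) - 2 * q))"
      by (intro mult_right_mono) auto
    finally show "(\<integral>x. indicator {x. 2 * R1 \<le> norm x \<and> norm x \<le> R2} x * u x powr \<sigma> \<partial>lborel)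
      \<le> C' * (R1 powr (DIM('a) - 2 * q) + R2 powr (DIM('a) - 2 * q))" .
  qed (rule C')
qed

section \<open>Decay at infinity\<close>

text \<open>Interpolation between the exponents a and b: the first term dominates for t \<le> T, the
  second for t > T, and T is free to depend on the scale.\<close>

lemma powr_interpolate:
  fixes t T :: real
  assumes "t > 0" "T > 0" "a \<le> r" "r \<le> b"
  shows "t powr r \<le> T powr (r - a) * t powr a + T powr (r - b) * t powr b"
proof (cases "t \<le> T")
  case True
  have "t powr r = t powr (r - a) * t powr a" by (simp add: powr_add[symmetric])
  also have "\<dots> \<le> T powr (r - a) * t powr a"
    using True assms by (intro mult_right_mono powr_mono2) auto
  finally show ?thesis by (simp add: add_increasing2)
next
  case False
  have "t powr r = t powr (r - b) * t powr b" by (simp add: powr_add[symmetric])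
  also have "\<dots> \<le> T powr (r - b) * t powr b"
    using False assms by (intro mult_right_mono powr_mono2') auto
  finally show ?thesis by (simp add: add_increasing)
qed

text \<open>Translation of the weighted estimate into powers of u. On (0, M] the bounds on f make
  \<phi>^2 comparable to t^(2 \<alpha> p), and f \<le> t f' turns the lower bound on f into f' \<ge>
  a1 t^(p-1), which gives the additional exponent p - 1 on the left.\<close>

lemma power_energy_estimate:
  fixes u :: "'a::euclidean_space \<Rightarrow> real" and f f' f'' :: "real \<Rightarrow> real" and p \<alpha> M a1 a2 :: real
  assumes f: "\<And>t. t > 0 \<Longrightarrow> (f has_real_derivative f' t) (at t)"
    and f': "\<And>t. t > 0 \<Longrightarrow> (f' has_real_derivative f'' t) (at t)"
    and f'': "continuous_on {0<..} f''"
    and pos: "\<And>t. t > 0 \<Longrightarrow> f t > 0" "\<And>t. t > 0 \<Longrightarrow> f' t > 0" "\<And>t. t > 0 \<Longrightarrow> f'' t \<ge> 0"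
    and mono: "\<And>s t. 0 < s \<Longrightarrow> s \<le> t \<Longrightarrow> f s \<le> f t"
    and lim: "((\<lambda>t. f t * f'' t / (f' t)\<^sup>2) \<longlongrightarrow> 1 - 1 / p) (at_right 0)"
    and f_le: "\<And>t. t > 0 \<Longrightarrow> f t \<le> t * f' t"
    and a: "a1 > 0" "\<And>t. 0 < t \<Longrightarrow> t \<le> M \<Longrightarrow> a1 * t powr p \<le> f t" "a2 > 0" "\<And>t. 0 < t \<Longrightarrow> t \<le> M \<Longrightarrow> f t \<le> a2 * t powr p"
    and p: "p > 1" and \<alpha>: "\<alpha> > 0" "(\<alpha> - 1)\<^sup>2 < 1 - 1 / p"
    and u: "C2 u" "\<And>x. u x > 0" "\<And>x. u x \<le> M" and sol: "\<And>x. - laplacian u x = f (u x)"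
    and stable: "\<And>\<psi>. \<psi> \<in> C1c A \<Longrightarrow>
        (\<integral>x. f' (u x) * (\<psi> x)\<^sup>2 \<partial>lborel) \<le> (\<integral>x. (norm (grad \<psi> x))\<^sup>2 \<partial>lborel)"
  shows "\<exists>C>0. \<forall>\<psi>\<in>C1c A. (\<integral>x. u x powr (2 * \<alpha> * p + p - 1) * (\<psi> x)\<^sup>2 \<partial>lborel)
      \<le> C * (\<integral>x. u x powr (2 * \<alpha> * p) * (norm (grad \<psi> x))\<^sup>2 \<partial>lborel)"
proof -
  have M: "M > 0" using u(2,3)[of 0] by linarith
  have s0: "1 - 1 / p \<le> 1" using p by simp
  show ?thesis
  proof (rule test_functions_exist[OF f f' f'' pos mono lim s0 \<alpha>(2) M])
    fix \<phi> \<phi>' K K' :: "real \<Rightarrow> real" and \<eta> \<delta> b1 b2 :: real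
    assume T: "\<And>t. t > 0 \<Longrightarrow> (\<phi> has_real_derivative \<phi>' t) (at t)" "continuous_on {0<..} \<phi>'" "\<And>t. t > 0 \<Longrightarrow> \<phi> t > 0"
      "\<And>t. t > 0 \<Longrightarrow> (K has_real_derivative K' t) (at t)" "continuous_on {0<..} K'"
      "\<eta> > 0" "\<And>t. 0 < t \<Longrightarrow> t \<le> M \<Longrightarrow> f t * K t \<le> (1 - \<eta>) * f' t * (\<phi> t)\<^sup>2"
      "\<delta> > 0" "\<And>t. 0 < t \<Longrightarrow> t \<le> M \<Longrightarrow> \<delta> * (\<phi> t * \<phi>' t - K t)\<^sup>2 \<le> (\<phi> t)\<^sup>2 * (K' t - (\<phi>' t)\<^sup>2)"
      and b12: "b1 > 0" "b2 > 0" "\<And>t. 0 < t \<Longrightarrow> t \<le> M \<Longrightarrow> b1 * f t powr \<alpha> \<le> \<phi> t \<and> \<phi> t \<le> b2 * f t powr \<alpha>"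
    have cf: "continuous_on {0<..} f" "continuous_on {0<..} f'"
      using f f' by (auto intro!: DERIV_continuous_on intro: has_field_derivative_at_within)
    have c\<phi>: "continuous_on {0<..} \<phi>"
      using T(1) by (auto intro!: DERIV_continuous_on intro: has_field_derivative_at_within)
    define c0 where "c0 = a1 * b1\<^sup>2 * a1 powr (2 * \<alpha>)"
    define c1 where "c1 = b2\<^sup>2 * a2 powr (2 * \<alpha>)"
    have c: "c0 > 0" "c1 > 0" using a b12 by (auto simp: c0_def c1_def)
    have sq: "(C * f t powr \<alpha>)\<^sup>2 = C\<^sup>2 * f t powr (2 * \<alpha>)" if "t > 0" for C t
      using pos(1)[OF that] powr_powr[of "f t" \<alpha> 2] by (simp add: power_mult_distrib mult.commute)
    have pw: "(a * t powr p) powr (2 * \<alpha>) = a powr (2 * \<alpha>) * t powr (2 * \<alpha> * p)" if "t > 0" "a > 0" for a t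
      using that by (simp add: powr_mult powr_powr mult_ac)
    have low: "c0 * t powr (2 * \<alpha> * p + p - 1) \<le> f' t * (\<phi> t)\<^sup>2" if t: "0 < t" "t \<le> M" for t
    proof -
      have "a1 * t powr (p - 1) \<le> f' t"
      proof -
        have "a1 * t powr p \<le> t * f' t" using a(2)[OF t] f_le[OF t(1)] by linarith
        moreover have "t powr p = t * t powr (p - 1)" using t powr_add[of t 1 "p - 1"] by simp
        ultimately have "t * (a1 * t powr (p - 1)) \<le> t * f' t" by (simp add: mult.left_commute)
        then show ?thesis using t by simp
      qed
      moreover have "b1\<^sup>2 * (a1 powr (2 * \<alpha>) * t powr (2 * \<alpha> * p)) \<le> (\<phi> t)\<^sup>2"
      proof -
        have "(a1 * t powr p) powr (2 * \<alpha>) \<le> f t powr (2 * \<alpha>)"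
          using a t \<alpha> by (intro powr_mono2) auto
        then have "b1\<^sup>2 * (a1 powr (2 * \<alpha>) * t powr (2 * \<alpha> * p)) \<le> (b1 * f t powr \<alpha>)\<^sup>2"
          unfolding sq[OF t(1)] pw[OF t(1) a(1)] by (intro mult_left_mono) auto
        also have "\<dots> \<le> (\<phi> t)\<^sup>2" using b12(3)[OF t] b12(1) by (intro power_mono) auto
        finally show ?thesis .
      qed
      ultimately have "a1 * t powr (p - 1) * (b1\<^sup>2 * (a1 powr (2 * \<alpha>) * t powr (2 * \<alpha> * p))) \<le> f' t * (\<phi> t)\<^sup>2"
        using a pos(2)[OF t(1)] by (intro mult_mono) auto
      moreover have "t powr (2 * \<alpha> * p + p - 1) = t powr (p - 1) * t powr (2 * \<alpha> * p)"
        by (simp add: powr_add[symmetric] algebra_simps)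
      ultimately show ?thesis by (simp add: c0_def mult_ac)
    qed
    have up: "(\<phi> t)\<^sup>2 \<le> c1 * t powr (2 * \<alpha> * p)" if t: "0 < t" "t \<le> M" for t
    proof -
      have "(\<phi> t)\<^sup>2 \<le> (b2 * f t powr \<alpha>)\<^sup>2" using b12(3)[OF t] T(3)[OF t(1)] by (intro power_mono) auto
      also have "\<dots> \<le> b2\<^sup>2 * (a2 * t powr p) powr (2 * \<alpha>)"
        unfolding sq[OF t(1)] using a t \<alpha> pos(1)[OF t(1)] by (intro mult_left_mono powr_mono2) auto
      also have "\<dots> = c1 * t powr (2 * \<alpha> * p)" unfolding pw[OF t(1) a(3)] by (simp add: c1_def)
      finally show ?thesis .
    qed
    define C where "C = (1 + 1 / \<delta>) * c1 / (\<eta> * c0)"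
    have C: "C > 0" using c T(6,8) by (simp add: C_def add_pos_pos)
    show ?thesis
    proof (intro exI[of _ C] conjI ballI)
      fix \<psi> assume \<psi>: "\<psi> \<in> C1c A"
      obtain r where r: "\<And>x. norm x > r \<Longrightarrow> \<psi> x = 0" using C1c_vanishes_outside[OF \<psi>] by blast
      have gr: "norm x > r \<Longrightarrow> grad \<psi> x = 0" for x using bounded_support_grad[of r \<psi> x] r by blast
      have \<psi>1: "C1 \<psi>" using \<psi> by (simp add: C1c_def)
      note cu = C1_continuous[OF C2_C1[OF u(1)]]
      have comp: "continuous_on UNIV (\<lambda>x. g (u x))" if "continuous_on {0<..} g" for g :: "real \<Rightarrow> real"
        by (rule continuous_on_compose2[OF that cu]) (use u in auto)
      have cp: "continuous_on UNIV (\<lambda>x. u x powr b)" for b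
        by (rule comp) (auto intro!: continuous_intros)
      note ci = continuous_on_mult continuous_on_power continuous_on_norm comp[OF cf(2)] comp[OF c\<phi>] cp
          C1_continuous[OF \<psi>1] C1_continuous_grad[OF \<psi>1]
      have i1: "integrable lborel (\<lambda>x. u x powr (2 * \<alpha> * p + p - 1) * (\<psi> x)\<^sup>2)"
        by (rule integrable_continuous_bounded_support[of _ r], intro ci) (simp add: r)
      have i2: "integrable lborel (\<lambda>x. f' (u x) * (\<phi> (u x))\<^sup>2 * (\<psi> x)\<^sup>2)"
        by (rule integrable_continuous_bounded_support[of _ r], intro ci) (simp add: r)
      have i3: "integrable lborel (\<lambda>x. (\<phi> (u x))\<^sup>2 * (norm (grad \<psi> x))\<^sup>2)"
        by (rule integrable_continuous_bounded_support[of _ r], intro ci) (simp add: gr)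
      have i4: "integrable lborel (\<lambda>x. u x powr (2 * \<alpha> * p) * (norm (grad \<psi> x))\<^sup>2)"
        by (rule integrable_continuous_bounded_support[of _ r], intro ci) (simp add: gr)
      let ?L = "\<integral>x. u x powr (2 * \<alpha> * p + p - 1) * (\<psi> x)\<^sup>2 \<partial>lborel"
      let ?R = "\<integral>x. u x powr (2 * \<alpha> * p) * (norm (grad \<psi> x))\<^sup>2 \<partial>lborel"
      have "c0 * ?L = (\<integral>x. c0 * (u x powr (2 * \<alpha> * p + p - 1) * (\<psi> x)\<^sup>2) \<partial>lborel)"
        by (rule integral_mult_right_zero[symmetric])
      also have "\<dots> \<le> (\<integral>x. f' (u x) * (\<phi> (u x))\<^sup>2 * (\<psi> x)\<^sup>2 \<partial>lborel)"
      proof (rule integral_mono[OF integrable_mult_right[OF i1] i2])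
        show "c0 * (u x powr (2 * \<alpha> * p + p - 1) * (\<psi> x)\<^sup>2) \<le> f' (u x) * (\<phi> (u x))\<^sup>2 * (\<psi> x)\<^sup>2" for x
          using mult_right_mono[OF low[OF u(2,3)], of "(\<psi> x)\<^sup>2" x] by (simp add: mult.assoc)
      qed
      finally have "\<eta> * (c0 * ?L) \<le> \<eta> * (\<integral>x. f' (u x) * (\<phi> (u x))\<^sup>2 * (\<psi> x)\<^sup>2 \<partial>lborel)"
        using T(6) by (intro mult_left_mono) auto
      also have "\<dots> \<le> (1 + 1 / \<delta>) * (\<integral>x. (\<phi> (u x))\<^sup>2 * (norm (grad \<psi> x))\<^sup>2 \<partial>lborel)"
        by (rule stability_weighted_estimate[OF u sol cf stable T(1,2,3,4,5,7,9,8) \<psi>])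
      also have "\<dots> \<le> (1 + 1 / \<delta>) * (c1 * ?R)"
      proof (rule mult_left_mono)
        have "(\<integral>x. (\<phi> (u x))\<^sup>2 * (norm (grad \<psi> x))\<^sup>2 \<partial>lborel)
           \<le> (\<integral>x. c1 * (u x powr (2 * \<alpha> * p) * (norm (grad \<psi> x))\<^sup>2) \<partial>lborel)"
        proof (rule integral_mono[OF i3 integrable_mult_right[OF i4]])
          show "(\<phi> (u x))\<^sup>2 * (norm (grad \<psi> x))\<^sup>2 \<le> c1 * (u x powr (2 * \<alpha> * p) * (norm (grad \<psi> x))\<^sup>2)" for x
            using mult_right_mono[OF up[OF u(2,3)], of "(norm (grad \<psi> x))\<^sup>2" x] by (simp add: mult.assoc)
        qed
        then show "(\<integral>x. (\<phi> (u x))\<^sup>2 * (norm (grad \<psi> x))\<^sup>2 \<partial>lborel) \<le> c1 * ?R"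
          by (simp only: integral_mult_right_zero)
      qed (use T(8) in simp)
      finally have "?L * (\<eta> * c0) \<le> (1 + 1 / \<delta>) * c1 * ?R" by (simp only: mult_ac)
      then have "?L \<le> (1 + 1 / \<delta>) * c1 * ?R / (\<eta> * c0)" using c T(6) by (simp only: pos_le_divide_eq mult_pos_pos)
      then show "?L \<le> C * ?R" by (simp add: C_def)
    qed (rule C)
  qed
qed

lemma integrable_annulus:
  fixes g :: "'a::euclidean_space \<Rightarrow> real"
  assumes "continuous_on UNIV g"
  shows "integrable lborel (\<lambda>x. indicator {x. a \<le> norm x \<and> norm x \<le> b} x * g x)"
proof -
  have "compact {x::'a. a \<le> norm x \<and> norm x \<le> b}"
    unfolding compact_eq_bounded_closed
    by (intro conjI closed_Collect_conj closed_Collect_le continuous_intros boundedI[of _ b]) auto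
  from borel_integrable_compact[OF this, of g] show ?thesis
    using assms by (auto intro: continuous_on_subset)
qed

text \<open>At the scale invariant exponent \<sigma>0 the bounded energy has vanishing tails, but
  the local supremum estimate needs an exponent strictly above \<sigma>0. At \<sigma>1 the rescaled
  energy is merely bounded. Interpolation carries the smallness over to every \<sigma> in
  between.\<close>

lemma rescaled_energy_small:
  fixes u :: "'a::euclidean_space \<Rightarrow> real" and \<kappa> \<sigma>0 \<sigma> \<sigma>1 C0 C1 R0 :: real
  assumes u: "continuous_on UNIV u" "\<And>x. u x > 0" and \<sigma>: "\<sigma>0 < \<sigma>" "\<sigma> < \<sigma>1" "\<kappa> * \<sigma>0 = DIM('a)" and "\<kappa> > 0" "R0 > 0"
    and C0: "\<And>R1 R2. R0 \<le> R1 \<Longrightarrow> 2 * R1 \<le> R2 \<Longrightarrow>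
      (\<integral>x. indicator {x. 2 * R1 \<le> norm x \<and> norm x \<le> R2} x * u x powr \<sigma>0 \<partial>lborel) \<le> C0"
    and C1: "C1 > 0" "\<And>R1 R2. R0 \<le> R1 \<Longrightarrow> 2 * R1 \<le> R2 \<Longrightarrow>
      (\<integral>x. indicator {x. 2 * R1 \<le> norm x \<and> norm x \<le> R2} x * u x powr \<sigma>1 \<partial>lborel)
      \<le> C1 * (R1 powr (DIM('a) - \<kappa> * \<sigma>1) + R2 powr (DIM('a) - \<kappa> * \<sigma>1))"
    and "\<delta> > 0"
  shows "\<exists>R>0. \<forall>x. norm x \<ge> R \<longrightarrow>
    (norm x / 2) powr (\<kappa> * \<sigma> - DIM('a)) * (\<integral>y. indicator (ball x (norm x / 2)) y * u y powr \<sigma> \<partial>lborel) \<le> \<delta>"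
proof -
  let ?N = "real DIM('a)"
  have nz: "u x \<noteq> 0" for x using u(2)[of x] by simp
  have cu: "continuous_on UNIV (\<lambda>x. u x powr a)" for a by (intro continuous_intros u) (use nz in auto)
  define I where "I n = (\<integral>x. indicator {x. 2 * R0 \<le> norm x \<and> norm x \<le> 2 * R0 + real n} x * u x powr \<sigma>0 \<partial>lborel)" for n
  define C1' where "C1' = 2 * C1 * 2 powr (\<kappa> * \<sigma>1 - ?N)"
  \<comment> \<open>First \<tau> makes the \<sigma>1 term equal to \<delta>/2 (the exponent \<sigma>
    - \<sigma>1 is negative, so small \<delta> means large \<tau>); only then is the tail size
    \<epsilon> fixed in terms of \<tau>.\<close>
  define \<tau> where "\<tau> = (\<delta> / (2 * C1')) powr (1 / (\<sigma> - \<sigma>1))"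
  define \<epsilon> where "\<epsilon> = \<delta> / (2 * \<tau> powr (\<sigma> - \<sigma>0))"
  have C1': "C1' > 0" using C1 by (simp add: C1'_def)
  have \<tau>: "\<tau> > 0" using \<open>\<delta> > 0\<close> C1' by (simp add: \<tau>_def)
  have \<tau>1: "C1' * \<tau> powr (\<sigma> - \<sigma>1) = \<delta> / 2"
    using \<open>\<delta> > 0\<close> C1' \<sigma> by (simp add: \<tau>_def powr_powr)
  have \<epsilon>: "\<epsilon> > 0" "\<tau> powr (\<sigma> - \<sigma>0) * \<epsilon> = \<delta> / 2" using \<open>\<delta> > 0\<close> \<tau> by (auto simp: \<epsilon>_def)
  have bdd: "bdd_above (range I)"
    unfolding I_def by (intro bdd_aboveI[of _ C0]) (auto intro!: C0)
  have "Sup (range I) - \<epsilon> < Sup (range I)" using \<epsilon> by simp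
  then obtain n where n: "I n > Sup (range I) - \<epsilon>"
    using less_cSup_iff[OF _ bdd] by auto
  have tail: "(\<integral>y. indicator (ball x (norm x / 2)) y * u y powr \<sigma>0 \<partial>lborel) \<le> \<epsilon>"
    if x: "norm x > 2 * (2 * R0 + real n)" for x
  proof -
    obtain m :: nat where m: "real m \<ge> 2 * norm x" using real_arch_simple by blast
    have B: "norm y > 2 * R0 + real n" "norm y \<le> 2 * R0 + real m" if "y \<in> ball x (norm x / 2)" for y
    proof -
      have d: "norm (x - y) < norm x / 2" using that by (simp add: dist_norm)
      have "norm y > norm x / 2" using norm_triangle_ineq2[of x y] d by linarith
      then show "norm y > 2 * R0 + real n" using x by argo
      show "norm y \<le> 2 * R0 + real m"
        using norm_triangle_ineq2[of y x] d m \<open>R0 > 0\<close> by (simp add: norm_minus_commute)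
    qed
    have "real n \<le> real m" using m x \<open>R0 > 0\<close> of_nat_0_le_iff[of n, where ?'a = real] by argo
    then have nm: "n \<le> m" by simp
    \<comment> \<open>The ball is disjoint from the n-th annulus, and both lie in the m-th. Since
      \<open>I n\<close> is within \<epsilon> of the supremum, the ball can hold energy at most
      \<epsilon>.\<close>
    have "(\<integral>y. indicator (ball x (norm x / 2)) y * u y powr \<sigma>0 \<partial>lborel) + I n
       = (\<integral>y. indicator (ball x (norm x / 2)) y * u y powr \<sigma>0
          + indicator {x. 2 * R0 \<le> norm x \<and> norm x \<le> 2 * R0 + real n} y * u y powr \<sigma>0 \<partial>lborel)"
      unfolding I_def
      by (rule Bochner_Integration.integral_add[symmetric]) (intro integrable_ball_continuous integrable_annulus cu)+
    also have "\<dots> \<le> I m"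
      unfolding I_def
    proof (intro integral_mono Bochner_Integration.integrable_add integrable_ball_continuous integrable_annulus cu)
      show "indicator (ball x (norm x / 2)) y * u y powr \<sigma>0
          + indicator {x. 2 * R0 \<le> norm x \<and> norm x \<le> 2 * R0 + real n} y * u y powr \<sigma>0
          \<le> indicator {x. 2 * R0 \<le> norm x \<and> norm x \<le> 2 * R0 + real m} y * u y powr \<sigma>0" for y
        using B[of y] nm by (cases "y \<in> ball x (norm x / 2)") (auto simp: indicator_def)
    qed
    also have "I m \<le> Sup (range I)" by (rule cSUP_upper[OF UNIV_I bdd])
    finally show ?thesis using n by linarith
  qed
  define R where "R = 2 * (2 * R0 + real n) + 1"
  have R: "R > 0" using \<open>R0 > 0\<close> by (simp add: R_def)
  show ?thesis
  proof (intro exI[of _ R] conjI allI impI)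
    fix x :: 'a assume x: "norm x \<ge> R"
    define \<rho> where "\<rho> = norm x / 2"
    have \<rho>: "\<rho> > 0" "\<rho> > 2 * R0" using x R \<open>R0 > 0\<close> by (auto simp: \<rho>_def R_def)
    \<comment> \<open>The threshold is \<tau> times \<rho>^(-\<kappa>), the natural size of a
      solution at scale \<rho>; with it all powers of \<rho> cancel, using \<kappa> \<sigma>0 =
      N.\<close>
    define T where "T = \<tau> * \<rho> powr (- \<kappa>)"
    have T: "T > 0" using \<tau> \<rho> by (simp add: T_def)
    let ?J = "\<lambda>a. \<integral>y. indicator (ball x \<rho>) y * u y powr a \<partial>lborel"
    have J0: "?J \<sigma>0 \<le> \<epsilon>" using tail[of x] x by (simp add: \<rho>_def R_def)
    have J1: "?J \<sigma>1 \<le> C1' * \<rho> powr (?N - \<kappa> * \<sigma>1)"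
    proof -
      have "?J \<sigma>1 \<le> (\<integral>y. indicator {y. 2 * (\<rho> / 2) \<le> norm y \<and> norm y \<le> 3 * \<rho>} y * u y powr \<sigma>1 \<partial>lborel)"
      proof (intro integral_mono integrable_ball_continuous integrable_annulus cu)
        show "indicator (ball x \<rho>) y * u y powr \<sigma>1 \<le> indicator {y. 2 * (\<rho> / 2) \<le> norm y \<and> norm y \<le> 3 * \<rho>} y * u y powr \<sigma>1" for y
        proof (cases "y \<in> ball x \<rho>")
          case True
          then have d: "norm (x - y) < \<rho>" by (simp add: dist_norm)
          have "norm x = 2 * \<rho>" by (simp add: \<rho>_def)
          then have "\<rho> \<le> norm y" "norm y \<le> 3 * \<rho>"
            using norm_triangle_ineq2[of x y] norm_triangle_ineq2[of y x] d by (auto simp: norm_minus_commute)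
          then show ?thesis using True by (simp add: indicator_def)
        qed simp
      qed
      also have "\<dots> \<le> C1 * ((\<rho> / 2) powr (?N - \<kappa> * \<sigma>1) + (3 * \<rho>) powr (?N - \<kappa> * \<sigma>1))"
        using \<rho> by (intro C1(2)) auto
      also have "\<dots> \<le> C1 * ((\<rho> / 2) powr (?N - \<kappa> * \<sigma>1) + (\<rho> / 2) powr (?N - \<kappa> * \<sigma>1))"
        using \<rho> C1(1) \<sigma> \<open>\<kappa> > 0\<close> mult_strict_left_mono[of \<sigma>0 \<sigma>1 \<kappa>]
        by (intro mult_left_mono add_left_mono powr_mono2') auto
      also have "(\<rho> / 2) powr (?N - \<kappa> * \<sigma>1) = 2 powr (\<kappa> * \<sigma>1 - ?N) * \<rho> powr (?N - \<kappa> * \<sigma>1)"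
        using \<rho> powr_minus_divide[of 2 "?N - \<kappa> * \<sigma>1"] by (simp add: powr_divide)
      finally show ?thesis by (simp add: C1'_def algebra_simps)
    qed
    have "?J \<sigma> \<le> (\<integral>y. T powr (\<sigma> - \<sigma>0) * (indicator (ball x \<rho>) y * u y powr \<sigma>0)
        + T powr (\<sigma> - \<sigma>1) * (indicator (ball x \<rho>) y * u y powr \<sigma>1) \<partial>lborel)"
    proof (intro integral_mono Bochner_Integration.integrable_add integrable_mult_right integrable_ball_continuous cu)
      show "indicator (ball x \<rho>) y * u y powr \<sigma> \<le> T powr (\<sigma> - \<sigma>0) * (indicator (ball x \<rho>) y * u y powr \<sigma>0)
        + T powr (\<sigma> - \<sigma>1) * (indicator (ball x \<rho>) y * u y powr \<sigma>1)" for y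
        using powr_interpolate[OF u(2) T, of \<sigma>0 \<sigma> \<sigma>1 y] \<sigma> by (simp add: indicator_def)
    qed
    also have "\<dots> = T powr (\<sigma> - \<sigma>0) * ?J \<sigma>0 + T powr (\<sigma> - \<sigma>1) * ?J \<sigma>1"
      by (simp only: Bochner_Integration.integral_add[OF integrable_mult_right integrable_mult_right]
          integrable_ball_continuous cu integral_mult_right_zero)
    also have "\<dots> \<le> T powr (\<sigma> - \<sigma>0) * \<epsilon> + T powr (\<sigma> - \<sigma>1) * (C1' * \<rho> powr (?N - \<kappa> * \<sigma>1))"
      by (intro add_mono mult_left_mono J0 J1) auto
    finally have "\<rho> powr (\<kappa> * \<sigma> - ?N) * ?J \<sigma>
       \<le> \<rho> powr (\<kappa> * \<sigma> - ?N) * (T powr (\<sigma> - \<sigma>0) * \<epsilon> + T powr (\<sigma> - \<sigma>1) * (C1' * \<rho> powr (?N - \<kappa> * \<sigma>1)))"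
      by (intro mult_left_mono) auto
    also have "\<dots> = \<tau> powr (\<sigma> - \<sigma>0) * \<epsilon> + C1' * \<tau> powr (\<sigma> - \<sigma>1)"
    proof -
      have Tp: "T powr b = \<tau> powr b * \<rho> powr (- \<kappa> * b)" for b
        using \<tau> \<rho> by (simp add: T_def powr_mult powr_powr)
      have "\<rho> powr (\<kappa> * \<sigma> - ?N) * \<rho> powr (- \<kappa> * (\<sigma> - \<sigma>0)) = 1"
        using \<rho> \<sigma>(3) by (simp add: powr_add[symmetric] algebra_simps)
      moreover have "\<rho> powr (\<kappa> * \<sigma> - ?N) * \<rho> powr (- \<kappa> * (\<sigma> - \<sigma>1)) * \<rho> powr (?N - \<kappa> * \<sigma>1) = 1"
        using \<rho> by (simp add: powr_add[symmetric] algebra_simps)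
      ultimately show ?thesis unfolding Tp by algebra
    qed
    finally show "(norm x / 2) powr (\<kappa> * \<sigma> - DIM('a)) * (\<integral>y. indicator (ball x (norm x / 2)) y * u y powr \<sigma> \<partial>lborel) \<le> \<delta>"
      using \<epsilon>(2) \<tau>1 by (simp add: \<rho>_def)
  qed (rule R)
qed

text \<open>Since \<kappa> p = \<kappa> + 2, decay of u makes the Laplacian o(|x|^(-\<kappa>-2)).
  The gradient estimate on B(x, |x|/2), that is with \<rho> = |x|/4, then gains one power of
  |x|.\<close>

lemma decay_with_gradient:
  fixes u :: "'a::euclidean_space \<Rightarrow> real" and p \<kappa> Cf :: real
  assumes u: "C2 u" "\<And>x. u x > 0" and p: "p > 1" "\<kappa> = 2 / (p - 1)"
    and lap: "\<And>x. 0 \<le> - laplacian u x" "\<And>x. - laplacian u x \<le> Cf * u x powr p" "Cf > 0"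
    and decay: "\<And>\<epsilon>. \<epsilon> > 0 \<Longrightarrow> \<exists>R. \<forall>x. norm x \<ge> R \<longrightarrow> u x \<le> \<epsilon> * norm x powr (- \<kappa>)"
  shows "u \<in> o[at_infinity](\<lambda>x. norm x powr (- \<kappa>))"
    "(\<lambda>x. norm (grad u x)) \<in> o[at_infinity](\<lambda>x. norm x powr (- \<kappa> - 1))"
proof -
  show "u \<in> o[at_infinity](\<lambda>x. norm x powr (- \<kappa>))"
  proof (rule landau_o.smallI)
    fix c :: real assume "c > 0"
    then show "\<forall>\<^sub>F x in at_infinity. norm (u x) \<le> c * norm (norm x powr (- \<kappa>))"
      using decay[of c] u(2) by (simp add: eventually_at_infinity less_imp_le)
  qed
  obtain C where C: "C > 0" and grad_le: "\<forall>(u :: 'a \<Rightarrow> real) x \<rho> B G. C2 u \<longrightarrow> \<rho> > 0 \<longrightarrow>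
      (\<forall>y\<in>ball x (2 * \<rho>). \<bar>u y\<bar> \<le> B \<and> \<bar>laplacian u y\<bar> \<le> G) \<longrightarrow>
      norm (grad u x) \<le> C * (B / \<rho> + \<rho> * G)"
    using gradient_estimate[where ?'a = 'a] by blast
  have \<kappa>: "\<kappa> > 0" "\<kappa> * p = \<kappa> + 2"
    unfolding p(2) using p(1) by (auto simp: field_simps)
  show "(\<lambda>x. norm (grad u x)) \<in> o[at_infinity](\<lambda>x. norm x powr (- \<kappa> - 1))"
  proof (rule landau_o.smallI)
    fix c :: real assume "c > 0"
    \<comment> \<open>e \<le> 1 gives e^p \<le> e, so that both terms of the gradient bound are
      linear in e.\<close>
    define e where "e = min 1 (c / (C * (4 + Cf)))"
    have e: "e > 0" "e \<le> 1" using \<open>c > 0\<close> C lap(3) by (auto simp: e_def add_pos_pos)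
    have ec: "C * (4 + Cf) * e \<le> c"
    proof -
      have "C * (4 + Cf) * e \<le> C * (4 + Cf) * (c / (C * (4 + Cf)))"
        using C lap(3) by (intro mult_left_mono) (auto simp: e_def)
      then show ?thesis using C lap(3) by simp
    qed
    obtain R where R: "\<And>x. norm x \<ge> R \<Longrightarrow> u x \<le> e / 2 powr \<kappa> * norm x powr (- \<kappa>)"
      using decay[of "e / 2 powr \<kappa>"] e by auto
    have "norm (grad u x) \<le> c * norm x powr (- \<kappa> - 1)" if x: "norm x \<ge> max 1 (2 * R)" for x
    proof -
      define s where "s = norm x"
      have s: "s > 0" "s \<ge> 2 * R" using x by (auto simp: s_def)
      have B: "u y \<le> e * s powr (- \<kappa>)" if "y \<in> ball x (2 * (s / 4))" for y
      proof -
        have "norm (x - y) < s / 2" using that by (simp add: dist_norm)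
        then have y: "norm y \<ge> s / 2" using norm_triangle_ineq2[of x y] by (simp add: s_def)
        then have "u y \<le> e / 2 powr \<kappa> * norm y powr (- \<kappa>)" using R[of y] s by simp
        also have "\<dots> \<le> e / 2 powr \<kappa> * (s / 2) powr (- \<kappa>)"
          using y s e \<kappa> by (intro mult_left_mono powr_mono2') auto
        also have "\<dots> = e * s powr (- \<kappa>)"
          using s by (simp add: powr_divide powr_minus_divide)
        finally show ?thesis .
      qed
      have G: "\<bar>laplacian u y\<bar> \<le> Cf * e * s powr (- \<kappa> - 2)" if "y \<in> ball x (2 * (s / 4))" for y
      proof -
        have "u y powr p \<le> (e * s powr (- \<kappa>)) powr p"
          using B[OF that] u(2)[of y] p by (intro powr_mono2) auto
        also have "\<dots> = e powr p * s powr (- \<kappa> - 2)"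
          using e s \<kappa>(2) by (simp add: powr_mult powr_powr algebra_simps)
        also have "\<dots> \<le> e powr 1 * s powr (- \<kappa> - 2)"
          using e p by (intro mult_right_mono powr_mono') auto
        also have "e powr 1 = e" using e by simp
        finally have "Cf * u y powr p \<le> Cf * (e * s powr (- \<kappa> - 2))"
          using lap(3) by (intro mult_left_mono) auto
        then show ?thesis using lap(1,2)[of y] by (simp add: mult.assoc)
      qed
      have "norm (grad u x) \<le> C * (e * s powr (- \<kappa>) / (s / 4) + s / 4 * (Cf * e * s powr (- \<kappa> - 2)))"
        using s B G u(2) by (intro grad_le[rule_format] u(1)) (auto simp: less_imp_le)
      also have "\<dots> = C * e * (4 + Cf / 4) * s powr (- \<kappa> - 1)"
      proof -
        have e: "s powr (1 + b) = s * s powr b" for b using s by (simp add: powr_add)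
        define z where "z = s powr (- \<kappa> - 2)"
        have "- \<kappa> - 1 = 1 + (- \<kappa> - 2)" "- \<kappa> = 1 + (1 + (- \<kappa> - 2))" by simp_all
        then have "s powr (- \<kappa> - 1) = s * z" "s powr (- \<kappa>) = s * (s * z)"
          unfolding z_def by (metis e)+
        then show ?thesis unfolding z_def[symmetric] using s by (simp add: field_simps)
      qed
      also have "\<dots> \<le> C * e * (4 + Cf) * s powr (- \<kappa> - 1)"
        using C e lap(3) by (intro mult_right_mono mult_left_mono) auto
      also have "\<dots> \<le> c * s powr (- \<kappa> - 1)"
        using ec by (intro mult_right_mono) (auto simp: mult_ac)
      finally show ?thesis by (simp add: s_def)
    qed
    then show "\<forall>\<^sub>F x in at_infinity. norm (norm (grad u x)) \<le> c * norm (norm x powr (- \<kappa> - 1))"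
      unfolding eventually_at_infinity by (intro exI[of _ "max 1 (2 * R)"]) auto
  qed
qed

section \<open>Admissible exponents, and consequences of the hypotheses on f\<close>

lemma exponent_window:
  fixes p \<sigma> :: real
  assumes p: "p > 1" and \<sigma>: "p + 1 < \<sigma>" "\<sigma> < 3 * p - 1 + 2 * sqrt (p * (p - 1))"
  defines "\<alpha> \<equiv> (\<sigma> - p + 1) / (2 * p)"
  shows "\<alpha> > 0" "(\<alpha> - 1)\<^sup>2 < 1 - 1 / p" "2 * \<alpha> * p = \<sigma> - p + 1"
proof -
  show "\<alpha> > 0" "2 * \<alpha> * p = \<sigma> - p + 1" using p \<sigma> by (auto simp: \<alpha>_def)
  define s where "s = sqrt (p * (p - 1))"
  have s2: "s\<^sup>2 = p * (p - 1)" using p by (simp add: s_def)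
  \<comment> \<open>Because s \<ge> p - 1, the lower end 3 p - 1 - 2 s of the exact window is at
    most p + 1, so \<sigma> > p + 1 suffices on that side.\<close>
  have "sqrt ((p - 1) * (p - 1)) \<le> s" unfolding s_def using p by (intro real_sqrt_le_mono mult_right_mono) auto
  then have "p - 1 \<le> s" using p by simp
  then have "\<bar>\<sigma> - 3 * p + 1\<bar> < \<bar>2 * s\<bar>" using \<sigma> p by (simp add: s_def[symmetric])
  then have "(\<sigma> - 3 * p + 1)\<^sup>2 < 4 * (p * (p - 1))"
    using power_strict_mono[of "\<bar>\<sigma> - 3 * p + 1\<bar>" "\<bar>2 * s\<bar>" 2] s2 by (simp add: power_mult_distrib)
  moreover have "\<alpha> - 1 = (\<sigma> - 3 * p + 1) / (2 * p)" using p by (simp add: \<alpha>_def field_simps)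
  ultimately have "(\<alpha> - 1)\<^sup>2 < 4 * (p * (p - 1)) / (2 * p)\<^sup>2"
    using p by (simp only: power_divide) (rule divide_strict_right_mono, auto)
  also have "\<dots> = 1 - 1 / p" using p by (simp add: power2_eq_square field_simps)
  finally show "(\<alpha> - 1)\<^sup>2 < 1 - 1 / p" .
qed

text \<open>The lower bound is p > (N + 2) / (N - 2) rearranged. The upper one reads (N - 6) p - (N
  - 2) < 4 sqrt (p (p - 1)). Squaring leads to the quadratic D p^2 - 2 B p + (N - 2)^2 with roots (B
  \<plusminus> 8 sqrt (N - 1)) / D, the larger being p_c(N). Its leading coefficient D = (N - 2) (N
  - 10) is positive only from N = 11 on, hence the case distinction.\<close>

lemma critical_exponent_window:
  fixes p :: real and N :: nat
  assumes N: "N \<ge> 3" and p: "(real N + 2) / (real N - 2) < p" and pc: "N \<ge> 11 \<Longrightarrow> p < p_c N"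
  shows "p > 1" "p + 1 < N * (p - 1) / 2" "N * (p - 1) / 2 < 3 * p - 1 + 2 * sqrt (p * (p - 1))"
proof -
  define n where "n = real N"
  have n: "n \<ge> 3" using N by (simp add: n_def)
  have p': "n + 2 < p * (n - 2)" using p n by (simp add: n_def field_simps)
  have "1 * (n - 2) < p * (n - 2)" using p' by simp
  then show p1: "p > 1" using n by simp
  show "p + 1 < N * (p - 1) / 2" using p' by (simp add: n_def algebra_simps)
  define s where "s = sqrt (p * (p - 1))"
  have s: "s \<ge> 0" "s\<^sup>2 = p * (p - 1)" using p1 by (auto simp: s_def)
  have "n * (p - 1) / 2 < 3 * p - 1 + 2 * s"
  proof (cases "N \<le> 10")
    case True
    have "p - 2 < s"
    proof (rule ccontr)
      assume "\<not> p - 2 < s"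
      then have "s\<^sup>2 \<le> (p - 2)\<^sup>2" using s by (intro power_mono) auto
      then have "3 * p \<le> 4" unfolding s by (simp add: power2_eq_square algebra_simps)
      then show False using \<open>\<not> p - 2 < s\<close> s(1) p1 by linarith
    qed
    moreover have "n * (p - 1) \<le> 10 * (p - 1)" using True p1 by (intro mult_right_mono) (auto simp: n_def)
    ultimately show ?thesis by argo
  next
    case False
    then have n11: "n \<ge> 11" by (simp add: n_def)
    define D B m where "D = (n - 2) * (n - 10)" and "B = (n - 2)\<^sup>2 - 4 * n" and "m = sqrt (n - 1)"
    have D: "D > 0" using n11 by (simp add: D_def)
    have m: "m > 0" "m\<^sup>2 = n - 1" using n11 by (auto simp: m_def)
    have "p < (B + 8 * m) / D" using pc False by (simp add: p_c_def D_def B_def m_def n_def)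
    then have up: "D * p - B < 8 * m" using D by (simp add: field_simps)
    show ?thesis
    proof (rule ccontr)
      assume "\<not> ?thesis"
      then have h: "4 * s \<le> (n - 6) * p - (n - 2)" by argo
      then have "(4 * s)\<^sup>2 \<le> ((n - 6) * p - (n - 2))\<^sup>2" using s by (intro power_mono) auto
      then have "16 * (p * (p - 1)) \<le> ((n - 6) * p - (n - 2))\<^sup>2" by (simp add: power_mult_distrib s)
      then have "D * (16 * (p * (p - 1))) \<le> D * ((n - 6) * p - (n - 2))\<^sup>2" using D by simp
      moreover have "D * (((n - 6) * p - (n - 2))\<^sup>2 - 16 * (p * (p - 1))) = (D * p - B)\<^sup>2 - 64 * (n - 1)"
        unfolding D_def B_def by algebra
      ultimately have "(8 * m)\<^sup>2 \<le> (D * p - B)\<^sup>2" by (simp add: power_mult_distrib m right_diff_distrib)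
      then have "8 * m \<le> \<bar>D * p - B\<bar>" using m abs_le_square_iff[of "8 * m" "D * p - B"] by simp
      \<comment> \<open>So p would be at most the smaller root. That root comes from squaring: there
        (N - 6) p - (N - 2) is negative. Quantitatively this forces (n - 6) m \<le> n + 2,
        impossible for n \<ge> 11 because m > 3.\<close>
      then have low: "D * p - B \<le> - 8 * m" using up by linarith
      have "n - 2 \<le> (n - 6) * p" using h s by linarith
      then have "D * (n - 2) \<le> D * ((n - 6) * p)" using D by simp
      moreover have "(n - 6) * (D * p - B) \<le> (n - 6) * (- 8 * m)" using low n11 by (intro mult_left_mono) auto
      moreover have "D * (n - 2) - (n - 6) * B = - (8 * n + 16)" unfolding D_def B_def by algebra
      ultimately have m_le: "(n - 6) * m \<le> n + 2" by argo
      have "m > 3"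
      proof (rule ccontr)
        assume "\<not> m > 3"
        then have "m\<^sup>2 \<le> 3\<^sup>2" using m by (intro power_mono) auto
        then show False using m n11 by simp
      qed
      then have "(n - 6) * 3 < (n - 6) * m" using n11 by (intro mult_strict_left_mono) auto
      then show False using m_le n11 by argo
    qed
  qed
  then show "N * (p - 1) / 2 < 3 * p - 1 + 2 * sqrt (p * (p - 1))" by (simp add: n_def s_def)
qed

text \<open>1 < p < \<infinity> makes q0 a real number different from 0 and 1. Then
  \<open>q_fun\<close> is finite near 0, so its quotient branch applies there, and the reciprocals
  converge to 1 / q0 = 1 - 1/p.\<close>

lemma conjugate_exponent_limit:
  fixes f :: "real \<Rightarrow> real" and p q0 :: ereal
  assumes q0: "(q_fun f \<longlongrightarrow> q0) (at_right 0)" and p: "p = conjugate_exponent q0" "1 < p" "p < \<infinity>"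
  shows "1 < real_of_ereal p" "p = ereal (real_of_ereal p)"
    "((\<lambda>t. f t * deriv (deriv f) t / (deriv f t)\<^sup>2) \<longlongrightarrow> 1 - 1 / real_of_ereal p) (at_right 0)"
proof -
  obtain r where r: "q0 = ereal r"
  proof (cases q0)
    case MInf
    \<comment> \<open>In \<open>ereal\<close> dividing by an infinite value is multiplication by 0,
      so this case contradicts p > 1.\<close>
    then have "p = 0" using p(1) by (simp add: conjugate_exponent_def one_ereal_def divide_ereal_def)
    then show ?thesis using p(2) by simp
  qed (use p in \<open>auto simp: conjugate_exponent_def\<close>)
  have "r \<noteq> 1" using p r by (auto simp: conjugate_exponent_def)
  then have pr: "p = ereal (r / (r - 1))"
    using p(1) r by (simp add: conjugate_exponent_def one_ereal_def)
  then show p1: "1 < real_of_ereal p" and "p = ereal (real_of_ereal p)" using p(2) by auto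
  have "r \<noteq> 0" using pr p1 by auto
  have "1 - 1 / real_of_ereal p = inverse r"
    using pr \<open>r \<noteq> 0\<close> \<open>r \<noteq> 1\<close> by (simp add: field_simps)
  moreover have "\<forall>\<^sub>F t in at_right 0. q_fun f t = ereal ((deriv f t)\<^sup>2 / (f t * deriv (deriv f) t))"
  proof -
    have "\<forall>\<^sub>F t in at_right 0. q_fun f t < \<infinity>"
      using order_tendstoD(2)[OF q0, of \<infinity>] r by simp
    then show ?thesis by eventually_elim (auto simp: q_fun_def split: if_splits)
  qed
  then have "((\<lambda>t. ereal ((deriv f t)\<^sup>2 / (f t * deriv (deriv f) t))) \<longlongrightarrow> ereal r) (at_right 0)"
    using q0 r by (simp add: tendsto_cong)
  then have "((\<lambda>t. (deriv f t)\<^sup>2 / (f t * deriv (deriv f) t)) \<longlongrightarrow> r) (at_right 0)" by simp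
  from tendsto_inverse[OF this \<open>r \<noteq> 0\<close>]
  have "((\<lambda>t. f t * deriv (deriv f) t / (deriv f t)\<^sup>2) \<longlongrightarrow> inverse r) (at_right 0)" by simp
  ultimately show "((\<lambda>t. f t * deriv (deriv f) t / (deriv f t)\<^sup>2) \<longlongrightarrow> 1 - 1 / real_of_ereal p) (at_right 0)"
    by simp
qed

text \<open>Everything comes from tangent lines: the one at t, evaluated at 0 where f vanishes,
  gives f t \<le> t f'(t) and hence f' > 0; comparing the tangents at two points gives monotonicity
  of f'.\<close>

lemma convex_function_derivative_facts:
  fixes f :: "real \<Rightarrow> real"
  assumes f_C2: "C2_pos f" and conv: "convex_on {0..} f" and f_pos: "\<And>t. t > 0 \<Longrightarrow> f t > 0" and f_0: "f 0 = 0"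
  shows "\<And>t. t > 0 \<Longrightarrow> (f has_real_derivative deriv f t) (at t)"
    "\<And>t. t > 0 \<Longrightarrow> (deriv f has_real_derivative deriv (deriv f) t) (at t)"
    "\<And>t. t > 0 \<Longrightarrow> f t \<le> t * deriv f t" "\<And>t. t > 0 \<Longrightarrow> deriv f t > 0" "\<And>t. t > 0 \<Longrightarrow> deriv (deriv f) t \<ge> 0"
proof -
  show d: "(f has_real_derivative deriv f t) (at t)" if "t > 0" for t
    using f_C2 that by (simp add: C2_pos_def DERIV_deriv_iff_real_differentiable)
  show d2: "(deriv f has_real_derivative deriv (deriv f) t) (at t)" if "t > 0" for t
    using f_C2 that by (simp add: C2_pos_def DERIV_deriv_iff_real_differentiable)
  have tan: "f x - f t \<ge> deriv f t * (x - t)" if "t > 0" "x \<ge> 0" for t x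
  proof (rule convex_on_imp_above_tangent[OF conv])
    show "(f has_real_derivative deriv f t) (at t within {0..})"
      using d[OF that(1)] by (rule has_field_derivative_at_within)
  qed (use that in auto)
  show le: "f t \<le> t * deriv f t" if "t > 0" for t
    using tan[OF that, of 0] f_0 by (simp add: mult.commute)
  show "deriv f t > 0" if "t > 0" for t
  proof -
    have "0 < t * deriv f t" using le[OF that] f_pos[OF that] by linarith
    then show ?thesis using that by (rule zero_less_mult_pos)
  qed
  have mono: "mono_on {0<..} (deriv f)"
  proof (rule mono_onI)
    fix s t :: real assume st: "s \<in> {0<..}" "t \<in> {0<..}" "s \<le> t"
    have "deriv f s * (t - s) \<le> deriv f t * (t - s)"
      using tan[of s t] tan[of t s] st by (simp add: algebra_simps)
    then show "deriv f s \<le> deriv f t" using st by (cases "s = t") auto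
  qed
  show "deriv (deriv f) t \<ge> 0" if "t > 0" for t
    by (rule mono_on_imp_deriv_nonneg[OF mono d2[OF that]]) (use that in \<open>simp add: interior_open\<close>)
qed

text \<open>For t < \<epsilon> the upper bound on f' becomes one on f through f \<le> t f'. For
  \<epsilon> \<le> t \<le> M monotonicity traps f between f \<epsilon> and f M. As u is bounded by
  M, one pair of constants serves all values of u.\<close>

lemma power_comparability:
  fixes f f' :: "real \<Rightarrow> real" and p \<epsilon> c1 c2 M :: real
  assumes pos: "\<And>t. t > 0 \<Longrightarrow> f t > 0" and mono: "\<And>s t. 0 < s \<Longrightarrow> s \<le> t \<Longrightarrow> f s \<le> f t"
    and le: "\<And>t. t > 0 \<Longrightarrow> f t \<le> t * f' t" and p: "p > 1" and c: "\<epsilon> > 0" "c1 > 0" "c2 > 0" "M > 0"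
    and lower: "\<And>t. 0 < t \<Longrightarrow> t < \<epsilon> \<Longrightarrow> f t \<ge> c1 * t powr p"
    and upper: "\<And>t. 0 < t \<Longrightarrow> t < \<epsilon> \<Longrightarrow> f' t \<le> c2 * t powr (p - 1)"
  obtains a1 a2 where "a1 > 0" "\<And>t. 0 < t \<Longrightarrow> t \<le> M \<Longrightarrow> a1 * t powr p \<le> f t"
    "a2 > 0" "\<And>t. 0 < t \<Longrightarrow> t \<le> M \<Longrightarrow> f t \<le> a2 * t powr p"
proof -
  define a1 a2 where "a1 = min c1 (f \<epsilon> / M powr p)" and "a2 = c2 + f M / \<epsilon> powr p"
  have a: "a1 > 0" "a2 > 0" using c pos by (auto simp: a1_def a2_def add_pos_nonneg less_imp_le)
  moreover have "a1 * t powr p \<le> f t \<and> f t \<le> a2 * t powr p" if t: "0 < t" "t \<le> M" for t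
  proof (cases "t < \<epsilon>")
    case True
    have "f t \<le> t * (c2 * t powr (p - 1))"
      using le[OF t(1)] mult_left_mono[OF upper[OF t(1) True], of t] t by linarith
    also have "\<dots> = c2 * t powr p" using t powr_add[of t 1 "p - 1"] by simp
    also have "\<dots> \<le> a2 * t powr p" using pos[OF c(4)] c by (intro mult_right_mono) (auto simp: a2_def less_imp_le)
    finally have "f t \<le> a2 * t powr p" .
    moreover have "a1 * t powr p \<le> c1 * t powr p" by (intro mult_right_mono) (auto simp: a1_def)
    ultimately show ?thesis using lower[OF t(1) True] by linarith
  next
    case False
    have "a1 * t powr p \<le> f \<epsilon> / M powr p * M powr p"
      using t p pos[OF c(1)] c by (intro mult_mono powr_mono2) (auto simp: a1_def less_imp_le)
    then have "a1 * t powr p \<le> f \<epsilon>" using c by simp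
    moreover have "f \<epsilon> \<le> f t" using False c by (intro mono) auto
    moreover have "f t \<le> f M" using t by (intro mono)
    moreover have "f M / \<epsilon> powr p * \<epsilon> powr p \<le> a2 * t powr p"
      using False t p pos[OF c(4)] c a by (intro mult_mono powr_mono2) (auto simp: a2_def less_imp_le)
    moreover have "f M / \<epsilon> powr p * \<epsilon> powr p = f M" using c by simp
    ultimately show ?thesis by linarith
  qed
  ultimately show ?thesis using that by blast
qed

theorem theorem1p24:
  fixes f :: "real \<Rightarrow> real"
    and u :: "real ^ 'n \<Rightarrow> real"
    and q0 p0 :: ereal
    and N :: nat
    and \<epsilon> c1 c2 :: real
  assumes N: "N = CARD('n)" "N \<ge> 3"
    and f_cont: "continuous_on {0..} f"
    and f_C2: "C2_pos f"
    and f_mono: "mono_on {0..} f"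
    and f_convex: "convex_on {0..} f"
    and f_pos: "\<And>t. t > 0 \<Longrightarrow> f t > 0"
    and f_0: "f 0 = 0"
    and q0: "(q_fun f \<longlongrightarrow> q0) (at_right 0)"
    and p0: "p0 = conjugate_exponent q0"
    and p0_gt: "ereal ((real N + 2) / (real N - 2)) < p0"
    and p0_lt_low: "N \<le> 10 \<Longrightarrow> p0 < \<infinity>"
    and p0_lt_high: "N \<ge> 11 \<Longrightarrow> p0 < ereal (p_c N)"
    and const_pos: "\<epsilon> > 0" "c1 > 0" "c2 > 0"
    and f_lower: "\<And>t. 0 < t \<Longrightarrow> t < \<epsilon> \<Longrightarrow> f t \<ge> c1 * t powr real_of_ereal p0"
    and f'_upper: "\<And>t. 0 < t \<Longrightarrow> t < \<epsilon> \<Longrightarrow> deriv f t \<le> c2 * t powr (real_of_ereal p0 - 1)"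
    and u_C2: "C2 u"
    and u_bounded: "bounded (range u)"
    and u_pos: "\<And>x. u x > 0"
    and u_sol: "\<And>x. - laplacian u x = f (u x)"
    and u_stable: "stable_outside_compact f u"
  shows "u \<in> o[at_infinity](\<lambda>x. norm x powr (- 2 / (real_of_ereal p0 - 1))) \<and>
         (\<lambda>x. norm (grad u x)) \<in> o[at_infinity](\<lambda>x. norm x powr (- 2 / (real_of_ereal p0 - 1) - 1))"
proof -
  define p where "p = real_of_ereal p0"
  have "p0 < \<infinity>"
  proof (cases "N \<le> 10")
    case False
    then have "p0 < ereal (p_c N)" by (intro p0_lt_high) simp
    then show ?thesis by (rule less_trans) simp
  qed (rule p0_lt_low)
  moreover have "1 < p0"
  proof -
    have "1 < (real N + 2) / (real N - 2)" using N by (simp add: field_simps)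
    then have "ereal 1 < ereal ((real N + 2) / (real N - 2))" by (simp only: less_ereal.simps)
    from less_trans[OF this p0_gt] show ?thesis by (simp add: one_ereal_def)
  qed
  ultimately have p: "1 < p" "p0 = ereal p"
    and lim: "((\<lambda>t. f t * deriv (deriv f) t / (deriv f t)\<^sup>2) \<longlongrightarrow> 1 - 1 / p) (at_right 0)"
    unfolding p_def using conjugate_exponent_limit[OF q0 p0] by blast+
  \<comment> \<open>The exponent for which the integral of u^\<sigma>0 is invariant under the
    scaling \<lambda>^\<kappa> u(\<lambda> x); this is the relation \<kappa> \<sigma>0 = N.\<close>
  define \<sigma>0 where "\<sigma>0 = N * (p - 1) / 2"
  define \<kappa> where "\<kappa> = 2 / (p - 1)"
  have \<kappa>: "\<kappa> > 0" "\<kappa> * \<sigma>0 = N" using p by (auto simp: \<kappa>_def \<sigma>0_def)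
  have dim: "DIM(real ^ 'n) = N" using N by simp
  have \<sigma>0: "p + 1 < \<sigma>0" "\<sigma>0 < 3 * p - 1 + 2 * sqrt (p * (p - 1))"
    using critical_exponent_window[of N p] N(2) p0_gt p0_lt_high unfolding p(2) \<sigma>0_def by auto
  \<comment> \<open>The strict inequality at \<sigma>0 leaves room for a second admissible exponent,
    the upper end of the interpolation.\<close>
  obtain \<sigma>1 where \<sigma>1: "\<sigma>0 < \<sigma>1" "\<sigma>1 < 3 * p - 1 + 2 * sqrt (p * (p - 1))" using dense[OF \<sigma>0(2)] by blast
  obtain M where M: "M > 0" "\<And>x. u x \<le> M"
  proof -
    obtain M where "\<And>x. \<bar>u x\<bar> \<le> M" using u_bounded by (auto simp: bounded_iff)
    then have "u x \<le> M" for x using abs_le_D1 by blast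
    moreover from this[of 0] u_pos[of 0] have "M > 0" by linarith
    ultimately show ?thesis using that by blast
  qed
  note F = convex_function_derivative_facts[OF f_C2 f_convex f_pos f_0]
  have f''c: "continuous_on {0<..} (deriv (deriv f))" using f_C2 by (simp add: C2_pos_def)
  have mono: "f s \<le> f t" if "0 < s" "s \<le> t" for s t using f_mono that by (auto simp: mono_on_def)
  obtain a1 a2 where a: "a1 > 0" "\<And>t. 0 < t \<Longrightarrow> t \<le> M \<Longrightarrow> a1 * t powr p \<le> f t"
    "a2 > 0" "\<And>t. 0 < t \<Longrightarrow> t \<le> M \<Longrightarrow> f t \<le> a2 * t powr p"
    using power_comparability[OF f_pos mono F(3) p(1) const_pos M(1) f_lower[folded p_def] f'_upper[folded p_def]]
    by blast
  obtain S where S: "compact S" "\<And>\<psi>. \<psi> \<in> C1c (- S) \<Longrightarrow>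
      (\<integral>x. deriv f (u x) * (\<psi> x)\<^sup>2 \<partial>lborel) \<le> (\<integral>x. (norm (grad \<psi> x))\<^sup>2 \<partial>lborel)"
    using u_stable by (auto simp: stable_outside_compact_def)
  obtain R0 where R0: "R0 > 0" "\<And>x. x \<in> S \<Longrightarrow> norm x < R0"
    using compact_imp_bounded[OF S(1)] by (auto simp: bounded_pos_less)
  note cu = C1_continuous[OF C2_C1[OF u_C2], of UNIV]
  have energy: "\<exists>C>0. \<forall>R1 R2. R0 \<le> R1 \<longrightarrow> 2 * R1 \<le> R2 \<longrightarrow>
      (\<integral>x. indicator {x. 2 * R1 \<le> norm x \<and> norm x \<le> R2} x * u x powr \<sigma> \<partial>lborel)
      \<le> C * (R1 powr (N - \<kappa> * \<sigma>) + R2 powr (N - \<kappa> * \<sigma>))"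
    if \<sigma>: "p + 1 < \<sigma>" "\<sigma> < 3 * p - 1 + 2 * sqrt (p * (p - 1))" for \<sigma>
  proof -
    define \<alpha> where "\<alpha> = (\<sigma> - p + 1) / (2 * p)"
    note \<alpha> = exponent_window[OF p(1) \<sigma>, folded \<alpha>_def]
    have e: "2 * \<alpha> * p + p - 1 = \<sigma>" using \<alpha>(3) by simp
    obtain C where C: "C > 0" "\<And>\<psi>. \<psi> \<in> C1c (- S) \<Longrightarrow> (\<integral>x. u x powr \<sigma> * (\<psi> x)\<^sup>2 \<partial>lborel)
      \<le> C * (\<integral>x. u x powr (2 * \<alpha> * p) * (norm (grad \<psi> x))\<^sup>2 \<partial>lborel)"
      using power_energy_estimate[OF F(1,2) f''c f_pos F(4,5) mono lim F(3) a p(1) \<alpha>(1,2) u_C2 u_pos M(2) u_sol S(2)]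
      unfolding e by blast
    have "2 * (\<sigma> / (p - 1)) = \<kappa> * \<sigma>" by (simp add: \<kappa>_def)
    then show ?thesis
      using annulus_energy_bound[OF cu u_pos p(1) _ _ C(1) C(2) R0(2) R0(1)] \<alpha>(1) p(1) e dim by simp
  qed
  obtain C0 where C0: "C0 > 0" "\<And>R1 R2. R0 \<le> R1 \<Longrightarrow> 2 * R1 \<le> R2 \<Longrightarrow>
      (\<integral>x. indicator {x. 2 * R1 \<le> norm x \<and> norm x \<le> R2} x * u x powr \<sigma>0 \<partial>lborel)
      \<le> C0 * (R1 powr (N - \<kappa> * \<sigma>0) + R2 powr (N - \<kappa> * \<sigma>0))"
    using energy[OF \<sigma>0] by blast
  \<comment> \<open>Both radii appear with exponent N - \<kappa> \<sigma>0 = 0 and are positive, so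
    each power equals 1.\<close>
  have C0': "(\<integral>x. indicator {x. 2 * R1 \<le> norm x \<and> norm x \<le> R2} x * u x powr \<sigma>0 \<partial>lborel) \<le> C0 * 2"
    if "R0 \<le> R1" "2 * R1 \<le> R2" for R1 R2
    using C0(2)[OF that] that R0(1) \<kappa>(2) by simp
  obtain C1 where C1: "C1 > 0" "\<And>R1 R2. R0 \<le> R1 \<Longrightarrow> 2 * R1 \<le> R2 \<Longrightarrow>
      (\<integral>x. indicator {x. 2 * R1 \<le> norm x \<and> norm x \<le> R2} x * u x powr \<sigma>1 \<partial>lborel)
      \<le> C1 * (R1 powr (N - \<kappa> * \<sigma>1) + R2 powr (N - \<kappa> * \<sigma>1))"
    using energy[of \<sigma>1] \<sigma>0 \<sigma>1 by (meson less_trans)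
  define \<sigma> where "\<sigma> = (\<sigma>0 + \<sigma>1) / 2"
  have \<sigma>: "\<sigma>0 < \<sigma>" "\<sigma> < \<sigma>1" "\<sigma> \<ge> 1" using \<sigma>0 \<sigma>1 p by (auto simp: \<sigma>_def)
  have lap: "- laplacian u x \<le> a2 * u x powr p" "0 \<le> - laplacian u x" for x
    using a(4)[OF u_pos M(2)] f_pos[OF u_pos] by (auto simp: u_sol less_imp_le)
  have "\<exists>R. \<forall>x. norm x \<ge> R \<longrightarrow> u x \<le> e * norm x powr (- \<kappa>)" if "e > 0" for e
  proof -
    \<comment> \<open>The estimate on B(x, |x|/2) controls (|x|/2)^\<kappa> u(x); the factor
      2^\<kappa> is therefore put into the target.\<close>
    have e': "e / 2 powr \<kappa> > 0" using that by simp
    have \<sigma>': "\<sigma> > DIM(real ^ 'n) * (p - 1) / 2" using \<sigma>(1) unfolding dim \<sigma>0_def .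
    have dim2: "2 \<le> DIM(real ^ 'n)" unfolding dim using N by simp
    obtain \<delta> where \<delta>: "\<delta> > 0" and small: "\<forall>(v :: real ^ 'n \<Rightarrow> real) x \<rho>. C2 v \<longrightarrow> (\<forall>y. v y > 0) \<longrightarrow> \<rho> > 0 \<longrightarrow>
      (\<forall>y\<in>ball x \<rho>. - laplacian v y \<le> a2 * v y powr p) \<longrightarrow>
      \<rho> powr (\<kappa> * \<sigma> - DIM(real ^ 'n)) * (\<integral>y. indicator (ball x \<rho>) y * v y powr \<sigma> \<partial>lborel) \<le> \<delta> \<longrightarrow>
      \<rho> powr \<kappa> * v x \<le> e / 2 powr \<kappa>"
      using small_energy_imp_small[OF dim2 p(1) \<sigma>(3) \<sigma>' a(3) e', folded \<kappa>_def] by blast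
    obtain R where R: "R > 0" "\<And>x. norm x \<ge> R \<Longrightarrow>
      (norm x / 2) powr (\<kappa> * \<sigma> - DIM(real ^ 'n)) * (\<integral>y. indicator (ball x (norm x / 2)) y * u y powr \<sigma> \<partial>lborel) \<le> \<delta>"
      using rescaled_energy_small[OF cu u_pos \<sigma>(1,2) _ \<kappa>(1) R0(1) C0' C1(1) _ \<delta>] C1(2) \<kappa>(2) unfolding dim by blast
    have "u x \<le> e * norm x powr (- \<kappa>)" if x: "norm x \<ge> R" for x
    proof -
      have x0: "norm x > 0" using x R(1) by linarith
      have "(norm x / 2) powr \<kappa> * u x \<le> e / 2 powr \<kappa>"
        using R(2)[OF x] x0 by (intro small[rule_format] u_C2 u_pos lap) auto
      moreover have "(norm x / 2) powr \<kappa> = norm x powr \<kappa> / 2 powr \<kappa>" using x0 by (simp add: powr_divide)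
      ultimately have "norm x powr \<kappa> * u x \<le> e" by (simp add: divide_le_cancel)
      then show ?thesis using x0 by (simp add: powr_minus field_simps)
    qed
    then show ?thesis by blast
  qed
  from decay_with_gradient[OF u_C2 u_pos p(1) \<kappa>_def lap(2) lap(1) a(3) this]
  show ?thesis by (simp add: \<kappa>_def p_def)
qed

end
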